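(* The optimal control problem $$\min_{(\psi,u)}\ J(\psi,u)=\tfrac12\langle\psi(T),\mathcal O\psi(T)\rangle_{\mathcal H}+\alpha\lVert u\rVert_{\mathcal M}$$ over $u\in\mathcal M(\Omega;\mathcal U)$ and $\psi\in C([0,T];\mathcal H)$, subject to $\psi$ being the mild solution with control field $Bu$, i.e. $$\psi(t)=G(t)\psi_0+\int_0^tG(t-s)\,(Bu)(s)\cdot\tilde H\,\psi(s)\,ds\quad\text{for all }t\in[0,T],$$ possesses a solution $(\bar\psi,\bar u)\in C([0,T];\mathcal H)\times\mathcal M(\Omega;\mathcal U)$.
   Context: $\mathcal H$ is a complex Hilbert space, regarded as a real Hilbert space with inner product $\langle a,b\rangle_{\mathcal H}=\operatorname{Re}(a,b)$. $H_0$ is a (possibly unbounded) self-adjoint operator on $\mathcal H$, $G(t)=e^{-itH_0}$ is the unitary group generated by $-iH_0$, $H_1,\dots,H_L$ are bounded self-adjoint operators on $\mathcal H$, and $w\cdot\tilde H=\sum_{l=1}^L w_l(-iH_l)$ for $w\in\mathbb R^L$. $T>0$, $\psi_0\in\mathcal H$, $\alpha>0$, and $\mathcal O$ is a bounded linear operator on $\mathcal H$. For every control field in $L^1(0,T;\mathbb R^L)$ the integral equation has a unique solution in $C([0,T];\mathcal H)$. $\Omega$ is a locally compact space and $\mathcal U$ a separable (real) Hilbert space. $C_0(\Omega;\mathcal U)$ denotes the continuous functions $\Omega\to\mathcal U$ that are uniform limits of compactly supported ones, with the sup norm; $\mathcal M(\Omega;\mathcal U)$ is the space of $\mathcal U$-valued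 Borel measures on $\Omega$ with finite total variation $\lVert u\rVert_{\mathcal M}=|u|(\Omega)$, identified with the dual of $C_0(\Omega;\mathcal U)$ via $\langle u,\varphi\rangle=\int_\Omega\langle u'(\omega),\varphi(\omega)\rangle_{\mathcal U}\,d|u|(\omega)$, where $u'$ is the Radon–Nikodym derivative of $u$ with respect to $|u|$. $B:\mathcal M(\Omega;\mathcal U)\to L^p(0,T;\mathbb R^L)$, for some $1<p\le\infty$, is a bounded linear operator possessing a bounded linear predual $B^*:L^q(0,T;\mathbb R^L)\to C_0(\Omega;\mathcal U)$ ($1/p+1/q=1$), i.e. $\langle B^*f,u\rangle_{C_0,\mathcal M}=\int_0^T f(t)\cdot(Bu)(t)\,dt$ for all $f\in L^q$, $u\in\mathcal M(\Omega;\mathcal U)$. *)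

theory Defs
  imports "HOL-Analysis.Analysis"
begin

text \<open>H is a complex Hilbert space regarded as a real Hilbert space with inner
 product Re(a,b). Multiplication by the imaginary unit is the real-linear map J.\<close>

definition complex_structure :: "('h::real_inner \<Rightarrow> 'h) \<Rightarrow> bool" where
  "complex_structure J \<longleftrightarrow> bounded_linear J \<and> (\<forall>x. J (J x) = - x)
      \<and> (\<forall>x y. inner (J x) (J y) = inner x y)"

definition cbounded_linear :: "('h::real_inner \<Rightarrow> 'h) \<Rightarrow> ('h \<Rightarrow> 'h) \<Rightarrow> bool" where
  "cbounded_linear J A \<longleftrightarrow> bounded_linear A \<and> (\<forall>x. A (J x) = J (A x))"

text \<open>bounded self-adjoint operator (complex-linear and symmetric; for complex-linear
 operators symmetry of the real part Re(.,.) is equivalent to complex self-adjointness)\<close>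
definition bounded_selfadjoint :: "('h::real_inner \<Rightarrow> 'h) \<Rightarrow> ('h \<Rightarrow> 'h) \<Rightarrow> bool" where
  "bounded_selfadjoint J A \<longleftrightarrow> cbounded_linear J A \<and> (\<forall>x y. inner (A x) y = inner x (A y))"

definition selfadjoint_op :: "('h::real_inner \<Rightarrow> 'h) \<Rightarrow> 'h set \<Rightarrow> ('h \<Rightarrow> 'h) \<Rightarrow> bool" where
  "selfadjoint_op J D A \<longleftrightarrow>
     subspace D \<and> (\<forall>x\<in>D. J x \<in> D) \<and> closure D = UNIV
   \<and> (\<forall>x\<in>D. \<forall>y\<in>D. \<forall>a b. A (a *\<^sub>R x + b *\<^sub>R y) = a *\<^sub>R A x + b *\<^sub>R A y)
   \<and> (\<forall>x\<in>D. A (J x) = J (A x))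
   \<and> (\<forall>x\<in>D. \<forall>y\<in>D. inner (A x) y = inner x (A y))
   \<and> (\<forall>y z. (\<forall>x\<in>D. inner (A x) y = inner x z) \<longrightarrow> y \<in> D)"

definition unitary_group_generated :: "('h::real_inner \<Rightarrow> 'h) \<Rightarrow> 'h set \<Rightarrow> ('h \<Rightarrow> 'h)
     \<Rightarrow> (real \<Rightarrow> 'h \<Rightarrow> 'h) \<Rightarrow> bool" where
  "unitary_group_generated J D A G \<longleftrightarrow>
     (\<forall>t. cbounded_linear J (G t) \<and> (\<forall>x. norm (G t x) = norm x))
   \<and> G 0 = id \<and> (\<forall>s t. G (s + t) = G s \<circ> G t)
   \<and> (\<forall>x. continuous_on UNIV (\<lambda>t. G t x))
   \<and> (\<forall>x. x \<in> D \<longleftrightarrow> (\<exists>v. ((\<lambda>t. G t x) has_vector_derivative v) (at 0)))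
   \<and> (\<forall>x\<in>D. ((\<lambda>t. G t x) has_vector_derivative (- J (A x))) (at 0))"

text \<open>w \<cdot> H~ applied to x, where H~_l = -i H_l\<close>
definition ctrl_op :: "('h::real_inner \<Rightarrow> 'h) \<Rightarrow> ('l::finite \<Rightarrow> 'h \<Rightarrow> 'h) \<Rightarrow> real^'l \<Rightarrow> 'h \<Rightarrow> 'h" where
  "ctrl_op J Hs w x = (\<Sum>l\<in>UNIV. (w $ l) *\<^sub>R (- J (Hs l x)))"

definition mild_solution :: "('h::real_inner \<Rightarrow> 'h) \<Rightarrow> (real \<Rightarrow> 'h \<Rightarrow> 'h)
     \<Rightarrow> ('l::finite \<Rightarrow> 'h \<Rightarrow> 'h) \<Rightarrow> 'h \<Rightarrow> real \<Rightarrow> (real \<Rightarrow> real^'l) \<Rightarrow> (real \<Rightarrow> 'h) \<Rightarrow> bool" where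
  "mild_solution J G Hs psi0 T w psi \<longleftrightarrow>
     continuous_on {0..T} psi \<and>
     (\<forall>t\<in>{0..T}. ((\<lambda>s. G (t - s) (ctrl_op J Hs (w s) (psi s))) has_integral (psi t - G t psi0)) {0..t})"

definition Lp_space :: "ereal \<Rightarrow> real \<Rightarrow> (real \<Rightarrow> real^'l::finite) set" where
  "Lp_space p T = {f. f \<in> borel_measurable (lebesgue_on {0..T}) \<and>
     (if p = \<infinity> then (\<exists>C. AE t in lebesgue_on {0..T}. norm (f t) \<le> C)
      else integrable (lebesgue_on {0..T}) (\<lambda>t. norm (f t) powr real_of_ereal p))}"

definition Lp_norm :: "ereal \<Rightarrow> real \<Rightarrow> (real \<Rightarrow> real^'l::finite) \<Rightarrow> real" where
  "Lp_norm p T f = (if p = \<infinity> then Inf {C. 0 \<le> C \<and> (AE t in lebesgue_on {0..T}. norm (f t) \<le> C)}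
     else (integral\<^sup>L (lebesgue_on {0..T}) (\<lambda>t. norm (f t) powr real_of_ereal p)) powr (1 / real_of_ereal p))"

definition total_variation :: "('w::topological_space set \<Rightarrow> 'u::real_normed_vector) \<Rightarrow> 'w set \<Rightarrow> ennreal" where
  "total_variation u A = (SUP P \<in> {P. finite P \<and> disjoint P \<and> \<Union>P = A \<and> P \<subseteq> sets borel}.
       \<Sum>B\<in>P. ennreal (norm (u B)))"

definition vmeasures :: "('w::topological_space set \<Rightarrow> 'u::real_normed_vector) set" where
  "vmeasures = {u. (\<forall>A. A \<notin> sets borel \<longrightarrow> u A = 0)
     \<and> (\<forall>A::nat \<Rightarrow> 'w set. range A \<subseteq> sets borel \<longrightarrow> disjoint_family A \<longrightarrow> (\<lambda>n. u (A n)) sums u (\<Union>n. A n))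
     \<and> total_variation u UNIV < \<infinity>}"

definition vm_norm :: "('w::topological_space set \<Rightarrow> 'u::real_normed_vector) \<Rightarrow> real" where
  "vm_norm u = enn2real (total_variation u UNIV)"

definition vm_abs :: "('w::topological_space set \<Rightarrow> 'u::real_normed_vector) \<Rightarrow> 'w measure" where
  "vm_abs u = measure_of UNIV (sets borel) (total_variation u)"

definition vm_density :: "('w::topological_space set \<Rightarrow> 'u::{banach,second_countable_topology})
     \<Rightarrow> ('w \<Rightarrow> 'u) \<Rightarrow> bool" where
  "vm_density u g \<longleftrightarrow> integrable (vm_abs u) g \<and>
     (\<forall>A\<in>sets borel. u A = (LINT x:A|vm_abs u. g x))"

definition vm_pair :: "('w::topological_space set \<Rightarrow> 'u::{real_inner,banach,second_countable_topology})
     \<Rightarrow> ('w \<Rightarrow> 'u) \<Rightarrow> real" where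
  "vm_pair u phi = (THE c. \<exists>g. vm_density u g \<and> c = (\<integral>x. inner (g x) (phi x) \<partial>vm_abs u))"

definition C0_space :: "('w::topological_space \<Rightarrow> 'u::real_normed_vector) set" where
  "C0_space = {phi. continuous_on UNIV phi \<and>
     (\<forall>e>0. \<exists>psi. continuous_on UNIV psi \<and> compact (closure {x. psi x \<noteq> 0})
                  \<and> (\<forall>x. norm (phi x - psi x) \<le> e))}"

definition sup_norm :: "('w \<Rightarrow> 'u::real_normed_vector) \<Rightarrow> real" where
  "sup_norm phi = Sup (range (\<lambda>x. norm (phi x)))"

definition control_operator :: "ereal \<Rightarrow> ereal \<Rightarrow> real
     \<Rightarrow> (('w::topological_space set \<Rightarrow> 'u::{real_inner,banach,second_countable_topology}) \<Rightarrow> real \<Rightarrow> real^'l::finite)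
     \<Rightarrow> ((real \<Rightarrow> real^'l) \<Rightarrow> 'w \<Rightarrow> 'u) \<Rightarrow> bool" where
  "control_operator p q T B Bs \<longleftrightarrow>
     \<comment> \<open>B : M(Omega;U) -> L^p(0,T;R^L) bounded linear\<close>
     (\<forall>u\<in>vmeasures. B u \<in> Lp_space p T)
   \<and> (\<forall>u\<in>vmeasures. \<forall>v\<in>vmeasures. \<forall>a b.
        AE t in lebesgue_on {0..T}. B (\<lambda>A. a *\<^sub>R u A + b *\<^sub>R v A) t = a *\<^sub>R B u t + b *\<^sub>R B v t)
   \<and> (\<exists>C. \<forall>u\<in>vmeasures. Lp_norm p T (B u) \<le> C * vm_norm u)
     \<comment> \<open>B^* : L^q(0,T;R^L) -> C_0(Omega;U) bounded linear\<close>
   \<and> (\<forall>f\<in>Lp_space q T. Bs f \<in> C0_space)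
   \<and> (\<forall>f\<in>Lp_space q T. \<forall>g\<in>Lp_space q T. \<forall>a b.
        Bs (\<lambda>t. a *\<^sub>R f t + b *\<^sub>R g t) = (\<lambda>x. a *\<^sub>R Bs f x + b *\<^sub>R Bs g x))
   \<and> (\<exists>C. \<forall>f\<in>Lp_space q T. sup_norm (Bs f) \<le> C * Lp_norm q T f)
     \<comment> \<open>predual relation\<close>
   \<and> (\<forall>f\<in>Lp_space q T. \<forall>u\<in>vmeasures.
        vm_pair u (Bs f) = (\<integral>t. f t \<bullet> B u t \<partial>lebesgue_on {0..T}))"

end

theory Submission
  imports Defs
begin

text \<open>
  A minimising sequence has bounded measure norms, because the norm of the state is conserved and
  the observable term is thus bounded below. Viewing the measures as functionals on \<open>C\<^sub>0\<close>, Tychonoff's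
  theorem gives a cluster point, along a filter rather than a subsequence since \<open>C\<^sub>0\<close> need not be
  separable. It is represented by a measure with no larger norm by Riesz' theorem, and the predual
  relation turns the convergence of the measures into weak convergence of the controls: their
  integrals over intervals converge.

  Since \<open>p > 1\<close>, the controls are equi-integrable. In the interaction picture \<open>\<phi>(t) = G(-t) \<psi>(t)\<close> the
  state equation is an integral equation with bounded skew operators, and weakly convergent
  equi-integrable controls yield strongly convergent end states. Hence the observable term, although
  not convex, passes to the limit, while the measure norm is lower semicontinuous.

  Riesz' theorem is proved directly for vector-valued functions: with \<open>\<lambda>(V)\<close> the supremum of the
  functional over functions of norm at most 1 vanishing outside the open set \<open>V\<close>, the outer measure
  generated by \<open>\<lambda>\<close> dominates the functional, which therefore extends from \<open>C\<^sub>0\<close> to indicator functions.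
\<close>


subsection \<open>Evolution under skew bounded operators\<close>

text \<open>Weak convergence of the controls yields strong convergence of the end states because the
  controls take values in the finite-dimensional \<open>real^'l\<close>. In the equation for the
  difference of two trajectories, the difference of the controls multiplies only the limit
  trajectory, a fixed continuous curve, and an oscillating scalar factor averages out uniformly
  against such a curve; no compactness of the operators enters. The interaction picture makes this
  possible: it removes the unbounded generator, at the price of time-dependent operators that are
  only strongly continuous, which is all that a single curve requires. The limit trajectory is
  supplied by well-posedness, not by compactness of trajectories.

  The filter dictates the style of the estimates. It need not have a countable base, so dominated
  convergence along it is not at hand, and only finitely many convergence statements can be
  combined. Hence stability is quantitative: one tolerance on the primitives of the control
  differences serves all competitors with the same mass bounds, and a finite grid in time reaches
  it.\<close>

lemma has_integral_increment:
  fixes g \<Phi> :: "real \<Rightarrow> real"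
  assumes "\<And>t. t \<in> {0..T} \<Longrightarrow> (g has_integral \<Phi> t) {0..t}" and "0 \<le> s" "s \<le> t" "t \<le> T"
  shows "(g has_integral (\<Phi> t - \<Phi> s)) {s..t}"
proof -
  have t: "(g has_integral \<Phi> t) {0..t}" and s: "(g has_integral \<Phi> s) {0..s}"
    using assms by auto
  then have "g integrable_on {s..t}"
    by (metis assms(2) atLeastatMost_subset_iff has_integral_integrable integrable_subinterval_real order_refl)
  then obtain I where I: "(g has_integral I) {s..t}" by blast
  have "(g has_integral \<Phi> s + I) {0..t}"
    using has_integral_combine[OF assms(2,3) s I] .
  then have "\<Phi> t = \<Phi> s + I" using t has_integral_unique by blast
  then show ?thesis using I by simp
qed

lemma integral_increment:
  fixes h :: "real \<Rightarrow> real"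
  assumes "h integrable_on {0..T}" "0 \<le> r" "r \<le> s" "s \<le> T"
  shows "integral {r..s} h = integral {0..s} h - integral {0..r} h"
  by (intro integral_unique has_integral_increment[OF _ assms(2-4)] integrable_integral
      integrable_subinterval_real[OF assms(1)]) auto

lemma absolutely_integrable_vec_nth:
  fixes w :: "real \<Rightarrow> real^'l"
  assumes "w absolutely_integrable_on S"
  shows "(\<lambda>r. w r $ l) absolutely_integrable_on S"
  using absolutely_integrable_component[OF assms, of "axis l 1"] by (simp add: inner_axis)

lemma integrable_mult_inner_continuous:
  fixes f :: "real \<Rightarrow> 'h::real_inner" and v :: "real \<Rightarrow> real"
  assumes v: "v absolutely_integrable_on {0..T}" and f: "continuous_on {0..T} f"
  shows "(\<lambda>r. v r * inner (f r) x) integrable_on {0..T}"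
proof -
  have fx: "continuous_on {0..T} (\<lambda>r. inner (f r) x)"
    by (intro continuous_intros f)
  have "(\<lambda>r. inner (f r) x * v r) absolutely_integrable_on {0..T}"
  proof (rule absolutely_integrable_bounded_measurable_product_real[OF _ _ _ v])
    show "(\<lambda>r. inner (f r) x) \<in> borel_measurable (lebesgue_on {0..T})"
      by (rule continuous_imp_measurable_on_sets_lebesgue[OF fx]) simp
    show "bounded ((\<lambda>r. inner (f r) x) ` {0..T})"
      by (rule compact_imp_bounded[OF compact_continuous_image[OF fx compact_Icc]])
  qed simp
  then show ?thesis by (simp add: absolutely_integrable_on_def mult.commute)
qed

lemma has_integral_bound_abs_integrable:
  fixes g :: "real \<Rightarrow> real" and w :: "real \<Rightarrow> 'b::euclidean_space"
  assumes "(g has_integral I) {s..t}" "w absolutely_integrable_on {0..T}" "0 \<le> s" "t \<le> T"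
    and "\<And>r. r \<in> {s..t} \<Longrightarrow> \<bar>g r\<bar> \<le> b * norm (w r)"
  shows "\<bar>I\<bar> \<le> b * integral {s..t} (\<lambda>r. norm (w r))"
proof -
  have "(\<lambda>r. norm (w r)) integrable_on {0..T}"
    using assms(2) by (simp add: absolutely_integrable_on_def)
  then have int: "(\<lambda>r. b * norm (w r)) integrable_on {s..t}"
    by (metis assms(3,4) atLeastatMost_subset_iff integrable_on_mult_right integrable_subinterval_real)
  have "norm (integral {s..t} g) \<le> integral {s..t} (\<lambda>r. b * norm (w r))"
    by (rule integral_norm_bound_integral) (use assms int in auto)
  then show ?thesis using assms(1) by (simp add: integral_unique)
qed

text \<open>Telescoping over \<open>N\<close> steps of length \<open>t / N\<close>. The
  contributions of \<open>m\<close> are increments and add up independently of \<open>N\<close>;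
  only \<open>\<kappa>\<close> is multiplied by \<open>N\<close>, so it has to be made small after
  \<open>N\<close> is fixed.\<close>

lemma grid_chain:
  fixes g m :: "real \<Rightarrow> real"
  assumes "N > 0" "0 \<le> t" "t \<le> T"
    and step: "\<And>r s. 0 \<le> r \<Longrightarrow> r \<le> s \<Longrightarrow> s \<le> T \<Longrightarrow> s - r \<le> T / real N \<Longrightarrow>
       \<bar>g s - g r\<bar> \<le> m s - m r + \<kappa>"
  shows "\<bar>g t - g 0\<bar> \<le> m t - m 0 + real N * \<kappa>"
proof -
  have "\<bar>g (real i * (t / real N)) - g 0\<bar> \<le> m (real i * (t / real N)) - m 0 + real i * \<kappa>"
    if "i \<le> N" for i
    using that
  proof (induction i)
    case (Suc i)
    have "real (Suc i) * t \<le> real N * t"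
      using Suc.prems assms(2) by (intro mult_right_mono) auto
    then have "real (Suc i) * (t / real N) \<le> t" using assms(1) by (simp add: field_simps)
    moreover have "t / real N \<le> T / real N" using assms by (simp add: divide_right_mono)
    moreover have "real (Suc i) * (t / real N) - real i * (t / real N) = t / real N"
      by (simp add: algebra_simps add_divide_distrib)
    moreover have "0 \<le> t / real N" using assms by simp
    ultimately have "\<bar>g (real (Suc i) * (t / real N)) - g (real i * (t / real N))\<bar>
        \<le> m (real (Suc i) * (t / real N)) - m (real i * (t / real N)) + \<kappa>"
      using assms by (intro step) (auto intro: order_trans simp: algebra_simps)
    then show ?case using Suc by (simp add: algebra_simps)
  qed simp
  from this[of N] show ?thesis using assms(1) by simp
qed

lemma obtain_grid_below:
  assumes "(d::real) > 0"
  obtains N :: nat where "N > 0" "T / real N < d"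
proof -
  obtain N :: nat where N: "\<bar>T\<bar> / d < real N" using reals_Archimedean2 by blast
  then have "\<bar>T\<bar> < real N * d" using assms by (simp add: field_simps)
  moreover have "0 < real N" by (rule le_less_trans[OF _ N]) (use assms in simp)
  ultimately have "T / real N < d" by (simp add: field_simps)
  then show ?thesis using that \<open>0 < real N\<close> by simp
qed

text \<open>\<open>F l s\<close> models the conjugated control operator G(-s) (-i H_l) G(s).
  Continuity is asked along continuous curves only, since the conjugating group is strongly but in
  general not norm continuous.\<close>

locale skew_family =
  fixes F :: "'l::finite \<Rightarrow> real \<Rightarrow> 'h::real_inner \<Rightarrow> 'h" and c T :: real
  assumes T_pos: "0 < T" and c_pos: "0 < c"
    and F_diff: "F l s (x - y) = F l s x - F l s y"
    and F_bound: "norm (F l s x) \<le> c * norm x"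
    and F_skew: "inner (F l s x) x = 0"
    and F_cont: "continuous_on {0..T} \<phi> \<Longrightarrow> continuous_on {0..T} (\<lambda>s. F l s (\<phi> s))"
begin

definition field :: "real^'l \<Rightarrow> real \<Rightarrow> 'h \<Rightarrow> 'h" where
  "field w s x = (\<Sum>l\<in>UNIV. (w $ l) *\<^sub>R F l s x)"

definition K :: real where "K = c * real CARD('l)"

lemma K_pos: "0 < K"
  unfolding K_def using c_pos by (simp add: zero_less_card_finite)

lemma inner_field: "inner (field w s x) y = (\<Sum>l\<in>UNIV. w $ l * inner (F l s x) y)"
  by (simp add: field_def inner_sum_left)

lemma field_bound: "norm (field w s x) \<le> K * norm w * norm x"
proof -
  have "norm (field w s x) \<le> (\<Sum>l\<in>(UNIV::'l set). norm w * (c * norm x))"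
    unfolding field_def
  proof (rule order_trans[OF norm_sum sum_mono])
    fix l
    show "norm ((w $ l) *\<^sub>R F l s x) \<le> norm w * (c * norm x)"
      unfolding norm_scaleR using F_bound[of l s x] component_le_norm_cart[of w l]
      by (intro mult_mono) auto
  qed
  then show ?thesis by (simp add: K_def mult_ac)
qed

lemma inner_field_bound: "\<bar>inner (field w s x) y\<bar> \<le> K * norm x * norm y * norm w"
proof -
  have "\<bar>inner (field w s x) y\<bar> \<le> norm (field w s x) * norm y"
    by (rule Cauchy_Schwarz_ineq2)
  also have "\<dots> \<le> (K * norm w * norm x) * norm y"
    by (intro mult_right_mono field_bound) simp
  finally show ?thesis by (simp add: mult_ac)
qed

lemma field_skew: "inner (field w s x) x = 0"
  by (simp add: inner_field F_skew)

lemma field_diff: "field w s (x - y) = field w s x - field w s y"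
  by (simp add: field_def F_diff scaleR_diff_right sum_subtractf)

lemma field_diff_control: "field (w - v) s x = field w s x - field v s x"
  by (simp add: field_def scaleR_diff_left sum_subtractf)

text \<open>The integral equation is tested against vectors: the state space of the theorem is complete
  but not of class \<open>banach\<close>, which the library requires for most facts on vector-valued integrals.\<close>
definition evolves :: "(real \<Rightarrow> real^'l) \<Rightarrow> (real \<Rightarrow> 'h) \<Rightarrow> bool" where
  "evolves w \<phi> \<longleftrightarrow> continuous_on {0..T} \<phi> \<and>
     (\<forall>x. \<forall>t\<in>{0..T}. ((\<lambda>s. inner (field (w s) s (\<phi> s)) x) has_integral inner (\<phi> t - \<phi> 0) x) {0..t})"

lemma evolves_increment:
  assumes "evolves w \<phi>" "0 \<le> s" "s \<le> t" "t \<le> T"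
  shows "((\<lambda>r. inner (field (w r) r (\<phi> r)) x) has_integral inner (\<phi> t - \<phi> s) x) {s..t}"
  using has_integral_increment[of T "\<lambda>r. inner (field (w r) r (\<phi> r)) x" "\<lambda>t. inner (\<phi> t - \<phi> 0) x", OF _ assms(2-4)]
    assms(1) by (simp add: evolves_def inner_diff_left)

text \<open>The control is only integrable and the equation is in tested integral form, so the
  squared norm is not differentiated. Its increment over a step is
  \<open>inner (\<phi> s - \<phi> r) (\<phi> s + \<phi> r)\<close>; skewness at time
  \<open>q\<close> allows \<open>\<phi> q\<close> to be subtracted twice from the second factor,
  which leaves at most \<open>2 * e\<close> if \<open>\<phi>\<close> varies by less than
  \<open>e\<close> on the step. Summed against the mass of \<open>w\<close> this is \<open>e\<close>
  times a constant.\<close>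

lemma evolves_norm:
  assumes ev: "evolves w \<phi>" and w: "w absolutely_integrable_on {0..T}" and t: "t \<in> {0..T}"
  shows "norm (\<phi> t) = norm (\<phi> 0)"
proof -
  have cont: "continuous_on {0..T} \<phi>" using ev by (simp add: evolves_def)
  obtain R where R: "\<And>s. s \<in> {0..T} \<Longrightarrow> norm (\<phi> s) \<le> R"
    using compact_imp_bounded[OF compact_continuous_image[OF cont compact_Icc]]
    unfolding bounded_iff by (metis image_eqI)
  define W where "W s = integral {0..s} (\<lambda>r. norm (w r))" for s
  have wint: "(\<lambda>r. norm (w r)) integrable_on {0..T}"
    using w by (simp add: absolutely_integrable_on_def)
  have Wi: "integral {r..s} (\<lambda>r. norm (w r)) = W s - W r" if "0 \<le> r" "r \<le> s" "s \<le> T" for r s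
    unfolding W_def by (rule integral_increment[OF wint that])
  have R0: "0 \<le> R" using R[of 0] T_pos norm_ge_zero[of "\<phi> 0"] by (simp del: norm_ge_zero)
  have est: "\<bar>(norm (\<phi> t))\<^sup>2 - (norm (\<phi> 0))\<^sup>2\<bar> \<le> e * (2 * K * R * (W t - W 0))" if e: "e > 0" for e
  proof -
    obtain d where d: "d > 0"
      "\<And>r s. r \<in> {0..T} \<Longrightarrow> s \<in> {0..T} \<Longrightarrow> dist r s < d \<Longrightarrow> dist (\<phi> r) (\<phi> s) < e"
      using compact_uniformly_continuous[OF cont compact_Icc] e
      unfolding uniformly_continuous_on_def by metis
    obtain N :: nat where N: "N > 0" "T / real N < d" using obtain_grid_below[OF d(1)] .
    have "\<bar>(norm (\<phi> t))\<^sup>2 - (norm (\<phi> 0))\<^sup>2\<bar> \<le> e * (2 * K * R * W t) - e * (2 * K * R * W 0) + real N * 0"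
    proof (rule grid_chain[OF N(1)])
      fix r s assume rs: "0 \<le> r" "r \<le> s" "s \<le> T" "s - r \<le> T / real N"
      have "\<bar>inner (\<phi> s - \<phi> r) (\<phi> s + \<phi> r)\<bar> \<le> (K * R * (2 * e)) * integral {r..s} (\<lambda>r. norm (w r))"
      proof (rule has_integral_bound_abs_integrable[OF evolves_increment[OF ev rs(1-3)] w rs(1,3)])
        fix q assume q: "q \<in> {r..s}"
        have "dist (\<phi> s) (\<phi> q) < e" "dist (\<phi> r) (\<phi> q) < e"
          using rs q N by (intro d(2); auto simp: dist_real_def)+
        then have "norm ((\<phi> s - \<phi> q) + (\<phi> r - \<phi> q)) \<le> 2 * e"
          by (intro order_trans[OF norm_triangle_ineq]) (simp add: dist_norm)
        moreover have "inner (field (w q) q (\<phi> q)) (\<phi> s + \<phi> r)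
          = inner (field (w q) q (\<phi> q)) ((\<phi> s - \<phi> q) + (\<phi> r - \<phi> q))"
          using field_skew[of "w q" q "\<phi> q"] by (simp add: inner_diff_right inner_add_right)
        moreover have "\<bar>inner (field (w q) q (\<phi> q)) ((\<phi> s - \<phi> q) + (\<phi> r - \<phi> q))\<bar>
            \<le> K * norm (\<phi> q) * norm ((\<phi> s - \<phi> q) + (\<phi> r - \<phi> q)) * norm (w q)"
          by (rule inner_field_bound)
        moreover have "K * norm (\<phi> q) * norm ((\<phi> s - \<phi> q) + (\<phi> r - \<phi> q)) * norm (w q)
            \<le> K * R * (2 * e) * norm (w q)" if "norm ((\<phi> s - \<phi> q) + (\<phi> r - \<phi> q)) \<le> 2 * e"
          using that R[of q] q rs K_pos R0 by (intro mult_right_mono mult_mono) auto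
        ultimately show "\<bar>inner (field (w q) q (\<phi> q)) (\<phi> s + \<phi> r)\<bar> \<le> K * R * (2 * e) * norm (w q)"
          by linarith
      qed
      moreover have "inner (\<phi> s - \<phi> r) (\<phi> s + \<phi> r) = (norm (\<phi> s))\<^sup>2 - (norm (\<phi> r))\<^sup>2"
        by (simp add: power2_norm_eq_inner inner_diff_left inner_add_right inner_commute[of "\<phi> r" "\<phi> s"])
      ultimately show "\<bar>(norm (\<phi> s))\<^sup>2 - (norm (\<phi> r))\<^sup>2\<bar>
          \<le> e * (2 * K * R * W s) - e * (2 * K * R * W r) + 0"
        using Wi[OF rs(1-3)] by (simp add: algebra_simps)
    qed (use t in auto)
    then show ?thesis by (simp add: algebra_simps)
  qed
  have "\<bar>(norm (\<phi> t))\<^sup>2 - (norm (\<phi> 0))\<^sup>2\<bar> \<le> 0"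
  proof (rule field_le_epsilon)
    fix e :: real assume e: "e > 0"
    let ?C = "\<bar>2 * K * R * (W t - W 0)\<bar> + 1"
    have "\<bar>(norm (\<phi> t))\<^sup>2 - (norm (\<phi> 0))\<^sup>2\<bar> \<le> e / ?C * (2 * K * R * (W t - W 0))"
      using e by (intro est) (auto intro: divide_pos_pos add_nonneg_pos)
    also have "\<dots> \<le> e / ?C * ?C" using e by (intro mult_left_mono) auto
    also have "\<dots> = e" by (smt (verit) nonzero_eq_divide_eq)
    finally show "\<bar>(norm (\<phi> t))\<^sup>2 - (norm (\<phi> 0))\<^sup>2\<bar> \<le> 0 + e" by simp
  qed
  then show ?thesis by simp
qed


text \<open>Riemann-Lebesgue argument: with \<open>f\<close> frozen at the left end of each grid
  cell, the integral of \<open>v\<close> over the cell is a difference of two primitives and thus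
  small, while freezing costs the oscillation of \<open>f\<close> times the mass of
  \<open>v\<close>. The grid depends on \<open>f\<close>, \<open>e\<close> and \<open>M\<close>
  alone, so one \<open>\<delta>\<close> serves all \<open>v\<close>, \<open>x\<close> and
  \<open>t\<close>; uniformity in \<open>x\<close> matters because the test vector will depend on
  the solution.\<close>

lemma oscillation_residual1:
  fixes f :: "real \<Rightarrow> 'h"
  assumes f: "continuous_on {0..T} f" and e: "e > 0"
  shows "\<exists>\<delta>>0. \<forall>v x t. v absolutely_integrable_on {0..T} \<longrightarrow> integral {0..T} (\<lambda>r. \<bar>v r\<bar>) \<le> M \<longrightarrow>
       (\<forall>t \<in> {0..T}. \<bar>integral {0..t} v\<bar> \<le> \<delta>) \<longrightarrow> t \<in> {0..T} \<longrightarrow>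
       \<bar>integral {0..t} (\<lambda>r. v r * inner (f r) x)\<bar> \<le> e * norm x"
proof -
  obtain R0 where R0: "\<And>s. s \<in> {0..T} \<Longrightarrow> norm (f s) \<le> R0"
    using compact_imp_bounded[OF compact_continuous_image[OF f compact_Icc]]
    unfolding bounded_iff by (metis image_eqI)
  define R where "R = \<bar>R0\<bar> + 1"
  have R: "norm (f s) \<le> R" if "s \<in> {0..T}" for s using R0[OF that] by (simp add: R_def)
  have Rpos: "R > 0" by (simp add: R_def)
  \<comment> \<open>Freezing \<open>f\<close> costs at most \<open>e1\<close> times the mass bound,
    hence at most \<open>e / 2\<close>.\<close>
  define e1 where "e1 = e / (2 * (\<bar>M\<bar> + 1))"
  have e1: "e1 > 0" using e by (simp add: e1_def)
  obtain d where d: "d > 0"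
    "\<And>r s. r \<in> {0..T} \<Longrightarrow> s \<in> {0..T} \<Longrightarrow> dist r s < d \<Longrightarrow> dist (f r) (f s) < e1"
    using compact_uniformly_continuous[OF f compact_Icc] e1
    unfolding uniformly_continuous_on_def by metis
  obtain N :: nat where N: "N > 0" "T / real N < d" using obtain_grid_below[OF d(1)] .
  \<comment> \<open>Each of the \<open>N\<close> cells contributes at most
    \<open>2 * \<delta> * R * norm x\<close>, in total \<open>e / 2 * norm x\<close>.\<close>
  define \<delta> where "\<delta> = e / (4 * real N * R)"
  have \<delta>: "\<delta> > 0" using e N Rpos by (simp add: \<delta>_def)
  show ?thesis
  proof (intro exI[of _ \<delta>] conjI \<delta> allI impI)
    fix v x t
    assume v: "v absolutely_integrable_on {0..T}" and vM: "integral {0..T} (\<lambda>r. \<bar>v r\<bar>) \<le> M"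
      and prim: "\<forall>t\<in>{0..T}. \<bar>integral {0..t} v\<bar> \<le> \<delta>" and t: "t \<in> {0..T}"
    let ?g = "\<lambda>r. v r * inner (f r) x"
    have gi: "?g integrable_on {0..T}" by (rule integrable_mult_inner_continuous[OF v f])
    have vi: "v integrable_on {0..T}" and nvi: "(\<lambda>r. \<bar>v r\<bar>) integrable_on {0..T}"
      using v by (auto simp: absolutely_integrable_on_def)
    have "\<bar>integral {0..t} ?g - integral {0..0} ?g\<bar>
      \<le> e1 * norm x * integral {0..t} (\<lambda>r. \<bar>v r\<bar>) - e1 * norm x * integral {0..0} (\<lambda>r. \<bar>v r\<bar>)
        + real N * (2 * \<delta> * R * norm x)"
    proof (rule grid_chain[OF N(1)])
      fix r s assume rs: "0 \<le> r" "r \<le> s" "s \<le> T" "s - r \<le> T / real N"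
      have sub: "{r..s} \<subseteq> {0..T}" using rs by auto
      have hg: "(?g has_integral integral {r..s} ?g) {r..s}"
        using integrable_subinterval_real[OF gi sub] by (rule integrable_integral)
      have hv: "(v has_integral integral {r..s} v) {r..s}"
        using integrable_subinterval_real[OF vi sub] by (rule integrable_integral)
      have "((\<lambda>q. ?g q - inner (f r) x * v q) has_integral
          integral {r..s} ?g - inner (f r) x * integral {r..s} v) {r..s}"
        by (intro has_integral_diff hg has_integral_mult_right hv)
      then have "\<bar>integral {r..s} ?g - inner (f r) x * integral {r..s} v\<bar>
          \<le> e1 * norm x * integral {r..s} (\<lambda>q. norm (v q))"
      proof (rule has_integral_bound_abs_integrable[OF _ v rs(1,3)])
        fix q assume q: "q \<in> {r..s}"
        have "dist (f q) (f r) < e1"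
          using rs q N by (intro d(2)) (auto simp: dist_real_def)
        then have "\<bar>inner (f q - f r) x\<bar> \<le> e1 * norm x"
          by (intro order_trans[OF Cauchy_Schwarz_ineq2] mult_right_mono) (auto simp: dist_norm)
        then have "\<bar>inner (f q - f r) x\<bar> * \<bar>v q\<bar> \<le> e1 * norm x * \<bar>v q\<bar>"
          by (intro mult_right_mono) auto
        then show "\<bar>?g q - inner (f r) x * v q\<bar> \<le> e1 * norm x * norm (v q)"
          by (simp add: inner_diff_left abs_mult[symmetric] algebra_simps)
      qed
      moreover have "\<bar>inner (f r) x * integral {r..s} v\<bar> \<le> (R * norm x) * (2 * \<delta>)"
        unfolding abs_mult
      proof (rule mult_mono)
        show "\<bar>inner (f r) x\<bar> \<le> R * norm x"
          using R[of r] rs by (intro order_trans[OF Cauchy_Schwarz_ineq2] mult_right_mono) auto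
        show "\<bar>integral {r..s} v\<bar> \<le> 2 * \<delta>"
          using integral_increment[OF vi rs(1-3)] prim[rule_format, of r] prim[rule_format, of s] rs by auto
      qed (use Rpos in auto)
      ultimately show "\<bar>integral {0..s} ?g - integral {0..r} ?g\<bar>
          \<le> e1 * norm x * integral {0..s} (\<lambda>r. \<bar>v r\<bar>) - e1 * norm x * integral {0..r} (\<lambda>r. \<bar>v r\<bar>)
            + 2 * \<delta> * R * norm x"
        using integral_increment[OF gi rs(1-3)] integral_increment[OF nvi rs(1-3)] by (simp add: algebra_simps)
    qed (use t in auto)
    also have "\<dots> \<le> e / 2 * norm x + e / 2 * norm x"
    proof -
      have "integral {0..t} (\<lambda>r. \<bar>v r\<bar>) \<le> integral {0..T} (\<lambda>r. \<bar>v r\<bar>)"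
        using t nvi integrable_subinterval_real[OF nvi, of 0 t]
        by (intro integral_subset_le) auto
      then have "e1 * integral {0..t} (\<lambda>r. \<bar>v r\<bar>) \<le> e1 * (\<bar>M\<bar> + 1)"
        using vM e1 by (intro mult_left_mono) auto
      also have "\<dots> = e / 2" by (simp add: e1_def field_simps)
      finally have "e1 * norm x * integral {0..t} (\<lambda>r. \<bar>v r\<bar>) \<le> e / 2 * norm x"
        using mult_right_mono[of "e1 * integral {0..t} (\<lambda>r. \<bar>v r\<bar>)" "e / 2" "norm x"] by (simp add: mult_ac)
      moreover have "real N * (2 * \<delta> * R * norm x) = e / 2 * norm x"
        using N Rpos by (simp add: \<delta>_def field_simps)
      moreover have "e1 * norm x * integral {0..0} (\<lambda>r. \<bar>v r\<bar>) = 0" by simp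
      ultimately show ?thesis by linarith
    qed
    finally show "\<bar>integral {0..t} ?g\<bar> \<le> e * norm x" by simp
  qed
qed

lemma oscillation_residual:
  fixes f :: "'l \<Rightarrow> real \<Rightarrow> 'h"
  assumes f: "\<And>l. continuous_on {0..T} (f l)" and e: "e > 0"
  shows "\<exists>\<delta>>0. \<forall>v x t. v absolutely_integrable_on {0..T} \<longrightarrow>
       integral {0..T} (\<lambda>r. norm (v r)) \<le> M \<longrightarrow>
       (\<forall>l. \<forall>t\<in>{0..T}. \<bar>integral {0..t} (\<lambda>r. v r $ l)\<bar> \<le> \<delta>) \<longrightarrow> t \<in> {0..T} \<longrightarrow>
       (\<exists>I. ((\<lambda>r. \<Sum>l\<in>UNIV. v r $ l * inner (f l r) x) has_integral I) {0..t} \<and> \<bar>I\<bar> \<le> e * norm x)"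
proof -
  define n where "n = real CARD('l)"
  have n: "n > 0" by (simp add: n_def zero_less_card_finite)
  have en: "e / n > 0" using e n by simp
  have "\<exists>\<delta>>0. \<forall>v x t. v absolutely_integrable_on {0..T} \<longrightarrow> integral {0..T} (\<lambda>r. \<bar>v r\<bar>) \<le> M \<longrightarrow>
       (\<forall>t \<in> {0..T}. \<bar>integral {0..t} v\<bar> \<le> \<delta>) \<longrightarrow> t \<in> {0..T} \<longrightarrow>
       \<bar>integral {0..t} (\<lambda>r. v r * inner (f l r) x)\<bar> \<le> e / n * norm x" for l
    using oscillation_residual1[OF f[of l] en, of M] .
  then have "\<exists>\<delta>. \<forall>l. \<delta> l > 0 \<and> (\<forall>v x t. v absolutely_integrable_on {0..T} \<longrightarrow>
       integral {0..T} (\<lambda>r. \<bar>v r\<bar>) \<le> M \<longrightarrow> (\<forall>t \<in> {0..T}. \<bar>integral {0..t} v\<bar> \<le> \<delta> l) \<longrightarrow> t \<in> {0..T} \<longrightarrow>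
       \<bar>integral {0..t} (\<lambda>r. v r * inner (f l r) x)\<bar> \<le> e / n * norm x)"
    by (intro choice allI)
  then obtain \<delta> where \<delta>0': "\<forall>l. \<delta> l > 0 \<and> (\<forall>v x t. v absolutely_integrable_on {0..T} \<longrightarrow>
       integral {0..T} (\<lambda>r. \<bar>v r\<bar>) \<le> M \<longrightarrow> (\<forall>t \<in> {0..T}. \<bar>integral {0..t} v\<bar> \<le> \<delta> l) \<longrightarrow> t \<in> {0..T} \<longrightarrow>
       \<bar>integral {0..t} (\<lambda>r. v r * inner (f l r) x)\<bar> \<le> e / n * norm x)"
    by (elim exE)
  note \<delta> = conjunct1[OF spec[OF \<delta>0']] conjunct2[OF spec[OF \<delta>0'], rule_format]
  define \<delta>0 where "\<delta>0 = Min (range \<delta>)"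
  have \<delta>0: "\<delta>0 > 0" "\<And>l. \<delta>0 \<le> \<delta> l" using \<delta>(1) by (auto simp: \<delta>0_def)
  show ?thesis
  proof (rule exI[of _ \<delta>0], intro conjI \<delta>0(1) allI impI)
    fix v :: "real \<Rightarrow> real^'l" and x t
    assume v: "v absolutely_integrable_on {0..T}" and vM: "integral {0..T} (\<lambda>r. norm (v r)) \<le> M"
      and prim: "\<forall>l. \<forall>t\<in>{0..T}. \<bar>integral {0..t} (\<lambda>r. v r $ l)\<bar> \<le> \<delta>0" and t: "t \<in> {0..T}"
    let ?g = "\<lambda>l r. v r $ l * inner (f l r) x"
    have vl: "(\<lambda>r. v r $ l) absolutely_integrable_on {0..T}" for l
      by (rule absolutely_integrable_vec_nth[OF v])
    have gi: "?g l integrable_on {0..t}" for l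
      using integrable_subinterval_real[OF integrable_mult_inner_continuous[OF vl f]] t by simp
    have b: "\<bar>integral {0..t} (?g l)\<bar> \<le> e / n * norm x" for l
    proof (rule \<delta>(2)[OF vl _ _ t])
      have "integral {0..T} (\<lambda>r. \<bar>v r $ l\<bar>) \<le> integral {0..T} (\<lambda>r. norm (v r))"
        using vl[of l] v component_le_norm_cart by (intro integral_le) (auto simp: absolutely_integrable_on_def)
      then show "integral {0..T} (\<lambda>r. \<bar>v r $ l\<bar>) \<le> M" using vM by simp
      show "\<bar>integral {0..t} (\<lambda>r. v r $ l)\<bar> \<le> \<delta> l" if "t \<in> {0..T}" for t
        using prim[rule_format, OF that, of l] \<delta>0(2)[of l] by (rule order_trans)
    qed
    have "((\<lambda>r. \<Sum>l\<in>UNIV. ?g l r) has_integral (\<Sum>l\<in>UNIV. integral {0..t} (?g l))) {0..t}"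
      by (intro has_integral_sum integrable_integral gi) auto
    moreover have "\<bar>\<Sum>l\<in>UNIV. integral {0..t} (?g l)\<bar> \<le> (\<Sum>l\<in>(UNIV::'l set). e / n * norm x)"
      by (rule order_trans[OF sum_abs sum_mono]) (rule b)
    moreover have "\<dots> = e * norm x" using n by (simp add: n_def)
    ultimately show "\<exists>I. ((\<lambda>r. \<Sum>l\<in>UNIV. ?g l r) has_integral I) {0..t} \<and> \<bar>I\<bar> \<le> e * norm x"
      by auto
  qed
qed

text \<open>No Gronwall inequality is needed: on steps where the control has mass at most \<open>1/(2K)\<close>
  the deviation at most doubles, up to the residual.\<close>
lemma evolves_stability:
  assumes ev: "evolves w \<phi>" and w: "w absolutely_integrable_on {0..T}" and e: "e > 0" and N: "N > 0"
  shows "\<exists>\<delta>>0. \<forall>w' \<phi>'. evolves w' \<phi>' \<longrightarrow> w' absolutely_integrable_on {0..T} \<longrightarrow> \<phi>' 0 = \<phi> 0 \<longrightarrow>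
       integral {0..T} (\<lambda>r. norm (w' r)) \<le> M \<longrightarrow>
       (\<forall>r s. 0 \<le> r \<longrightarrow> r \<le> s \<longrightarrow> s \<le> T \<longrightarrow> s - r \<le> T / real N \<longrightarrow>
          K * integral {r..s} (\<lambda>r. norm (w' r)) \<le> 1/2) \<longrightarrow>
       (\<forall>l. \<forall>t\<in>{0..T}. \<bar>integral {0..t} (\<lambda>r. (w' r - w r) $ l)\<bar> \<le> \<delta>) \<longrightarrow>
       norm (\<phi>' T - \<phi> T) \<le> e"
proof -
  have cont: "continuous_on {0..T} \<phi>" using ev by (simp add: evolves_def)
  \<comment> \<open>Starting from 0, \<open>N\<close> steps that double the deviation and add
    \<open>4 * \<eta>\<close> lead to at most \<open>2 ^ N * (4 * \<eta>) = e\<close>.\<close>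
  define \<eta> where "\<eta> = e / (4 * 2 ^ N)"
  have \<eta>: "\<eta> > 0" using e by (simp add: \<eta>_def)
  \<comment> \<open>Only the fixed trajectory \<open>\<phi>\<close> enters \<open>f\<close>, so the
    tolerance \<open>\<delta>\<close> obtained from it is independent of the competitor.\<close>
  define f where "f l r = F l r (\<phi> r)" for l r
  have f: "continuous_on {0..T} (f l)" for l unfolding f_def using F_cont[OF cont] .
  obtain \<delta> where \<delta>: "\<delta> > 0" and res:
    "\<forall>v x t. v absolutely_integrable_on {0..T} \<longrightarrow>
       integral {0..T} (\<lambda>r. norm (v r)) \<le> M + integral {0..T} (\<lambda>r. norm (w r)) \<longrightarrow>
       (\<forall>l. \<forall>t\<in>{0..T}. \<bar>integral {0..t} (\<lambda>r. v r $ l)\<bar> \<le> \<delta>) \<longrightarrow> t \<in> {0..T} \<longrightarrow>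
       (\<exists>I. ((\<lambda>r. \<Sum>l\<in>UNIV. v r $ l * inner (f l r) x) has_integral I) {0..t} \<and> \<bar>I\<bar> \<le> \<eta> * norm x)"
    using oscillation_residual[where f = f and M = "M + integral {0..T} (\<lambda>r. norm (w r))", OF f \<eta>]
    by (elim exE conjE)
  show ?thesis
  proof (intro exI[of _ \<delta>] conjI \<delta> allI impI)
    fix w' \<phi>'
    assume ev': "evolves w' \<phi>'" and w': "w' absolutely_integrable_on {0..T}" and init: "\<phi>' 0 = \<phi> 0"
      and M: "integral {0..T} (\<lambda>r. norm (w' r)) \<le> M"
      and small: "\<forall>r s. 0 \<le> r \<longrightarrow> r \<le> s \<longrightarrow> s \<le> T \<longrightarrow> s - r \<le> T / real N \<longrightarrow>
          K * integral {r..s} (\<lambda>r. norm (w' r)) \<le> 1/2"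
      and prim: "\<forall>l. \<forall>t\<in>{0..T}. \<bar>integral {0..t} (\<lambda>r. (w' r - w r) $ l)\<bar> \<le> \<delta>"
    define v where "v r = w' r - w r" for r
    define d where "d r = \<phi>' r - \<phi> r" for r
    have v: "v absolutely_integrable_on {0..T}"
      unfolding v_def by (intro set_integral_diff w w')
    have vM: "integral {0..T} (\<lambda>r. norm (v r)) \<le> M + integral {0..T} (\<lambda>r. norm (w r))"
    proof -
      have "integral {0..T} (\<lambda>r. norm (v r)) \<le> integral {0..T} (\<lambda>r. norm (w' r) + norm (w r))"
        using v w w' norm_triangle_ineq4 unfolding absolutely_integrable_on_def
        by (intro integral_le integrable_add) (auto simp: v_def)
      also have "\<dots> = integral {0..T} (\<lambda>r. norm (w' r)) + integral {0..T} (\<lambda>r. norm (w r))"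
        using w w' unfolding absolutely_integrable_on_def
        by (intro Henstock_Kurzweil_Integration.integral_add) auto
      finally show ?thesis using M by simp
    qed
    have r0: "\<exists>I. ((\<lambda>r. inner (field (v r) r (\<phi> r)) x) has_integral I) {0..t} \<and> \<bar>I\<bar> \<le> \<eta> * norm x"
      if "t \<in> {0..T}" for x t
      using res[rule_format, OF v vM _ that, of x] prim by (simp add: inner_field v_def f_def)
    define I where "I x t = integral {0..t} (\<lambda>r. inner (field (v r) r (\<phi> r)) x)" for x t
    have I: "((\<lambda>r. inner (field (v r) r (\<phi> r)) x) has_integral I x t) {0..t}" "\<bar>I x t\<bar> \<le> \<eta> * norm x"
      if "t \<in> {0..T}" for x t
      using r0[OF that, of x] by (auto simp: I_def integral_unique)
    have contd: "continuous_on {0..T} d"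
      using cont ev' unfolding d_def evolves_def by (intro continuous_intros) auto
    have step: "norm (d t) \<le> 2 * norm (d s) + 4 * \<eta>"
      if st: "0 \<le> s" "s \<le> t" "t \<le> T" "t - s \<le> T / real N" for s t
    proof -
      \<comment> \<open>At a maximum point \<open>p\<close> of the deviation the integrand is
        controlled by \<open>norm (d p)\<close>; since the step carries little mass, only half of
        this maximum appears on the right and can be absorbed.\<close>
      have "\<exists>p\<in>{s..t}. \<forall>q\<in>{s..t}. norm (d q) \<le> norm (d p)"
        using st by (intro continuous_attains_sup continuous_intros
            continuous_on_subset[OF contd]) auto
      then obtain p where p: "p \<in> {s..t}" and pmax: "\<And>q. q \<in> {s..t} \<Longrightarrow> norm (d q) \<le> norm (d p)"
        by blast
      define x where "x = d p - d s"
      have sp: "0 \<le> s" "s \<le> p" "p \<le> T" using p st by auto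
      \<comment> \<open>The integrand collapses to the field of \<open>w'\<close> applied to the
        deviation \<open>d\<close>: the third term, with the difference of the controls acting on
        \<open>\<phi>\<close>, is the residual whose primitive \<open>I\<close> is small. The test
        vector is the increment \<open>x\<close> of the deviation itself.\<close>
      have "((\<lambda>r. inner (field (w' r) r (\<phi>' r)) x - inner (field (w r) r (\<phi> r)) x
            - inner (field (v r) r (\<phi> r)) x) has_integral
          inner (\<phi>' p - \<phi>' s) x - inner (\<phi> p - \<phi> s) x - (I x p - I x s)) {s..p}"
        by (intro has_integral_diff evolves_increment[OF ev' sp] evolves_increment[OF ev sp]
            has_integral_increment[OF I(1) sp])
      then have "\<bar>inner (\<phi>' p - \<phi>' s) x - inner (\<phi> p - \<phi> s) x - (I x p - I x s)\<bar>
          \<le> (K * norm (d p) * norm x) * integral {s..p} (\<lambda>r. norm (w' r))"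
      proof (rule has_integral_bound_abs_integrable[OF _ w' sp(1,3)])
        fix r assume r: "r \<in> {s..p}"
        have "inner (field (w' r) r (\<phi>' r)) x - inner (field (w r) r (\<phi> r)) x
            - inner (field (v r) r (\<phi> r)) x = inner (field (w' r) r (d r)) x"
          by (simp add: v_def d_def field_diff field_diff_control inner_diff_left)
        moreover have "\<bar>inner (field (w' r) r (d r)) x\<bar> \<le> K * norm (d r) * norm x * norm (w' r)"
          by (rule inner_field_bound)
        moreover have "\<dots> \<le> K * norm (d p) * norm x * norm (w' r)"
          using pmax[of r] r p K_pos by (intro mult_right_mono mult_left_mono) auto
        ultimately show "\<bar>inner (field (w' r) r (\<phi>' r)) x - inner (field (w r) r (\<phi> r)) x
            - inner (field (v r) r (\<phi> r)) x\<bar> \<le> K * norm (d p) * norm x * norm (w' r)"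
          by linarith
      qed
      also have "\<dots> = norm (d p) * norm x * (K * integral {s..p} (\<lambda>r. norm (w' r)))"
        by (simp add: mult_ac)
      also have "\<dots> \<le> norm (d p) * norm x * (1/2)"
        using sp p st by (intro mult_left_mono small[rule_format]) auto
      finally have "\<bar>inner x x - (I x p - I x s)\<bar> \<le> norm (d p) * norm x * (1/2)"
        by (simp add: x_def d_def algebra_simps inner_diff_left)
      moreover have "\<bar>I x p\<bar> \<le> \<eta> * norm x" "\<bar>I x s\<bar> \<le> \<eta> * norm x"
        using sp by (auto intro!: I(2))
      ultimately have "inner x x \<le> norm (d p) * norm x * (1/2) + 2 * (\<eta> * norm x)"
        by linarith
      then have "inner x x \<le> norm x * (norm (d p) / 2 + 2 * \<eta>)"
        by (simp add: algebra_simps)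
      then have "norm x * norm x \<le> norm x * (norm (d p) / 2 + 2 * \<eta>)"
        by (simp add: power2_norm_eq_inner[symmetric] power2_eq_square)
      then have "norm x \<le> norm (d p) / 2 + 2 * \<eta>"
        using \<eta> by (cases "norm x = 0") (auto simp: add_nonneg_nonneg)
      moreover have "norm (d p) \<le> norm (d s) + norm x"
        using norm_triangle_ineq[of "d s" x] by (simp add: x_def)
      ultimately have "norm (d p) \<le> 2 * norm (d s) + 4 * \<eta>" by simp
      then show ?thesis using pmax[of t] st by auto
    qed
    have "norm (d (real i * (T / real N))) \<le> (2 ^ i - 1) * (4 * \<eta>)" if "i \<le> N" for i
      using that
    proof (induction i)
      case 0
      then show ?case using init by (simp add: d_def)
    next
      case (Suc i)
      have "real (Suc i) * T \<le> real N * T"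
        using Suc.prems T_pos by (intro mult_right_mono) auto
      then have "real (Suc i) * (T / real N) \<le> T" using N by (simp add: field_simps)
      moreover have "real (Suc i) * (T / real N) = real i * (T / real N) + T / real N"
        by (simp add: algebra_simps add_divide_distrib)
      moreover have "0 \<le> T / real N" "0 \<le> real i * (T / real N)" using T_pos by auto
      ultimately have "norm (d (real (Suc i) * (T / real N)))
          \<le> 2 * norm (d (real i * (T / real N))) + 4 * \<eta>"
        by (intro step) auto
      then show ?case using Suc by (simp add: algebra_simps)
    qed
    from this[of N] have "norm (d T) \<le> (2 ^ N - 1) * (4 * \<eta>)" using N by simp
    also have "\<dots> \<le> 2 ^ N * (4 * \<eta>)" using \<eta> by (intro mult_right_mono) auto
    also have "\<dots> = e" by (simp add: \<eta>_def)
    finally show "norm (\<phi>' T - \<phi> T) \<le> e" by (simp add: d_def)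
  qed
qed

text \<open>Equi-integrability makes the pointwise convergence of the primitives uniform.\<close>
lemma evolves_tendsto:
  assumes ev: "evolves w \<phi>" and w: "w absolutely_integrable_on {0..T}"
    and evn: "\<And>n. evolves (wn n) (\<phi>n n)" and wn: "\<And>n. wn n absolutely_integrable_on {0..T}"
    and init: "\<And>n. \<phi>n n 0 = \<phi> 0"
    and M: "\<And>n. integral {0..T} (\<lambda>r. norm (wn n r)) \<le> M"
    and equi: "\<And>e. e > 0 \<Longrightarrow> \<exists>d>0. \<forall>n r s. 0 \<le> r \<longrightarrow> r \<le> s \<longrightarrow> s \<le> T \<longrightarrow> s - r \<le> d \<longrightarrow>
        integral {r..s} (\<lambda>r. norm (wn n r)) \<le> e"
    and lim: "\<And>l t. t \<in> {0..T} \<Longrightarrow>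
        ((\<lambda>n. integral {0..t} (\<lambda>r. wn n r $ l)) \<longlongrightarrow> integral {0..t} (\<lambda>r. w r $ l)) G"
  shows "((\<lambda>n. \<phi>n n T) \<longlongrightarrow> \<phi> T) G"
proof (rule tendstoI)
  fix e :: real assume e: "e > 0"
  obtain d where d: "d > 0" "\<And>n r s. 0 \<le> r \<Longrightarrow> r \<le> s \<Longrightarrow> s \<le> T \<Longrightarrow> s - r \<le> d \<Longrightarrow>
        integral {r..s} (\<lambda>r. norm (wn n r)) \<le> 1 / (2 * K)"
    using equi[of "1 / (2 * K)"] K_pos by auto
  obtain N :: nat where N: "N > 0" "T / real N < d" using obtain_grid_below[OF d(1)] .
  obtain \<delta> where \<delta>: "\<delta> > 0" and stab:
    "\<forall>w' \<phi>'. evolves w' \<phi>' \<longrightarrow> w' absolutely_integrable_on {0..T} \<longrightarrow> \<phi>' 0 = \<phi> 0 \<longrightarrow>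
       integral {0..T} (\<lambda>r. norm (w' r)) \<le> M \<longrightarrow>
       (\<forall>r s. 0 \<le> r \<longrightarrow> r \<le> s \<longrightarrow> s \<le> T \<longrightarrow> s - r \<le> T / real N \<longrightarrow>
          K * integral {r..s} (\<lambda>r. norm (w' r)) \<le> 1/2) \<longrightarrow>
       (\<forall>l. \<forall>t\<in>{0..T}. \<bar>integral {0..t} (\<lambda>r. (w' r - w r) $ l)\<bar> \<le> \<delta>) \<longrightarrow>
       norm (\<phi>' T - \<phi> T) \<le> e / 2"
    using evolves_stability[where M = M, OF ev w half_gt_zero[OF e] N(1)]
    by (elim exE conjE)
  \<comment> \<open>The primitives at \<open>t\<close> are compared through the grid point to the
    left of \<open>t\<close>: \<open>\<delta> / 3\<close> for \<open>wn n\<close> by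
    equi-integrability, \<open>\<delta> / 3\<close> for \<open>w\<close> by uniform continuity, and
    \<open>\<delta> / 3\<close> for the convergence at the grid point.\<close>
  obtain d1 where d1: "d1 > 0" "\<And>n r s. 0 \<le> r \<Longrightarrow> r \<le> s \<Longrightarrow> s \<le> T \<Longrightarrow> s - r \<le> d1 \<Longrightarrow>
        integral {r..s} (\<lambda>r. norm (wn n r)) \<le> \<delta> / 3"
    using equi[of "\<delta> / 3"] \<delta> by auto
  have wi: "(\<lambda>r. w r $ l) absolutely_integrable_on {0..T}"
    "(\<lambda>r. wn n r $ l) absolutely_integrable_on {0..T}" for l n
    by (intro absolutely_integrable_vec_nth w wn)+
  then have wi': "(\<lambda>r. w r $ l) integrable_on {0..T}" "(\<lambda>r. wn n r $ l) integrable_on {0..T}" for l n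
    by (auto simp: absolutely_integrable_on_def)
  have "uniformly_continuous_on {0..T} (\<lambda>t. integral {0..t} (\<lambda>r. w r $ l))" for l
    by (intro compact_uniformly_continuous indefinite_integral_continuous_1 wi'(1) compact_Icc)
  moreover have "\<delta> / 3 > 0" using \<delta> by simp
  ultimately have "\<exists>d>0. \<forall>r\<in>{0..T}. \<forall>s\<in>{0..T}. dist s r < d \<longrightarrow>
      dist (integral {0..s} (\<lambda>r. w r $ l)) (integral {0..r} (\<lambda>r. w r $ l)) < \<delta> / 3" for l
    unfolding uniformly_continuous_on_def by blast
  then obtain d2 where d2: "\<And>l. d2 l > 0" "\<And>l r s. r \<in> {0..T} \<Longrightarrow> s \<in> {0..T} \<Longrightarrow> dist s r < d2 l \<Longrightarrow>
      dist (integral {0..s} (\<lambda>r. w r $ l)) (integral {0..r} (\<lambda>r. w r $ l)) < \<delta> / 3"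
    by metis
  define d3 where "d3 = min d1 (Min (range d2))"
  have d3: "d3 > 0" "d3 \<le> d1" "\<And>l. d3 \<le> d2 l" using d1 d2(1) by (auto simp: d3_def min.coboundedI2)
  obtain m :: nat where m: "m > 0" "T / real m < d3" using obtain_grid_below[OF d3(1)] .
  define tt where "tt i = real i * (T / real m)" for i
  have tt: "tt i \<in> {0..T}" if "i \<le> m" for i
  proof -
    have "real i * T \<le> real m * T" using that T_pos by (intro mult_right_mono) auto
    then show ?thesis using m T_pos by (simp add: tt_def field_simps)
  qed
  \<comment> \<open>Grid points and components are finite in number, so the pointwise limits hold
    jointly along an arbitrary filter.\<close>
  have "eventually (\<lambda>n. \<forall>l. \<forall>i\<in>{..m}. dist (integral {0..tt i} (\<lambda>r. wn n r $ l))
      (integral {0..tt i} (\<lambda>r. w r $ l)) < \<delta> / 3) G"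
    using \<delta> tt by (intro eventually_all_finite eventually_ball_finite ballI tendstoD lim) auto
  then show "eventually (\<lambda>n. dist (\<phi>n n T) (\<phi> T) < e) G"
  proof eventually_elim
    case (elim n)
    have "norm (\<phi>n n T - \<phi> T) \<le> e / 2"
    proof (rule stab[rule_format, OF evn wn init M])
      fix r s assume rs: "0 \<le> r" "r \<le> s" "s \<le> T" "s - r \<le> T / real N"
      have "integral {r..s} (\<lambda>r. norm (wn n r)) \<le> 1 / (2 * K)" using d(2)[OF rs(1-3)] rs N by simp
      then show "K * integral {r..s} (\<lambda>r. norm (wn n r)) \<le> 1/2" using K_pos by (simp add: field_simps)
    next
      fix l t assume t: "t \<in> {0..T}"
      define i where "i = nat \<lfloor>t / (T / real m)\<rfloor>"
      have h: "T / real m > 0" using T_pos m by simp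
      have q0: "0 \<le> t / (T / real m)" using t h by (simp del: divide_divide_eq_right)
      have ile: "real i \<le> t / (T / real m)" "t / (T / real m) < real i + 1"
        using q0 unfolding i_def by (simp_all only: of_nat_nat zero_le_floor) linarith+
      have i1: "tt i \<le> t" "t - tt i \<le> T / real m"
        using ile h unfolding tt_def by (simp_all only: pos_le_divide_eq pos_divide_less_eq) (simp add: algebra_simps add_divide_distrib)
      have "t / (T / real m) \<le> real m" using t m T_pos by (simp add: field_simps)
      then have im: "i \<le> m" using ile by linarith
      have a: "\<bar>integral {0..t} (\<lambda>r. wn n r $ l) - integral {0..tt i} (\<lambda>r. wn n r $ l)\<bar> \<le> \<delta> / 3"
      proof -
        have r: "0 \<le> tt i" "tt i \<le> t" "t \<le> T" using tt[OF im] i1 t by auto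
        have "((\<lambda>r. wn n r $ l) has_integral integral {tt i..t} (\<lambda>r. wn n r $ l)) {tt i..t}"
          using r by (intro integrable_integral integrable_subinterval_real[OF wi'(2)]) auto
        then have "\<bar>integral {tt i..t} (\<lambda>r. wn n r $ l)\<bar> \<le> 1 * integral {tt i..t} (\<lambda>r. norm (wn n r))"
          by (rule has_integral_bound_abs_integrable[OF _ wn r(1,3)]) (simp add: component_le_norm_cart)
        also have "\<dots> \<le> \<delta> / 3" using d1(2)[OF r] i1 m d3 by auto
        finally show ?thesis using integral_increment[OF wi'(2) r] by simp
      qed
      have "dist (integral {0..t} (\<lambda>r. w r $ l)) (integral {0..tt i} (\<lambda>r. w r $ l)) < \<delta> / 3"
        using i1 m d3(3)[of l] tt[OF im] t by (intro d2(2)) (auto simp: dist_real_def)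
      moreover have "dist (integral {0..tt i} (\<lambda>r. wn n r $ l)) (integral {0..tt i} (\<lambda>r. w r $ l)) < \<delta> / 3"
        using elim im by auto
      moreover have "integral {0..t} (\<lambda>r. (wn n r - w r) $ l)
          = integral {0..t} (\<lambda>r. wn n r $ l) - integral {0..t} (\<lambda>r. w r $ l)"
        using t unfolding vector_minus_component
        by (intro Henstock_Kurzweil_Integration.integral_diff integrable_subinterval_real[OF wi'(1)]
            integrable_subinterval_real[OF wi'(2)]) auto
      ultimately show "\<bar>integral {0..t} (\<lambda>r. (wn n r - w r) $ l)\<bar> \<le> \<delta>"
        using a unfolding dist_real_def by linarith
    qed
    then show ?case using e by (simp add: dist_norm)
  qed
qed

end


subsection \<open>The total variation measure\<close>

lemma vmeasure_sums:
  assumes "u \<in> vmeasures" "range A \<subseteq> sets borel" "disjoint_family A"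
  shows "(\<lambda>n. u (A n)) sums u (\<Union>n. A n)"
  using assms unfolding vmeasures_def by blast

lemma vmeasure_empty:
  assumes "u \<in> vmeasures"
  shows "u {} = 0"
proof -
  have "(\<lambda>n::nat. u {}) sums u (\<Union>n::nat. {})"
    by (rule vmeasure_sums[OF assms]) (auto simp: disjoint_family_on_def)
  then have "(\<lambda>n::nat. u {}) \<longlonglongrightarrow> 0" by (intro summable_LIMSEQ_zero) (auto simp: summable_def)
  then show ?thesis by (simp add: tendsto_const_iff)
qed

lemma total_variation_upper:
  assumes "finite P" "disjoint P" "\<Union>P = A" "P \<subseteq> sets borel"
  shows "(\<Sum>B\<in>P. ennreal (norm (u B))) \<le> total_variation u A"
  unfolding total_variation_def by (rule SUP_upper) (use assms in auto)

lemma norm_le_total_variation: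
  assumes "A \<in> sets borel"
  shows "ennreal (norm (u A)) \<le> total_variation u A"
  using total_variation_upper[of "{A}" A u] assms by (simp add: disjoint_def)

lemma total_variation_empty:
  assumes "u \<in> vmeasures"
  shows "total_variation u {} = 0"
proof -
  have "(\<Sum>B\<in>P. ennreal (norm (u B))) = 0" if "\<Union>P = {}" for P
    using that vmeasure_empty[OF assms] by (intro sum.neutral) auto
  then have "total_variation u {} \<le> 0"
    unfolding total_variation_def by (intro SUP_least) auto
  then show ?thesis by simp
qed

text \<open>A partition of \<open>A\<close> and one of \<open>B\<close> merge into a partition of
  the union; the only set they can share is the empty one, on which \<open>u\<close>
  vanishes.\<close>

lemma total_variation_Un_ge:
  assumes u: "u \<in> vmeasures" and A: "A \<in> sets borel" and B: "B \<in> sets borel" and AB: "A \<inter> B = {}"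
  shows "total_variation u A + total_variation u B \<le> total_variation u (A \<union> B)"
proof -
  let ?S = "\<lambda>A. {P. finite P \<and> disjoint P \<and> \<Union>P = A \<and> P \<subseteq> sets borel}"
  let ?f = "\<lambda>P. \<Sum>B\<in>P. ennreal (norm (u B))"
  have "{A} \<in> ?S A" "{B} \<in> ?S B" using A B by (simp_all add: disjoint_def)
  then have ne: "?S A \<noteq> {}" "?S B \<noteq> {}" by (metis empty_iff)+
  have "?f P + ?f Q \<le> total_variation u (A \<union> B)" if "P \<in> ?S A" "Q \<in> ?S B" for P Q
  proof -
    have XY: "X \<inter> Y = {}" if "X \<in> P" "Y \<in> Q" for X Y
    proof -
      have "\<Union>P = A" "\<Union>Q = B" using \<open>P \<in> ?S A\<close> \<open>Q \<in> ?S B\<close> by simp_all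
      then have "X \<subseteq> A" "Y \<subseteq> B" using that by (metis Union_upper)+
      then show ?thesis using AB by auto
    qed
    have PQ: "X = {}" if "X \<in> P" "X \<in> Q" for X using XY[OF that] by simp
    have "?f P + ?f Q = ?f (P \<union> Q)"
      using that PQ vmeasure_empty[OF u]
      by (intro sum.union_inter_neutral[symmetric]) auto
    also have "\<dots> \<le> total_variation u (A \<union> B)"
    proof (rule total_variation_upper)
      have YX: "Y \<inter> X = {}" if "X \<in> P" "Y \<in> Q" for X Y using XY[OF that] by (simp add: Int_commute)
      show "disjoint (P \<union> Q)"
        unfolding disjoint_def
      proof (intro ballI impI)
        fix X Y assume "X \<in> P \<union> Q" "Y \<in> P \<union> Q" "X \<noteq> Y"
        moreover have "disjoint P" "disjoint Q" using that by auto
        ultimately show "X \<inter> Y = {}"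
          using XY YX unfolding disjoint_def by (elim UnE) simp_all
      qed
    qed (use that in auto)
    finally show ?thesis .
  qed
  then have "?f P + total_variation u B \<le> total_variation u (A \<union> B)" if "P \<in> ?S A" for P
    unfolding total_variation_def[of u B] ennreal_SUP_add_right[OF ne(2)]
    using that by (intro SUP_least) auto
  then show ?thesis
    unfolding total_variation_def[of u A] ennreal_SUP_add_left[OF ne(1), symmetric]
    by (intro SUP_least) auto
qed

lemma total_variation_mono:
  assumes u: "u \<in> vmeasures" and "A \<in> sets borel" "B \<in> sets borel" "A \<subseteq> B"
  shows "total_variation u A \<le> total_variation u B"
proof -
  have "total_variation u A \<le> total_variation u A + total_variation u (B - A)" by simp
  also have "\<dots> \<le> total_variation u (A \<union> (B - A))"
    using assms by (intro total_variation_Un_ge) auto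
  finally show ?thesis using assms by (simp add: Un_absorb1)
qed

lemma norm_suminf_ennreal:
  fixes a :: "nat \<Rightarrow> 'b::real_normed_vector"
  assumes "a sums s"
  shows "ennreal (norm s) \<le> (\<Sum>n. ennreal (norm (a n)))"
proof (rule LIMSEQ_le_const2)
  show "(\<lambda>N. ennreal (norm (\<Sum>n<N. a n))) \<longlonglongrightarrow> ennreal (norm s)"
    using assms unfolding sums_def by (intro tendsto_ennrealI tendsto_norm)
  have "ennreal (norm (\<Sum>n<N. a n)) \<le> (\<Sum>n. ennreal (norm (a n)))" for N
  proof -
    have "ennreal (norm (\<Sum>n<N. a n)) \<le> ennreal (\<Sum>n<N. norm (a n))"
      by (intro ennreal_leI norm_sum)
    also have "\<dots> = (\<Sum>n<N. ennreal (norm (a n)))" by simp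
    also have "\<dots> \<le> (\<Sum>n. ennreal (norm (a n)))" by (intro sum_le_suminf summableI) auto
    finally show ?thesis .
  qed
  then show "\<exists>N0. \<forall>N\<ge>N0. ennreal (norm (\<Sum>n<N. a n)) \<le> (\<Sum>n. ennreal (norm (a n)))" by blast
qed

text \<open>One inequality is finite superadditivity, passed to the limit by monotonicity. For the
  other, a partition of the union is cut along the sets \<open>A n\<close>, and countable additivity
  of \<open>u\<close> bounds each norm by the sum of the norms of the pieces.\<close>

lemma total_variation_countably_additive:
  assumes u: "u \<in> vmeasures"
  shows "countably_additive (sets borel) (total_variation u)"
proof (rule countably_additiveI)
  fix A :: "nat \<Rightarrow> 'a set"
  assume A: "range A \<subseteq> sets borel" and dA: "disjoint_family A"
  have Am: "A n \<in> sets borel" for n using A by auto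
  have dis: "A m \<inter> A n = {}" if "m \<noteq> n" for m n
    using dA that by (auto simp: disjoint_family_on_def)
  show "(\<Sum>n. total_variation u (A n)) = total_variation u (\<Union>n. A n)"
  proof (rule antisym)
    have "(\<Sum>n<N. total_variation u (A n)) \<le> total_variation u (\<Union>n<N. A n)" for N
    proof (induction N)
      case 0
      then show ?case by (simp add: total_variation_empty[OF u])
    next
      case (Suc N)
      have disN: "(\<Union>n<N. A n) \<inter> A N = {}"
      proof (rule equals0I)
        fix x assume "x \<in> (\<Union>n<N. A n) \<inter> A N"
        then obtain n where "n < N" "x \<in> A n" "x \<in> A N" by auto
        then show False using dis[of n N] by auto
      qed
      have "(\<Sum>n<Suc N. total_variation u (A n))
          \<le> total_variation u (\<Union>n<N. A n) + total_variation u (A N)"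
        using Suc by (simp add: add_right_mono)
      also have "\<dots> \<le> total_variation u ((\<Union>n<N. A n) \<union> A N)"
        using Am disN by (intro total_variation_Un_ge[OF u]) auto
      also have "(\<Union>n<N. A n) \<union> A N = (\<Union>n<Suc N. A n)" by (auto simp: less_Suc_eq)
      finally show ?case .
    qed
    also have "total_variation u (\<Union>n<N. A n) \<le> total_variation u (\<Union>n. A n)" for N
      using Am by (intro total_variation_mono[OF u]) auto
    finally show "(\<Sum>n. total_variation u (A n)) \<le> total_variation u (\<Union>n. A n)"
      by (intro suminf_le_const summableI)
  next
    show "total_variation u (\<Union>n. A n) \<le> (\<Sum>n. total_variation u (A n))"
      unfolding total_variation_def[of u "\<Union>n. A n"]
    proof (rule SUP_least, clarify)
      fix P assume P: "finite P" "disjoint P" "\<Union>P = (\<Union>n. A n)" "P \<subseteq> sets borel"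
      have "ennreal (norm (u B)) \<le> (\<Sum>n. ennreal (norm (u (B \<inter> A n))))" if "B \<in> P" for B
      proof (rule norm_suminf_ennreal)
        have "(\<lambda>n. u (B \<inter> A n)) sums u (\<Union>n. B \<inter> A n)"
        proof (rule vmeasure_sums[OF u])
          show "range (\<lambda>n. B \<inter> A n) \<subseteq> sets borel" using that P(4) Am by auto
          have "(B \<inter> A m) \<inter> (B \<inter> A n) = {}" if "m \<noteq> n" for m n
            using dis[OF that] by (simp add: Int_ac)
          then show "disjoint_family (\<lambda>n. B \<inter> A n)" by (simp add: disjoint_family_on_def)
        qed
        moreover have "(\<Union>n. B \<inter> A n) = B" using that P(3) by auto
        ultimately show "(\<lambda>n. u (B \<inter> A n)) sums u B" by simp
      qed
      then have "(\<Sum>B\<in>P. ennreal (norm (u B))) \<le> (\<Sum>B\<in>P. \<Sum>n. ennreal (norm (u (B \<inter> A n))))"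
        by (intro sum_mono)
      also have "\<dots> = (\<Sum>n. \<Sum>B\<in>P. ennreal (norm (u (B \<inter> A n))))"
        by (intro suminf_sum[symmetric] summableI)
      also have "\<dots> \<le> (\<Sum>n. total_variation u (A n))"
      proof (intro suminf_le summableI)
        fix n
        \<comment> \<open>Intersecting with \<open>A n\<close> need not be injective on
          \<open>P\<close>, but distinct members of \<open>P\<close> are disjoint, so a trace that
          occurs twice is empty and contributes 0.\<close>
        have "(\<Sum>B\<in>P. ennreal (norm (u (B \<inter> A n)))) = (\<Sum>C\<in>(\<lambda>B. B \<inter> A n) ` P. ennreal (norm (u C)))"
        proof (subst sum.reindex_nontrivial)
          fix X Y assume XY: "X \<in> P" "Y \<in> P" "X \<noteq> Y" "X \<inter> A n = Y \<inter> A n"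
          then have "X \<inter> Y = {}" using P(2) by (auto simp: disjoint_def)
          then have "X \<inter> A n = {}" using XY(4) by blast
          then show "ennreal (norm (u (X \<inter> A n))) = 0" by (simp add: vmeasure_empty[OF u])
        qed (use P in auto)
        also have "\<dots> \<le> total_variation u (A n)"
        proof (rule total_variation_upper)
          show "disjoint ((\<lambda>B. B \<inter> A n) ` P)" using P(2) unfolding disjoint_def by blast
        qed (use P Am in auto)
        finally show "(\<Sum>B\<in>P. ennreal (norm (u (B \<inter> A n)))) \<le> total_variation u (A n)" .
      qed
      finally show "(\<Sum>B\<in>P. ennreal (norm (u B))) \<le> (\<Sum>n. total_variation u (A n))" .
    qed
  qed
qed

lemma sets_vm_abs[simp, measurable_cong]: "sets (vm_abs u) = sets borel"
  and space_vm_abs[simp]: "space (vm_abs u) = UNIV"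
  unfolding vm_abs_def by (auto simp: sets_measure_of_conv space_measure_of_conv sets.sigma_sets_eq[of borel, unfolded space_borel])

lemma emeasure_vm_abs:
  assumes u: "u \<in> vmeasures" and A: "A \<in> sets borel"
  shows "emeasure (vm_abs u) A = total_variation u A"
  unfolding vm_abs_def
proof (rule emeasure_measure_of_sigma)
  show "sigma_algebra UNIV (sets (borel :: 'a measure))"
    using sets.sigma_algebra_axioms[of borel] by simp
  show "positive (sets borel) (total_variation u)"
    by (simp add: positive_def total_variation_empty[OF u])
qed (rule total_variation_countably_additive[OF u] A)+

lemma finite_measure_vm_abs:
  assumes "u \<in> vmeasures"
  shows "finite_measure (vm_abs u)"
  using assms by (intro finite_measureI) (auto simp: emeasure_vm_abs vmeasures_def)

lemma measure_vm_abs_UNIV: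
  assumes "u \<in> vmeasures"
  shows "measure (vm_abs u) UNIV = vm_norm u"
  using emeasure_vm_abs[OF assms, of UNIV] by (simp add: measure_def vm_norm_def)

lemma norm_le_measure_vm_abs:
  assumes u: "u \<in> vmeasures" and "A \<in> sets borel"
  shows "norm (u A) \<le> measure (vm_abs u) A"
proof -
  interpret finite_measure "vm_abs u" by (rule finite_measure_vm_abs[OF u])
  show ?thesis using norm_le_total_variation[OF assms(2), of u]
    by (simp add: emeasure_vm_abs[OF assms, symmetric] emeasure_eq_measure)
qed


subsection \<open>Radon-Nikodym theorem with values in a separable Hilbert space\<close>

text \<open>The vectors \<open>y\<close> violating the inequality form an open set; as it misses the
  dense set \<open>E\<close> it is empty, and \<open>y = x\<close> is admissible.\<close>

lemma norm_le_if_inner_le_dense: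
  fixes x :: "'b::real_inner"
  assumes dense: "\<And>X. open X \<Longrightarrow> X \<noteq> {} \<Longrightarrow> \<exists>y\<in>E. y \<in> X"
    and r: "0 \<le> r" and le: "\<And>y. y \<in> E \<Longrightarrow> inner x y \<le> r * norm y"
  shows "norm x \<le> r"
proof -
  have "open {y. r * norm y < inner x y}"
    by (intro open_Collect_less continuous_intros)
  then have "{y. r * norm y < inner x y} = {}"
    using dense le by (metis (no_types, lifting) mem_Collect_eq not_less)
  then have "inner x y \<le> r * norm y" for y by (auto simp: not_less)
  from this[of x] have "norm x * norm x \<le> r * norm x"
    by (simp add: power2_norm_eq_inner[symmetric] power2_eq_square)
  then show ?thesis using r by (cases "x = 0") auto
qed

lemma eq_if_inner_eq_dense:
  fixes x y :: "'b::real_inner"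
  assumes dense: "\<And>X. open X \<Longrightarrow> X \<noteq> {} \<Longrightarrow> \<exists>z\<in>E. z \<in> X"
    and "\<And>z. z \<in> E \<Longrightarrow> inner x z = inner y z"
  shows "x = y"
  using norm_le_if_inner_le_dense[of E 0 "x - y", OF dense] assms(2)
  by (simp add: inner_diff_left)

lemma pred_countable_Ball:
  assumes "countable X" "\<And>i. i \<in> X \<Longrightarrow> Measurable.pred M (P i)"
  shows "Measurable.pred M (\<lambda>x. \<forall>i\<in>X. P i x)"
proof -
  have "{x \<in> space M. \<forall>i\<in>X. P i x} = space M - (\<Union>i\<in>X. space M - {x \<in> space M. P i x})"
    by auto
  also have "\<dots> \<in> sets M"
    using assms by (intro sets.Diff sets.top sets.countable_UN') (auto simp: pred_def)
  finally show ?thesis by (simp add: pred_def)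
qed

text \<open>Pettis' measurability argument: a closed ball is an intersection of countably many
  half-spaces given by \<open>E\<close>, and an open set is a union of countably many balls with
  centre in \<open>E\<close> and rational radius.\<close>

lemma borel_measurable_if_inner_dense:
  fixes g :: "'a \<Rightarrow> 'b::{real_inner, second_countable_topology}"
  assumes E: "countable E" and dense: "\<And>X. open X \<Longrightarrow> X \<noteq> {} \<Longrightarrow> \<exists>y\<in>E. y \<in> X"
    and g: "\<And>y. y \<in> E \<Longrightarrow> (\<lambda>x. inner (g x) y) \<in> borel_measurable M"
  shows "g \<in> borel_measurable M"
proof (rule borel_measurableI)
  fix S :: "'b set" assume S: "open S"
  define I where "I = {(d, r). d \<in> E \<and> r \<in> \<rat> \<and> 0 \<le> r \<and> cball d r \<subseteq> S}"
  have "I \<subseteq> E \<times> \<rat>" by (auto simp: I_def)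
  then have I: "countable I" using E countable_rat countable_subset by (metis countable_SIGMA)
  have cb: "g -` cball d r \<inter> space M \<in> sets M" if "0 \<le> r" for d r
  proof -
    have "g -` cball d r \<inter> space M = {x\<in>space M. \<forall>y\<in>E. inner (g x) y - inner d y \<le> r * norm y}"
    proof -
      have "norm (z - d) \<le> r \<longleftrightarrow> (\<forall>y\<in>E. inner z y - inner d y \<le> r * norm y)" for z
      proof
        assume z: "norm (z - d) \<le> r"
        show "\<forall>y\<in>E. inner z y - inner d y \<le> r * norm y"
        proof
          fix y
          have "inner (z - d) y \<le> norm (z - d) * norm y" by (rule norm_cauchy_schwarz)
          also have "\<dots> \<le> r * norm y" using z by (intro mult_right_mono) auto
          finally show "inner z y - inner d y \<le> r * norm y" by (simp add: inner_diff_left)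
        qed
      next
        assume "\<forall>y\<in>E. inner z y - inner d y \<le> r * norm y"
        then show "norm (z - d) \<le> r"
          by (intro norm_le_if_inner_le_dense[OF dense \<open>0 \<le> r\<close>]) (auto simp: inner_diff_left)
      qed
      then show ?thesis by (auto simp: dist_norm norm_minus_commute[of d])
    qed
    also have "\<dots> \<in> sets M"
      using pred_countable_Ball[OF E, where M = M and P = "\<lambda>y x. inner (g x) y - inner d y \<le> r * norm y"] g
      by (auto simp: pred_def)
    finally show ?thesis .
  qed
  have "x \<in> (\<Union>(d, r)\<in>I. cball d r)" if x: "x \<in> S" for x
  proof -
    obtain e where e: "e > 0" "ball x e \<subseteq> S" using S x openE by blast
    \<comment> \<open>The centre \<open>d\<close> will lie within \<open>e / 4\<close> of
      \<open>x\<close>: \<open>e / 4 < r\<close> puts \<open>x\<close> into the ball, and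
      \<open>r + e / 4 < e\<close> keeps the ball inside \<open>S\<close>.\<close>
    obtain r where r: "r \<in> \<rat>" "e / 4 < r" "r < e / 3"
      using Rats_dense_in_real[of "e/4" "e/3"] e by auto
    obtain d where d: "d \<in> E" "d \<in> ball x (e / 4)" using dense[of "ball x (e/4)"] e by auto
    have "cball d r \<subseteq> ball x e"
    proof
      fix z assume "z \<in> cball d r"
      then show "z \<in> ball x e" using d r e dist_triangle[of x z d] by auto
    qed
    then have "(d, r) \<in> I" using d r e by (auto simp: I_def)
    moreover have "x \<in> cball d r" using d r by (simp add: dist_commute)
    ultimately show ?thesis by blast
  qed
  then have "S = (\<Union>(d, r)\<in>I. cball d r)" by (auto simp: I_def)
  then have "g -` S \<inter> space M = (\<Union>(d, r)\<in>I. g -` cball d r \<inter> space M)" by auto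
  also have "\<dots> \<in> sets M" using cb by (intro sets.countable_UN'[OF I]) (auto simp: I_def)
  finally show "g -` S \<inter> space M \<in> sets M" .
qed

text \<open>The functional is only given on a countable set closed under rational combinations, which is
  what is available almost everywhere in the Radon-Nikodym theorem below; the representing
  vector is the limit of a minimising sequence of \<open>\<parallel>y\<parallel>\<^sup>2 - 2 h y\<close>.\<close>
lemma riesz_representation_rational:
  fixes h :: "'b::{real_inner, banach} \<Rightarrow> real"
  assumes ne: "E \<noteq> {}" and add: "\<And>x y. x \<in> E \<Longrightarrow> y \<in> E \<Longrightarrow> x + y \<in> E"
    and scale: "\<And>a x. a \<in> \<rat> \<Longrightarrow> x \<in> E \<Longrightarrow> a *\<^sub>R x \<in> E"
    and h_add: "\<And>x y. x \<in> E \<Longrightarrow> y \<in> E \<Longrightarrow> h (x + y) = h x + h y"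
    and h_scale: "\<And>a x. a \<in> \<rat> \<Longrightarrow> x \<in> E \<Longrightarrow> h (a *\<^sub>R x) = a * h x"
    and h_bound: "\<And>x. x \<in> E \<Longrightarrow> h x \<le> C * norm x"
  shows "\<exists>v. \<forall>y\<in>E. h y = inner v y"
proof -
  define Q where "Q y = (norm y)\<^sup>2 - 2 * h y" for y
  have Qlow: "- C\<^sup>2 \<le> Q y" if "y \<in> E" for y
  proof -
    have "0 \<le> (norm y - C)\<^sup>2" by simp
    then show ?thesis using h_bound[OF that] by (simp add: Q_def power2_diff algebra_simps)
  qed
  define m where "m = Inf (Q ` E)"
  have bdd: "bdd_below (Q ` E)" using Qlow by (auto intro!: bdd_belowI2)
  have m_le: "m \<le> Q y" if "y \<in> E" for y unfolding m_def using bdd that by (intro cInf_lower) auto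
  have "\<exists>y\<in>E. Q y < m + 1 / real (Suc n)" for n
  proof -
    have "Inf (Q ` E) < m + 1 / real (Suc n)" unfolding m_def by simp
    then show ?thesis using cInf_lessD[of "Q ` E"] ne by auto
  qed
  then obtain y where yE: "\<And>n. y n \<in> E" and yQ: "\<And>n. Q (y n) < m + 1 / real (Suc n)" by metis
  have inv0: "(\<lambda>n. 1 / real (Suc n)) \<longlonglongrightarrow> 0" using LIMSEQ_inverse_real_of_nat by (simp add: inverse_eq_divide)
  \<comment> \<open>Parallelogram law: the midpoint of two near-minimisers belongs to
    \<open>E\<close> because 1/2 is rational, and its value of \<open>Q\<close> is at least
    \<open>m\<close>. This makes every minimising sequence Cauchy.\<close>
  have par: "(norm (a - b))\<^sup>2 \<le> 2 * (Q a - m) + 2 * (Q b - m)" if "a \<in> E" "b \<in> E" for a b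
  proof -
    have half: "(1/2::real) \<in> \<rat>" by simp
    have "m \<le> Q ((1/2) *\<^sub>R (a + b))" using that half by (intro m_le scale add)
    also have "\<dots> = (norm (a + b))\<^sup>2 / 4 - (h a + h b)"
      unfolding Q_def h_scale[OF half add[OF that]] h_add[OF that]
      by (simp add: power_divide add_divide_distrib del: scaleR_right_distrib scaleR_add_right)
    finally have "4 * m \<le> (norm (a + b))\<^sup>2 - 4 * (h a + h b)" by simp
    moreover have "(norm (a - b))\<^sup>2 = 2 * (norm a)\<^sup>2 + 2 * (norm b)\<^sup>2 - (norm (a + b))\<^sup>2"
      by (simp add: power2_norm_eq_inner inner_diff_left inner_diff_right inner_add_left inner_add_right)
    ultimately show ?thesis by (simp add: Q_def)
  qed
  have "Cauchy y"
  proof (rule metric_CauchyI)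
    fix e :: real assume e: "e > 0"
    then have "eventually (\<lambda>n. 1 / real (Suc n) < e\<^sup>2 / 4) sequentially"
      using inv0 by (intro order_tendstoD(2)[OF inv0]) auto
    then obtain N where N: "\<And>n. n \<ge> N \<Longrightarrow> 1 / real (Suc n) < e\<^sup>2 / 4"
      unfolding eventually_sequentially by auto
    have "dist (y i) (y j) < e" if "i \<ge> N" "j \<ge> N" for i j
    proof -
      have "Q (y i) < m + e\<^sup>2 / 4" "Q (y j) < m + e\<^sup>2 / 4"
        using that by (auto intro: less_trans[OF yQ add_strict_left_mono[OF N]])
      then have "(norm (y i - y j))\<^sup>2 < e\<^sup>2"
        using par[OF yE yE, of i j] by argo
      then show ?thesis using e by (simp add: dist_norm power_less_imp_less_base)
    qed
    then show "\<exists>M. \<forall>i\<ge>M. \<forall>j\<ge>M. dist (y i) (y j) < e" by blast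
  qed
  then obtain v where v: "y \<longlonglongrightarrow> v" using Cauchy_convergent_iff convergent_def by blast
  have Qm: "(\<lambda>n. Q (y n)) \<longlonglongrightarrow> m"
  proof (rule tendsto_sandwich)
    show "eventually (\<lambda>n. m \<le> Q (y n)) sequentially" using m_le yE by simp
    show "eventually (\<lambda>n. Q (y n) \<le> m + 1 / real (Suc n)) sequentially"
      using yQ by (simp add: less_imp_le)
    show "(\<lambda>n. m + 1 / real (Suc n)) \<longlonglongrightarrow> m" using tendsto_add[OF tendsto_const inv0, of m] by simp
  qed simp
  \<comment> \<open>First variation at the minimiser. As \<open>v\<close> need not lie in
    \<open>E\<close>, \<open>Q\<close> is varied at \<open>y n\<close> in direction \<open>z\<close>
    with rational step \<open>t\<close>, then \<open>n\<close> tends to infinity, and only then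
    \<open>t\<close> to 0. The reverse inequality comes from \<open>- z\<close>.\<close>
  have var: "0 \<le> inner v z - h z" if z: "z \<in> E" for z
  proof -
    have k: "0 \<le> 2 * (inner v z - h z) + t * (norm z)\<^sup>2" if t: "t \<in> \<rat>" "t > 0" for t
    proof -
      have "m \<le> Q (y n) + 2 * t * (inner (y n) z - h z) + t\<^sup>2 * (norm z)\<^sup>2" for n
      proof -
        have "m \<le> Q (y n + t *\<^sub>R z)" by (intro m_le add scale yE z t)
        also have "\<dots> = Q (y n) + 2 * t * (inner (y n) z - h z) + t\<^sup>2 * (norm z)\<^sup>2"
          unfolding Q_def power2_norm_eq_inner h_add[OF yE[of n] scale[OF t(1) z]] h_scale[OF t(1) z]
          by (simp add: inner_add_left inner_add_right inner_commute[of z "y n"] power2_eq_square algebra_simps)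
        finally show ?thesis .
      qed
      then have "m \<le> m + 2 * t * (inner v z - h z) + t\<^sup>2 * (norm z)\<^sup>2"
        by (intro LIMSEQ_le_const[of "\<lambda>n. Q (y n) + 2 * t * (inner (y n) z - h z) + t\<^sup>2 * (norm z)\<^sup>2"]
            tendsto_intros Qm v) auto
      then have "0 \<le> t * (2 * (inner v z - h z) + t * (norm z)\<^sup>2)"
        by (simp add: algebra_simps power2_eq_square)
      then show ?thesis using t by (simp add: zero_le_mult_iff)
    qed
    have "0 \<le> 2 * (inner v z - h z) + 1 / real (Suc n) * (norm z)\<^sup>2" for n
      by (rule k) auto
    then have "0 \<le> 2 * (inner v z - h z) + 0 * (norm z)\<^sup>2"
      by (intro LIMSEQ_le_const[OF tendsto_add[OF tendsto_const tendsto_mult[OF inv0 tendsto_const]]]) auto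
    then show ?thesis by simp
  qed
  have "h z = inner v z" if z: "z \<in> E" for z
  proof -
    have m1: "(-1::real) \<in> \<rat>" by simp
    show ?thesis using var[OF z] var[OF scale[OF m1 z]] h_scale[OF m1 z] by simp
  qed
  then show ?thesis by blast
qed

text \<open>Adding \<open>norm y\<close> times the variation makes the signed measure
  \<open>inner (u A) y\<close> nonnegative, so the Radon-Nikodym theorem for positive finite
  measures applies; the constant \<open>norm y\<close> is subtracted from the density
  afterwards.\<close>

lemma vmeasure_density_scalar:
  fixes u :: "'w::topological_space set \<Rightarrow> 'u::real_inner"
  assumes u: "u \<in> vmeasures"
  shows "\<exists>f. integrable (vm_abs u) f \<and> (\<forall>A\<in>sets borel. inner (u A) y = (LINT x:A|vm_abs u. f x))"
proof -
  let ?\<mu> = "vm_abs u"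
  interpret finite_measure ?\<mu> by (rule finite_measure_vm_abs[OF u])
  define n where "n A = inner (u A) y + norm y * measure ?\<mu> A" for A
  have n0: "0 \<le> n A" if "A \<in> sets borel" for A
  proof -
    have "- inner (u A) y \<le> norm (u A) * norm y" using norm_cauchy_schwarz[of "- u A" y] by simp
    also have "\<dots> \<le> measure ?\<mu> A * norm y"
      by (intro mult_right_mono norm_le_measure_vm_abs[OF u that]) simp
    finally show ?thesis by (simp add: n_def mult.commute)
  qed
  define N where "N = measure_of UNIV (sets borel) (\<lambda>A. ennreal (n A))"
  have setsN: "sets N = sets borel"
    by (simp add: N_def sets_measure_of_conv sets.sigma_sets_eq[of borel, unfolded space_borel])
  have emN: "emeasure N A = ennreal (n A)" if A: "A \<in> sets borel" for A
    unfolding N_def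
  proof (rule emeasure_measure_of_sigma[OF _ _ _ A])
    show "sigma_algebra UNIV (sets (borel :: 'w measure))"
      using sets.sigma_algebra_axioms[of borel] by simp
    show "positive (sets borel) (\<lambda>A. ennreal (n A))"
      by (simp add: positive_def n_def vmeasure_empty[OF u])
    show "countably_additive (sets borel) (\<lambda>A. ennreal (n A))"
    proof (rule countably_additiveI)
      fix A :: "nat \<Rightarrow> 'w set"
      assume A: "range A \<subseteq> sets borel" "disjoint_family A" "(\<Union>i. A i) \<in> sets borel"
      have "(\<lambda>i. n (A i)) sums n (\<Union>i. A i)"
        unfolding n_def
        using A by (intro sums_add sums_mult finite_measure_UNION
            bounded_linear.sums[OF bounded_linear_inner_left] vmeasure_sums[OF u]) auto
      then have "(\<lambda>i. ennreal (n (A i))) sums ennreal (n (\<Union>i. A i))"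
        using A n0 by (subst sums_ennreal) auto
      then show "(\<Sum>i. ennreal (n (A i))) = ennreal (n (\<Union>i. A i))" by (simp add: sums_iff)
    qed
  qed
  have spN: "space N = UNIV" using setsN by (metis sets_eq_imp_space_eq space_borel)
  have "\<exists>f\<in>borel_measurable ?\<mu>. density ?\<mu> f = N"
  proof (rule Radon_Nikodym_finite_measure)
    show "finite_measure N" by (rule finite_measureI) (simp add: spN emN)
    show "sets N = sets ?\<mu>" by (simp add: setsN)
    show "absolutely_continuous ?\<mu> N"
    proof (unfold absolutely_continuous_def, rule subsetI)
      fix A assume "A \<in> null_sets ?\<mu>"
      then have A: "A \<in> sets borel" "measure ?\<mu> A = 0" by (auto simp: null_sets_def measure_def)
      then have "u A = 0" using norm_le_measure_vm_abs[OF u A(1)] by simp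
      then show "A \<in> null_sets N" using A by (auto simp: null_sets_def setsN emN n_def)
    qed
  qed
  then obtain f where f[measurable]: "f \<in> borel_measurable ?\<mu>" and fN: "density ?\<mu> f = N" by blast
  have nn: "(\<integral>\<^sup>+x. f x * indicator A x \<partial>?\<mu>) = ennreal (n A)" if A: "A \<in> sets borel" for A
    using emeasure_density[OF f, of A] A fN emN[OF A] by simp
  have fin: "AE x in ?\<mu>. f x \<noteq> \<infinity>"
    using nn[of UNIV] by (intro nn_integral_PInf_AE f) auto
  define g where "g x = enn2real (f x)" for x
  have g[measurable]: "g \<in> borel_measurable ?\<mu>" unfolding g_def by simp
  have gn: "(\<integral>\<^sup>+x. ennreal (indicator A x * g x) \<partial>?\<mu>) = ennreal (n A)" if A: "A \<in> sets borel" for A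
  proof -
    have "(\<integral>\<^sup>+x. ennreal (indicator A x * g x) \<partial>?\<mu>) = (\<integral>\<^sup>+x. f x * indicator A x \<partial>?\<mu>)"
      using fin by (intro nn_integral_cong_AE)
        (auto simp: g_def indicator_def top.not_eq_extremum elim!: eventually_mono)
    then show ?thesis using nn[OF A] by simp
  qed
  have gi: "integrable ?\<mu> g"
    using gn[of UNIV] by (intro integrableI_nonneg) (auto simp: g_def)
  have gA: "(LINT x:A|?\<mu>. g x) = n A" if A: "A \<in> sets borel" for A
  proof -
    have "(\<integral>x. indicator A x * g x \<partial>?\<mu>) = enn2real (\<integral>\<^sup>+x. ennreal (indicator A x * g x) \<partial>?\<mu>)"
      using A by (intro integral_eq_nn_integral) (auto simp: g_def)
    then show ?thesis using gn[OF A] n0[OF A] by (simp add: set_lebesgue_integral_def)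
  qed
  show ?thesis
  proof (intro exI[of _ "\<lambda>x. g x - norm y"] conjI ballI)
    show "integrable ?\<mu> (\<lambda>x. g x - norm y)" using gi by simp
    fix A :: "'w set" assume A: "A \<in> sets borel"
    have "(LINT x:A|?\<mu>. g x - norm y) = (LINT x:A|?\<mu>. g x) - (LINT x:A|?\<mu>. norm y)"
      using A gi by (intro set_integral_diff(2)) (auto simp: set_integrable_def
          simp del: real_scaleR_def intro!: integrable_mult_indicator)
    also have "(LINT x:A|?\<mu>. norm y) = norm y * measure ?\<mu> A"
      using A by (simp add: set_integral_const emeasure_eq_measure mult.commute)
    finally show "inner (u A) y = (LINT x:A|?\<mu>. g x - norm y)"
      using gA[OF A] by (simp add: n_def)
  qed
qed


lemma integrable_bounded_vm_abs:
  fixes \<phi> :: "'w::topological_space \<Rightarrow> 'b::{banach, second_countable_topology}"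
  assumes "u \<in> vmeasures" "\<phi> \<in> borel_measurable borel" "AE x in vm_abs u. norm (\<phi> x) \<le> c"
  shows "integrable (vm_abs u) \<phi>"
proof -
  interpret finite_measure "vm_abs u" by (rule finite_measure_vm_abs[OF assms(1)])
  show ?thesis using assms(2,3) by (intro integrable_const_bound[of _ c]) auto
qed

lemma AE_abs_le_if_set_integral_le:
  fixes f :: "'a \<Rightarrow> real"
  assumes fin: "finite_measure M" and f: "integrable M f"
    and le: "\<And>A. A \<in> sets M \<Longrightarrow> \<bar>LINT x:A|M. f x\<bar> \<le> c * measure M A"
  shows "AE x in M. \<bar>f x\<bar> \<le> c"
proof -
  interpret finite_measure M by (rule fin)
  have "AE x in M. f x \<in> cball 0 c"
  proof (rule averaging_theorem[OF f closed_cball])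
    fix A assume A: "A \<in> sets M" "0 < measure M A"
    then show "(1 / measure M A) *\<^sub>R (LINT x:A|M. f x) \<in> cball 0 c"
      using le[OF A(1)] by (simp add: field_simps abs_mult)
  qed
  then show ?thesis by simp
qed

text \<open>Each scalar density \<open>f y\<close> is fixed only up to a null set depending on
  \<open>y\<close>. Linearity and the bound by \<open>norm y\<close> therefore hold simultaneously
  almost everywhere only for countably many vectors: the rational span \<open>E\<close> of a
  countable dense set. At each good point the Riesz representation on \<open>E\<close> yields the
  value of the density.\<close>

theorem vmeasure_density_exists:
  fixes u :: "'w::topological_space set \<Rightarrow> 'u::{real_inner, banach, second_countable_topology}"
  assumes u: "u \<in> vmeasures"
  shows "\<exists>g. vm_density u g"
proof -
  let ?\<mu> = "vm_abs u"
  interpret finite_measure ?\<mu> by (rule finite_measure_vm_abs[OF u])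
  obtain D :: "'u set" where D: "countable D" "\<And>X. open X \<Longrightarrow> X \<noteq> {} \<Longrightarrow> \<exists>y\<in>D. y \<in> X"
    using countable_dense_exists by blast
  \<comment> \<open>Finite rational combinations are coded by lists, which makes the countability of
    \<open>E\<close> immediate and turns addition into concatenation.\<close>
  define e where "e l = (\<Sum>(a, y)\<leftarrow>l. a *\<^sub>R y)" for l :: "(real \<times> 'u) list"
  define E where "E = e ` lists (\<rat> \<times> D)"
  have E: "countable E" unfolding E_def
    using D(1) countable_rat by (intro countable_image countable_lists countable_SIGMA) auto
  have DE: "y \<in> E" if "y \<in> D" for y
    unfolding E_def using that by (intro image_eqI[of _ _ "[(1, y)]"]) (auto simp: e_def)
  have dense: "\<exists>y\<in>E. y \<in> X" if "open X" "X \<noteq> {}" for X using D(2)[OF that] DE by blast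
  have Eadd: "x + y \<in> E" if x: "x \<in> E" and y: "y \<in> E" for x y
  proof -
    obtain k where k: "k \<in> lists (\<rat> \<times> D)" "x = e k"
      using x unfolding E_def by blast
    obtain l where l: "l \<in> lists (\<rat> \<times> D)" "y = e l"
      using y unfolding E_def by blast
    have "x + y = e (k @ l)" using k l by (simp add: e_def)
    then show ?thesis unfolding E_def using k l by (intro image_eqI[of _ _ "k @ l"]) simp_all
  qed
  have Escale: "a *\<^sub>R x \<in> E" if a: "a \<in> \<rat>" and x: "x \<in> E" for a x
  proof -
    obtain l where l: "l \<in> lists (\<rat> \<times> D)" "x = e l" using x unfolding E_def by blast
    have "a *\<^sub>R e l = e (map (\<lambda>(b, y). (a * b, y)) l)" for l
      by (induction l) (auto simp: e_def scaleR_right_distrib)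
    moreover have "map (\<lambda>(b, y). (a * b, y)) l \<in> lists (\<rat> \<times> D)"
      using l(1) a by (auto simp: in_lists_conv_set)
    ultimately show ?thesis unfolding E_def using l(2) by auto
  qed
  have "\<forall>y. \<exists>f. integrable ?\<mu> f \<and> (\<forall>A\<in>sets borel. inner (u A) y = (LINT x:A|?\<mu>. f x))"
    using vmeasure_density_scalar[OF u] by blast
  then obtain f where fi: "\<And>y. integrable ?\<mu> (f y)"
    and fA: "\<And>y A. A \<in> sets borel \<Longrightarrow> inner (u A) y = (LINT x:A|?\<mu>. f y x)"
    by metis
  have fm[measurable]: "f y \<in> borel_measurable borel" for y
    using borel_measurable_integrable[OF fi[of y]] by simp
  have fS: "set_integrable ?\<mu> A (f y)" if "A \<in> sets borel" for A y
    unfolding set_integrable_def using that fi by (intro integrable_mult_indicator) auto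
  have AEadd: "AE x in ?\<mu>. f (y + z) x = f y x + f z x" for y z
  proof (rule density_unique_banach)
    fix A assume "A \<in> sets ?\<mu>"
    then have A: "A \<in> sets borel" by simp
    then show "(LINT x:A|?\<mu>. f (y + z) x) = (LINT x:A|?\<mu>. f y x + f z x)"
      using fS[OF A] by (simp add: fA[OF A, symmetric] inner_add_right set_integral_add(2))
  qed (use fi in auto)
  have AEscale: "AE x in ?\<mu>. f (a *\<^sub>R y) x = a * f y x" for a y
  proof (rule density_unique_banach)
    fix A assume "A \<in> sets ?\<mu>"
    then have A: "A \<in> sets borel" by simp
    then show "(LINT x:A|?\<mu>. f (a *\<^sub>R y) x) = (LINT x:A|?\<mu>. a * f y x)"
      by (simp add: fA[OF A, symmetric])
  qed (use fi in auto)
  have AEbound: "AE x in ?\<mu>. \<bar>f y x\<bar> \<le> norm y" for y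
  proof (rule AE_abs_le_if_set_integral_le[OF finite_measure_axioms fi])
    fix A assume "A \<in> sets ?\<mu>"
    then have A: "A \<in> sets borel" by simp
    have "\<bar>inner (u A) y\<bar> \<le> norm (u A) * norm y" by (rule Cauchy_Schwarz_ineq2)
    also have "\<dots> \<le> measure ?\<mu> A * norm y"
      by (intro mult_right_mono norm_le_measure_vm_abs[OF u A]) simp
    finally show "\<bar>LINT x:A|?\<mu>. f y x\<bar> \<le> norm y * measure ?\<mu> A"
      by (simp add: fA[OF A, symmetric] mult.commute)
  qed
  define good where "good x \<longleftrightarrow> (\<forall>y\<in>E. \<bar>f y x\<bar> \<le> norm y \<and> (\<forall>z\<in>E. f (y + z) x = f y x + f z x)
      \<and> (\<forall>a\<in>\<rat>. f (a *\<^sub>R y) x = a * f y x))" for x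
  have AEgood: "AE x in ?\<mu>. good x"
    unfolding good_def
    using AEadd AEscale AEbound by (simp add: AE_ball_countable E countable_rat)
  have good_m: "Measurable.pred borel good"
  proof -
    have "Measurable.pred borel (\<lambda>x. \<forall>y\<in>E. \<bar>f y x\<bar> \<le> norm y \<and> (\<forall>z\<in>E. f (y + z) x = f y x + f z x)
      \<and> (\<forall>a\<in>\<rat>. f (a *\<^sub>R y) x = a * f y x))"
      by (intro pred_countable_Ball pred_intros_logic E countable_rat) measurable
    then show ?thesis by (simp add: good_def[abs_def])
  qed
  have rep: "\<exists>v. \<forall>y\<in>E. f y x = inner v y" if "good x" for x
  proof (rule riesz_representation_rational[where C = 1])
    show "E \<noteq> {}" using dense[of UNIV] by auto
    show "f y x \<le> 1 * norm y" if "y \<in> E" for y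
      using \<open>good x\<close> that unfolding good_def by (metis abs_le_D1 mult_1)
    show "f (y + z) x = f y x + f z x" if "y \<in> E" "z \<in> E" for y z
      using \<open>good x\<close> that unfolding good_def by blast
    show "f (a *\<^sub>R y) x = a * f y x" if "a \<in> \<rat>" "y \<in> E" for a y
      using \<open>good x\<close> that unfolding good_def by blast
  qed (use Eadd Escale in auto)
  \<comment> \<open>The choice is harmless for measurability: a vector is determined by its inner
    products with the dense set \<open>E\<close>, and these are prescribed by the measurable
    functions \<open>f y\<close>. Hence also the need for \<open>good\<close> to be a measurable
    predicate.\<close>
  define g where "g x = (if good x then SOME v. \<forall>y\<in>E. f y x = inner v y else 0)" for x
  have g: "inner (g x) y = f y x" if "good x" "y \<in> E" for x y
    using someI_ex[OF rep[OF that(1)]] that by (simp add: g_def)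
  have gm: "g \<in> borel_measurable borel"
  proof (rule borel_measurable_if_inner_dense[OF E dense])
    fix y assume y: "y \<in> E"
    have "(\<lambda>x. inner (g x) y) = (\<lambda>x. if good x then f y x else 0)"
      using g[OF _ y] by (auto simp: g_def)
    moreover have "(\<lambda>x. if good x then f y x else 0) \<in> borel_measurable borel"
      using good_m by (intro measurable_If) (auto simp: pred_def)
    ultimately show "(\<lambda>x. inner (g x) y) \<in> borel_measurable borel" by simp
  qed
  have gbound: "norm (g x) \<le> 1" for x
  proof (cases "good x")
    case True
    show ?thesis
    proof (rule norm_le_if_inner_le_dense[OF dense])
      fix y assume y: "y \<in> E"
      then show "inner (g x) y \<le> 1 * norm y"
        using g[OF True y] True unfolding good_def by (metis abs_le_D1 mult_1)
    qed auto
  qed (simp add: g_def)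
  have gi: "integrable ?\<mu> g"
    using gbound gm by (intro integrable_bounded_vm_abs[OF u, of _ 1]) auto
  have "u A = (LINT x:A|?\<mu>. g x)" if A: "A \<in> sets borel" for A
  proof (rule eq_if_inner_eq_dense[OF dense])
    fix y assume y: "y \<in> E"
    have gS: "integrable ?\<mu> (\<lambda>x. indicator A x *\<^sub>R g x)"
      using A gi by (intro integrable_mult_indicator) auto
    have "inner (LINT x:A|?\<mu>. g x) y = (LINT x:A|?\<mu>. inner (g x) y)"
      unfolding set_lebesgue_integral_def using gS
      by (subst integral_inner_left[symmetric]) (auto simp: inner_commute)
    also have "\<dots> = (LINT x:A|?\<mu>. f y x)"
      unfolding set_lebesgue_integral_def
    proof (rule integral_cong_AE)
      show "AE x in ?\<mu>. indicat_real A x *\<^sub>R inner (g x) y = indicat_real A x *\<^sub>R f y x"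
        using AEgood by eventually_elim (simp add: g[OF _ y])
    qed (use A gm fm in measurable)
    finally show "inner (u A) y = inner (LINT x:A|?\<mu>. g x) y" by (simp add: fA[OF A])
  qed
  then show ?thesis unfolding vm_density_def using gi by blast
qed

text \<open>The average of \<open>g\<close> over \<open>A\<close> is \<open>u A\<close> divided by
  the variation of \<open>A\<close>, hence in the closed unit ball; a function whose averages lie in
  a closed set has almost all its values there.\<close>

lemma vm_density_norm_le:
  fixes u :: "'w::topological_space set \<Rightarrow> 'u::{real_inner, banach, second_countable_topology}"
  assumes u: "u \<in> vmeasures" and g: "vm_density u g"
  shows "AE x in vm_abs u. norm (g x) \<le> 1"
proof -
  interpret finite_measure "vm_abs u" by (rule finite_measure_vm_abs[OF u])
  have "AE x in vm_abs u. g x \<in> cball 0 1"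
  proof (rule averaging_theorem[OF _ closed_cball])
    show "integrable (vm_abs u) g" using g by (simp add: vm_density_def)
    fix A assume A: "A \<in> sets (vm_abs u)" "0 < measure (vm_abs u) A"
    then have "(LINT x:A|vm_abs u. g x) = u A" using g by (simp add: vm_density_def)
    then show "(1 / measure (vm_abs u) A) *\<^sub>R (LINT x:A|vm_abs u. g x) \<in> cball 0 1"
      using norm_le_measure_vm_abs[OF u, of A] A by simp
  qed
  then show ?thesis by simp
qed

lemma integrable_inner_density:
  fixes u :: "'w::topological_space set \<Rightarrow> 'u::{real_inner, banach, second_countable_topology}"
  assumes u: "u \<in> vmeasures" and g: "vm_density u g"
    and \<phi>: "\<phi> \<in> borel_measurable borel" and le: "\<And>x. norm (\<phi> x) \<le> c"
  shows "integrable (vm_abs u) (\<lambda>x. inner (g x) (\<phi> x))"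
proof (rule integrable_bounded_vm_abs[OF u])
  have "g \<in> borel_measurable borel" using g borel_measurable_integrable[of "vm_abs u" g] by (simp add: vm_density_def)
  then show "(\<lambda>x. inner (g x) (\<phi> x)) \<in> borel_measurable borel" using \<phi> by measurable
  show "AE x in vm_abs u. norm (inner (g x) (\<phi> x)) \<le> 1 * c"
    using vm_density_norm_le[OF u g]
  proof eventually_elim
    case (elim x)
    have "\<bar>inner (g x) (\<phi> x)\<bar> \<le> norm (g x) * norm (\<phi> x)" by (rule Cauchy_Schwarz_ineq2)
    also have "\<dots> \<le> 1 * c" using elim le[of x] by (intro mult_mono) auto
    finally show ?case by simp
  qed
qed

text \<open>Resolves the definite description in \<open>vm_pair\<close>: two densities agree almost
  everywhere, so all of them give the same integral.\<close>

lemma vm_pair_eq: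
  fixes u :: "'w::topological_space set \<Rightarrow> 'u::{real_inner, banach, second_countable_topology}"
  assumes u: "u \<in> vmeasures" and g: "vm_density u g" and \<phi>: "\<phi> \<in> borel_measurable borel"
  shows "vm_pair u \<phi> = (\<integral>x. inner (g x) (\<phi> x) \<partial>vm_abs u)"
  unfolding vm_pair_def
proof (rule the_equality)
  show "\<exists>g'. vm_density u g' \<and> (\<integral>x. inner (g x) (\<phi> x) \<partial>vm_abs u) = (\<integral>x. inner (g' x) (\<phi> x) \<partial>vm_abs u)"
    using g by blast
  fix c assume "\<exists>g'. vm_density u g' \<and> c = (\<integral>x. inner (g' x) (\<phi> x) \<partial>vm_abs u)"
  then obtain g' where g': "vm_density u g'" "c = (\<integral>x. inner (g' x) (\<phi> x) \<partial>vm_abs u)" by blast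
  have m: "g \<in> borel_measurable borel" "g' \<in> borel_measurable borel"
    using g g'(1) borel_measurable_integrable[of "vm_abs u"] by (auto simp: vm_density_def)
  interpret finite_measure "vm_abs u" by (rule finite_measure_vm_abs[OF u])
  have "AE x in vm_abs u. g x = g' x"
    using g g'(1) by (intro density_unique_banach) (auto simp: vm_density_def)
  then have "AE x in vm_abs u. inner (g' x) (\<phi> x) = inner (g x) (\<phi> x)"
    by eventually_elim simp
  then show "c = (\<integral>x. inner (g x) (\<phi> x) \<partial>vm_abs u)"
    unfolding g'(2) using m \<phi> by (intro integral_cong_AE) auto
qed

lemma abs_vm_pair_le:
  fixes u :: "'w::topological_space set \<Rightarrow> 'u::{real_inner, banach, second_countable_topology}"
  assumes u: "u \<in> vmeasures" and \<phi>: "\<phi> \<in> borel_measurable borel" and le: "\<And>x. norm (\<phi> x) \<le> c"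
  shows "\<bar>vm_pair u \<phi>\<bar> \<le> vm_norm u * c"
proof -
  interpret finite_measure "vm_abs u" by (rule finite_measure_vm_abs[OF u])
  obtain g where g: "vm_density u g" using vmeasure_density_exists[OF u] by blast
  have "\<bar>\<integral>x. inner (g x) (\<phi> x) \<partial>vm_abs u\<bar> \<le> (\<integral>x. c \<partial>vm_abs u)"
  proof (rule integral_abs_bound[THEN order_trans], rule integral_mono_AE)
    show "AE x in vm_abs u. \<bar>inner (g x) (\<phi> x)\<bar> \<le> c"
      using vm_density_norm_le[OF u g]
    proof eventually_elim
      case (elim x)
      have "\<bar>inner (g x) (\<phi> x)\<bar> \<le> norm (g x) * norm (\<phi> x)" by (rule Cauchy_Schwarz_ineq2)
      also have "\<dots> \<le> 1 * c" using elim le[of x] by (intro mult_mono) auto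
      finally show ?case by simp
    qed
  qed (use integrable_inner_density[OF u g \<phi> le] in auto)
  then show ?thesis
    using measure_vm_abs_UNIV[OF u] by (simp add: vm_pair_eq[OF u g \<phi>] mult.commute)
qed

lemma vm_pair_linear:
  fixes u :: "'w::topological_space set \<Rightarrow> 'u::{real_inner, banach, second_countable_topology}"
  assumes u: "u \<in> vmeasures" and \<phi>: "\<phi> \<in> borel_measurable borel" "\<And>x. norm (\<phi> x) \<le> c"
    and \<psi>: "\<psi> \<in> borel_measurable borel" "\<And>x. norm (\<psi> x) \<le> d"
  shows "vm_pair u (\<lambda>x. a *\<^sub>R \<phi> x + b *\<^sub>R \<psi> x) = a * vm_pair u \<phi> + b * vm_pair u \<psi>"
proof -
  obtain g where g: "vm_density u g" using vmeasure_density_exists[OF u] by blast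
  have "(\<lambda>x. a *\<^sub>R \<phi> x + b *\<^sub>R \<psi> x) \<in> borel_measurable borel" using \<phi>(1) \<psi>(1) by measurable
  from vm_pair_eq[OF u g this] show ?thesis
    using integrable_inner_density[OF u g \<phi>] integrable_inner_density[OF u g \<psi>]
    by (simp add: vm_pair_eq[OF u g \<phi>(1)] vm_pair_eq[OF u g \<psi>(1)] inner_add_right)
qed


subsection \<open>Continuous functions vanishing at infinity\<close>

text \<open>Soft thresholding: the norm is lowered by \<open>e\<close>, and norms below \<open>e\<close> become 0. For \<open>e = 0\<close> this
  is the identity, the quotient \<open>0 / 0 = 0\<close> occurring only where \<open>\<phi>\<close> vanishes.\<close>
definition soft :: "real \<Rightarrow> ('w \<Rightarrow> 'b::real_normed_vector) \<Rightarrow> 'w \<Rightarrow> 'b" where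
  "soft e \<phi> x = (1 - e / max e (norm (\<phi> x))) *\<^sub>R \<phi> x"

lemma soft_zero: "soft 0 \<phi> = \<phi>"
  by (auto simp: soft_def fun_eq_iff)

lemma soft_eq_0: "norm (\<phi> x) \<le> e \<Longrightarrow> soft e \<phi> x = 0"
  by (cases "e = 0") (auto simp: soft_def max_absorb1)

lemma soft_coeff: "0 \<le> (e::real) \<Longrightarrow> 0 \<le> 1 - e / max e r \<and> 1 - e / max e r \<le> 1"
  by (cases "e = 0") (auto simp: divide_le_eq max_def)

lemma norm_soft_le: "0 \<le> e \<Longrightarrow> norm (soft e \<phi> x) \<le> norm (\<phi> x)"
  using soft_coeff[of e "norm (\<phi> x)"] unfolding soft_def norm_scaleR
  by (intro mult_left_le_one_le) auto

text \<open>Both vectors are nonnegative multiples of \<open>\<phi> x\<close>, of norms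
  \<open>max 0 (r - a)\<close> and \<open>max 0 (r - b)\<close> with \<open>r\<close> the norm of
  \<open>\<phi> x\<close>, so the norm of their difference is the difference of these norms.\<close>

lemma norm_soft_diff:
  assumes "0 \<le> a" "a \<le> b"
  shows "norm (soft a \<phi> x - soft b \<phi> x) \<le> b - a"
proof -
  let ?r = "norm (\<phi> x)"
  have *: "(1 - e / max e ?r) * ?r = max 0 (?r - e)" if "0 \<le> e" for e
    using that by (cases "?r \<le> e"; cases "?r = 0") (auto simp: max_def field_simps)
  have le: "e / max e ?r \<le> e' / max e' ?r" if "0 \<le> e" "e \<le> e'" for e e'
  proof (cases "e' = 0 \<or> ?r = 0")
    case False
    then show ?thesis using that by (auto simp: max_def field_simps mult_mono)
  qed (use that in \<open>auto simp: max_def\<close>)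
  have "soft a \<phi> x - soft b \<phi> x = ((1 - a / max a ?r) - (1 - b / max b ?r)) *\<^sub>R \<phi> x"
    by (simp add: soft_def scaleR_diff_left)
  then have "norm (soft a \<phi> x - soft b \<phi> x) = ((1 - a / max a ?r) - (1 - b / max b ?r)) * ?r"
    using le[OF assms] by simp
  also have "\<dots> = max 0 (?r - a) - max 0 (?r - b)"
    using *[of a] *[of b] assms by (simp add: left_diff_distrib)
  also have "\<dots> \<le> b - a" using assms by auto
  finally show ?thesis .
qed

lemma continuous_soft:
  assumes "continuous_on UNIV \<phi>" "0 \<le> e"
  shows "continuous_on UNIV (soft e \<phi>)"
proof (cases "e = 0")
  case False
  then have "max e (norm (\<phi> x)) \<noteq> 0" for x using assms(2) by (auto simp: max_def)
  then show ?thesis unfolding soft_def[abs_def]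
    using assms(1) by (intro continuous_intros) auto
qed (use assms soft_zero[of \<phi>] in \<open>simp\<close>)

lemma closed_subset_of_compact: "compact K \<Longrightarrow> closed S \<Longrightarrow> S \<subseteq> K \<Longrightarrow> compact S"
  using compact_Int_closed[of K S] by (simp add: Int_absorb1)

text \<open>For the converse direction the compactly supported approximant is
  \<open>soft e \<phi>\<close> itself, so no cutoff function has to be constructed.\<close>

lemma C0_space_iff:
  fixes \<phi> :: "'w::t2_space \<Rightarrow> 'b::real_normed_vector"
  shows "\<phi> \<in> C0_space \<longleftrightarrow> continuous_on UNIV \<phi> \<and> (\<forall>e>0. compact {x. e \<le> norm (\<phi> x)})"
proof
  assume \<phi>: "\<phi> \<in> C0_space"
  then have cont: "continuous_on UNIV \<phi>" by (simp add: C0_space_def)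
  have "compact {x. e \<le> norm (\<phi> x)}" if e: "e > 0" for e
  proof -
    from \<phi> half_gt_zero[OF e] obtain \<psi> where \<psi>: "compact (closure {x. \<psi> x \<noteq> 0})"
      "\<And>x. norm (\<phi> x - \<psi> x) \<le> e / 2" unfolding C0_space_def by blast
    have "{x. e \<le> norm (\<phi> x)} \<subseteq> closure {x. \<psi> x \<noteq> 0}"
    proof
      fix x assume "x \<in> {x. e \<le> norm (\<phi> x)}"
      then have "\<psi> x \<noteq> 0" using \<psi>(2)[of x] e by auto
      then show "x \<in> closure {x. \<psi> x \<noteq> 0}" using closure_subset[of "{x. \<psi> x \<noteq> 0}"] by blast
    qed
    moreover have "closed {x. e \<le> norm (\<phi> x)}"
      by (intro closed_Collect_le continuous_intros cont)
    ultimately show ?thesis using closed_subset_of_compact[OF \<psi>(1)] by simp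
  qed
  then show "continuous_on UNIV \<phi> \<and> (\<forall>e>0. compact {x. e \<le> norm (\<phi> x)})" using cont by blast
next
  assume \<phi>: "continuous_on UNIV \<phi> \<and> (\<forall>e>0. compact {x. e \<le> norm (\<phi> x)})"
  show "\<phi> \<in> C0_space"
    unfolding C0_space_def
  proof (intro CollectI conjI allI impI)
    fix e :: real assume e: "e > 0"
    have K: "compact {x. e \<le> norm (\<phi> x)}" using \<phi> e by blast
    have "{x. soft e \<phi> x \<noteq> 0} \<subseteq> {x. e \<le> norm (\<phi> x)}"
      using soft_eq_0[of \<phi> _ e] by (metis (mono_tags, lifting) Collect_mono linear)
    then have "closure {x. soft e \<phi> x \<noteq> 0} \<subseteq> {x. e \<le> norm (\<phi> x)}"
      using compact_imp_closed[OF K] by (rule closure_minimal)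
    then have "compact (closure {x. soft e \<phi> x \<noteq> 0})"
      using closed_subset_of_compact[OF K closed_closure] by simp
    moreover have "norm (\<phi> x - soft e \<phi> x) \<le> e" for x
      using norm_soft_diff[of 0 e \<phi> x] e by (simp add: soft_zero)
    moreover have "continuous_on UNIV (soft e \<phi>)" using \<phi> e by (intro continuous_soft) auto
    ultimately show "\<exists>\<psi>. continuous_on UNIV \<psi> \<and> compact (closure {x. \<psi> x \<noteq> 0}) \<and> (\<forall>x. norm (\<phi> x - \<psi> x) \<le> e)"
      by blast
  qed (use \<phi> in blast)
qed

text \<open>The common source of the closure properties. The codomains may differ, since scalar
  functions such as the norm of \<open>\<phi>\<close> and products of a scalar function with a fixed
  vector are both needed.\<close>

lemma C0_space_dominated:
  fixes \<phi> :: "'w::t2_space \<Rightarrow> 'b::real_normed_vector" and \<psi> :: "'w \<Rightarrow> 'c::real_normed_vector"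
  assumes \<phi>: "\<phi> \<in> C0_space" and \<psi>: "continuous_on UNIV \<psi>" and le: "\<And>x. norm (\<psi> x) \<le> c * norm (\<phi> x)"
  shows "\<psi> \<in> C0_space"
  unfolding C0_space_iff
proof (intro conjI allI impI \<psi>)
  fix e :: real assume e: "e > 0"
  let ?c = "\<bar>c\<bar> + 1"
  have "compact {x. e / ?c \<le> norm (\<phi> x)}" using \<phi> e unfolding C0_space_iff by auto
  moreover have "{x. e \<le> norm (\<psi> x)} \<subseteq> {x. e / ?c \<le> norm (\<phi> x)}"
  proof clarify
    fix x assume "e \<le> norm (\<psi> x)"
    also have "\<dots> \<le> c * norm (\<phi> x)" by (rule le)
    also have "\<dots> \<le> ?c * norm (\<phi> x)" by (intro mult_right_mono) auto
    finally show "e / ?c \<le> norm (\<phi> x)" by (simp add: field_simps)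
  qed
  moreover have "closed {x. e \<le> norm (\<psi> x)}"
    by (intro closed_Collect_le continuous_intros \<psi>)
  ultimately show "compact {x. e \<le> norm (\<psi> x)}" using closed_subset_of_compact by blast
qed

lemma C0_space_add:
  fixes \<phi> \<psi> :: "'w::t2_space \<Rightarrow> 'b::real_normed_vector"
  assumes \<phi>: "\<phi> \<in> C0_space" and \<psi>: "\<psi> \<in> C0_space"
  shows "(\<lambda>x. \<phi> x + \<psi> x) \<in> C0_space"
proof -
  have cont: "continuous_on UNIV (\<lambda>x. \<phi> x + \<psi> x)"
    using \<phi> \<psi> unfolding C0_space_iff by (intro continuous_intros) auto
  have "compact {x. e \<le> norm (\<phi> x + \<psi> x)}" if e: "e > 0" for e
  proof -
    have "compact ({x. e / 2 \<le> norm (\<phi> x)} \<union> {x. e / 2 \<le> norm (\<psi> x)})"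
      using \<phi> \<psi> half_gt_zero[OF e] unfolding C0_space_iff by (intro compact_Un) blast+
    moreover have "{x. e \<le> norm (\<phi> x + \<psi> x)} \<subseteq> {x. e / 2 \<le> norm (\<phi> x)} \<union> {x. e / 2 \<le> norm (\<psi> x)}"
    proof clarify
      fix x assume "e \<le> norm (\<phi> x + \<psi> x)" "\<not> e / 2 \<le> norm (\<psi> x)"
      then show "e / 2 \<le> norm (\<phi> x)" using norm_triangle_ineq[of "\<phi> x" "\<psi> x"] by linarith
    qed
    moreover have "closed {x. e \<le> norm (\<phi> x + \<psi> x)}"
      by (intro closed_Collect_le continuous_on_norm cont continuous_intros)
    ultimately show ?thesis using closed_subset_of_compact by blast
  qed
  then show ?thesis using cont by (simp add: C0_space_iff)
qed

lemma C0_space_zero[simp]: "(\<lambda>x. 0) \<in> C0_space"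
  by (auto simp: C0_space_def intro!: exI[of _ "\<lambda>x. 0"])

lemma C0_space_continuous: "\<phi> \<in> C0_space \<Longrightarrow> continuous_on UNIV \<phi>"
  by (simp add: C0_space_def)

lemma C0_space_scaleR:
  fixes \<phi> :: "'w::t2_space \<Rightarrow> 'b::real_normed_vector"
  assumes "\<phi> \<in> C0_space"
  shows "(\<lambda>x. a *\<^sub>R \<phi> x) \<in> C0_space"
proof (rule C0_space_dominated[OF assms])
  show "continuous_on UNIV (\<lambda>x. a *\<^sub>R \<phi> x)"
    by (intro continuous_intros C0_space_continuous assms)
  show "norm (a *\<^sub>R \<phi> x) \<le> \<bar>a\<bar> * norm (\<phi> x)" for x by simp
qed

lemma C0_space_sum:
  fixes \<phi> :: "'i \<Rightarrow> 'w::t2_space \<Rightarrow> 'b::real_normed_vector"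
  assumes "\<And>i. i \<in> I \<Longrightarrow> \<phi> i \<in> C0_space"
  shows "(\<lambda>x. \<Sum>i\<in>I. \<phi> i x) \<in> C0_space"
  using assms
proof (induction I rule: infinite_finite_induct)
  case (insert i I)
  then show ?case using C0_space_add[of "\<phi> i" "\<lambda>x. \<Sum>i\<in>I. \<phi> i x"] by simp
qed simp_all

lemma C0_space_soft:
  fixes \<phi> :: "'w::t2_space \<Rightarrow> 'b::real_normed_vector"
  assumes "\<phi> \<in> C0_space" "0 \<le> e"
  shows "soft e \<phi> \<in> C0_space"
  by (rule C0_space_dominated[OF assms(1) continuous_soft[OF C0_space_continuous[OF assms(1)] assms(2)], where c = 1])
    (use norm_soft_le[OF assms(2)] in simp)

lemma C0_space_bounded:
  fixes \<phi> :: "'w::t2_space \<Rightarrow> 'b::real_normed_vector"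
  assumes "\<phi> \<in> C0_space"
  obtains c where "\<And>x. norm (\<phi> x) \<le> c" "c \<ge> 0"
proof -
  have "compact {x. 1 \<le> norm (\<phi> x)}" using assms by (simp add: C0_space_iff)
  then have "compact (\<phi> ` {x. 1 \<le> norm (\<phi> x)})"
    by (intro compact_continuous_image continuous_on_subset[OF C0_space_continuous[OF assms]]) auto
  then have "bounded (\<phi> ` {x. 1 \<le> norm (\<phi> x)})" by (rule compact_imp_bounded)
  then obtain c where c: "\<And>x. 1 \<le> norm (\<phi> x) \<Longrightarrow> norm (\<phi> x) \<le> c"
    unfolding bounded_iff by auto
  show ?thesis
  proof (rule that[of "max c 1"])
    show "norm (\<phi> x) \<le> max c 1" for x using c[of x] by linarith
  qed simp
qed

lemma C0_space_measurable:
  fixes \<phi> :: "'w::t2_space \<Rightarrow> 'b::real_normed_vector"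
  shows "\<phi> \<in> C0_space \<Longrightarrow> \<phi> \<in> borel_measurable borel"
  by (intro borel_measurable_continuous_onI C0_space_continuous)


subsection \<open>Riesz representation on a locally compact space\<close>

lemma ennreal_add_le: "ennreal (a + b) \<le> ennreal a + ennreal b"
proof -
  have "ennreal (a + b) \<le> ennreal (max 0 a + max 0 b)" by (intro ennreal_leI) auto
  also have "\<dots> = ennreal a + ennreal b"
    by (subst ennreal_plus) (auto simp: max_def ennreal_neg)
  finally show ?thesis .
qed

lemma continuous_separation_point:
  fixes x :: "'w::t2_space"
  assumes "locally_compact_space (euclidean :: 'w topology)" "open V" "x \<in> V"
  obtains h :: "'w \<Rightarrow> real" where "continuous_on UNIV h" "\<And>y. 0 \<le> h y" "h x = 1" "\<And>y. y \<notin> V \<Longrightarrow> h y = 0"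
proof -
  have "completely_regular_space (euclidean :: 'w topology)"
  proof (rule locally_compact_regular_imp_completely_regular_space[OF assms(1)])
    have "Hausdorff_space (euclidean :: 'w topology)"
      unfolding Hausdorff_space_def disjnt_def by (simp, metis hausdorff)
    then show "Hausdorff_space (euclidean :: 'w topology) \<or> regular_space (euclidean :: 'w topology)" ..
  qed
  moreover have "closedin euclidean (- V)" using assms(2) by (simp add: closed_Compl)
  ultimately obtain f where f: "continuous_map euclidean (top_of_set {0..1::real}) f" "f x = 0" "f ` (- V) \<subseteq> {1}"
    unfolding completely_regular_space_def using assms(3) by (metis ComplD DiffI UNIV_I topspace_euclidean)
  have "continuous_on UNIV f" "\<And>y. f y \<in> {0..1}"
    using f(1) by (auto simp: continuous_map_in_subtopology image_subset_iff)
  then show ?thesis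
    using f(2,3) by (intro that[of "\<lambda>y. 1 - f y"] continuous_intros) auto
qed

text \<open>The bound is one-sided, which is the form that survives passage to the limit directly;
  the two-sided one follows by scaling with -1.\<close>

locale C0_functional =
  fixes Lam :: "('w::t2_space \<Rightarrow> 'u::{real_inner,banach,second_countable_topology}) \<Rightarrow> real" and M :: real
  assumes locally_compact: "locally_compact_space (euclidean :: 'w topology)"
    and Lam_add: "\<phi> \<in> C0_space \<Longrightarrow> \<psi> \<in> C0_space \<Longrightarrow> Lam (\<lambda>x. \<phi> x + \<psi> x) = Lam \<phi> + Lam \<psi>"
    and Lam_scaleR: "\<phi> \<in> C0_space \<Longrightarrow> Lam (\<lambda>x. a *\<^sub>R \<phi> x) = a * Lam \<phi>"
    and M_nonneg: "0 \<le> M"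
    and Lam_bound: "\<phi> \<in> C0_space \<Longrightarrow> (\<And>x. norm (\<phi> x) \<le> c) \<Longrightarrow> Lam \<phi> \<le> M * c"
begin

lemma Lam_zero[simp]: "Lam (\<lambda>x. 0) = 0"
  using Lam_scaleR[of "\<lambda>x. 0" 0] by simp

lemma Lam_diff:
  assumes "\<phi> \<in> C0_space" "\<psi> \<in> C0_space"
  shows "(\<lambda>x. \<phi> x - \<psi> x) \<in> C0_space" "Lam (\<lambda>x. \<phi> x - \<psi> x) = Lam \<phi> - Lam \<psi>"
  using C0_space_add[OF assms(1) C0_space_scaleR[OF assms(2), of "-1"]]
    Lam_add[OF assms(1) C0_space_scaleR[OF assms(2), of "-1"]] Lam_scaleR[OF assms(2), of "-1"] by simp_all

lemma Lam_sum:
  assumes "\<And>i. i \<in> I \<Longrightarrow> \<phi> i \<in> C0_space"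
  shows "Lam (\<lambda>x. \<Sum>i\<in>I. \<phi> i x) = (\<Sum>i\<in>I. Lam (\<phi> i))"
  using assms
proof (induction I rule: infinite_finite_induct)
  case (insert i I)
  then have "Lam (\<lambda>x. \<phi> i x + (\<Sum>i\<in>I. \<phi> i x)) = Lam (\<phi> i) + Lam (\<lambda>x. \<Sum>i\<in>I. \<phi> i x)"
    by (intro Lam_add C0_space_sum) auto
  then show ?case using insert by simp
qed simp_all

lemma Lam_le_soft:
  assumes "\<phi> \<in> C0_space" "0 \<le> e"
  shows "Lam \<phi> \<le> Lam (soft e \<phi>) + M * e"
proof -
  have "Lam (\<lambda>x. \<phi> x - soft e \<phi> x) \<le> M * e"
    using norm_soft_diff[of 0 e \<phi>] assms(2)
    by (intro Lam_bound Lam_diff(1) assms C0_space_soft) (auto simp: soft_zero)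
  then show ?thesis using Lam_diff(2)[OF assms(1) C0_space_soft[OF assms]] by simp
qed

text \<open>Vanishing outside \<open>V\<close> is demanded rather than compact support in
  \<open>V\<close>. Thresholding by \<open>soft\<close> recovers the missing margin: it shrinks the
  set where the function is nonzero into a compact subset of \<open>V\<close>.\<close>

definition tests :: "'w set \<Rightarrow> ('w \<Rightarrow> 'u) set" where
  "tests V = {\<phi> \<in> C0_space. (\<forall>x. norm (\<phi> x) \<le> 1) \<and> (\<forall>x. x \<notin> V \<longrightarrow> \<phi> x = 0)}"

text \<open>\<open>ennreal\<close> sends negative values to 0, which does not alter the supremum
  because the zero function is a test function. For the functional of a vector measure this is the
  expected variation of \<open>V\<close>.\<close>

definition content :: "'w set \<Rightarrow> ennreal" where
  "content V = (SUP \<phi>\<in>tests V. ennreal (Lam \<phi>))"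

lemma zero_in_tests: "(\<lambda>x. 0) \<in> tests V"
  by (simp add: tests_def)

lemma content_upper: "\<phi> \<in> tests V \<Longrightarrow> ennreal (Lam \<phi>) \<le> content V"
  unfolding content_def by (rule SUP_upper)

lemma content_mono: "V \<subseteq> W \<Longrightarrow> content V \<le> content W"
  unfolding content_def by (rule SUP_subset_mono) (auto simp: tests_def)

lemma content_le: "content V \<le> ennreal M"
  unfolding content_def
proof (rule SUP_least)
  fix \<phi> assume "\<phi> \<in> tests V"
  then have "Lam \<phi> \<le> M * 1" by (intro Lam_bound) (auto simp: tests_def)
  then show "ennreal (Lam \<phi>) \<le> ennreal M" by (intro ennreal_leI) simp
qed

lemma content_empty: "content {} = 0"
proof -
  have "\<phi> = (\<lambda>x. 0)" if "\<phi> \<in> tests {}" for \<phi> using that by (auto simp: tests_def)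
  then have "content {} \<le> 0" unfolding content_def by (intro SUP_least) force
  then show ?thesis by simp
qed

lemma soft_tests:
  assumes "\<phi> \<in> tests V" "0 \<le> e"
  shows "soft e \<phi> \<in> tests V"
proof -
  have "norm (soft e \<phi> x) \<le> 1" for x
    using norm_soft_le[OF assms(2), of \<phi> x] assms(1) by (auto simp: tests_def intro: order_trans)
  then show ?thesis
    using assms C0_space_soft[of \<phi> e] by (auto simp: tests_def soft_def)
qed

text \<open>A test function supported in a union is cut off to a compact set, on which finitely many
  Urysohn functions subordinate to the cover split it.\<close>
lemma content_subadditive:
  fixes V :: "nat \<Rightarrow> 'w set"
  assumes V: "\<And>i. open (V i)"
  shows "content (\<Union>i. V i) \<le> (\<Sum>i. content (V i))"
  unfolding content_def[of "\<Union>i. V i"]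
proof (rule SUP_least)
  fix \<phi> assume \<phi>: "\<phi> \<in> tests (\<Union>i. V i)"
  then have C0: "\<phi> \<in> C0_space" by (simp add: tests_def)
  show "ennreal (Lam \<phi>) \<le> (\<Sum>i. content (V i))"
  proof (rule ennreal_le_epsilon)
    fix e :: real assume e: "e > 0"
    \<comment> \<open>Thresholding at height \<open>t\<close> costs at most
      \<open>M * t \<le> e\<close>; the summand 1 covers \<open>M = 0\<close>.\<close>
    define t where "t = e / (M + 1)"
    have t: "t > 0" "M * t \<le> e" using e M_nonneg by (auto simp: t_def field_simps)
    define \<tau> where "\<tau> = soft t \<phi>"
    have \<tau>C0: "\<tau> \<in> C0_space" unfolding \<tau>_def using C0 t by (intro C0_space_soft) auto
    have \<tau>1: "norm (\<tau> x) \<le> 1" for x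
      using soft_tests[OF \<phi>, of t] t by (simp add: \<tau>_def tests_def)
    define K where "K = {x. t \<le> norm (\<phi> x)}"
    have K: "compact K" using C0 t by (simp add: K_def C0_space_iff)
    have \<tau>0: "\<tau> x = 0" if "x \<notin> K" for x
      using that soft_eq_0[of \<phi> x t] by (simp add: K_def \<tau>_def)
    have "\<exists>i. x \<in> V i" if "x \<in> K" for x
      using that \<phi> t by (force simp: K_def tests_def)
    then obtain idx where idx: "\<And>x. x \<in> K \<Longrightarrow> x \<in> V (idx x)" by metis
    have "\<exists>h::'w \<Rightarrow> real. continuous_on UNIV h \<and> (\<forall>y. 0 \<le> h y) \<and> h x = 1 \<and> (\<forall>y. y \<notin> V (idx x) \<longrightarrow> h y = 0)"
      if "x \<in> K" for x
      using continuous_separation_point[OF locally_compact V idx[OF that]] by metis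
    then obtain h :: "'w \<Rightarrow> 'w \<Rightarrow> real" where h: "\<And>x. x \<in> K \<Longrightarrow> continuous_on UNIV (h x)"
      "\<And>x y. x \<in> K \<Longrightarrow> 0 \<le> h x y" "\<And>x. x \<in> K \<Longrightarrow> h x x = 1"
      "\<And>x y. x \<in> K \<Longrightarrow> y \<notin> V (idx x) \<Longrightarrow> h x y = 0"
      by metis
    have "open {y. 0 < h x y}" if "x \<in> K" for x
      by (intro open_Collect_less continuous_intros h(1) that)
    moreover have "K \<subseteq> (\<Union>x\<in>K. {y. 0 < h x y})" using h(3) by force
    ultimately obtain X where X: "X \<subseteq> K" "finite X" "K \<subseteq> (\<Union>x\<in>X. {y. 0 < h x y})"
      using compactE_image[OF K, of K "\<lambda>x. {y. 0 < h x y}"] by metis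
    define H where "H y = (\<Sum>x\<in>X. h x y)" for y
    have Hcont: "continuous_on UNIV H" unfolding H_def[abs_def]
      using h(1) X(1) by (intro continuous_on_sum) auto
    have Hpos: "0 < H y" if y: "y \<in> K" for y
    proof -
      obtain x where "x \<in> X" "0 < h x y" using X(3) y by blast
      then show ?thesis unfolding H_def using h(2) X by (intro sum_pos2[of X x]) auto
    qed
    obtain \<delta> where \<delta>: "\<delta> > 0" "\<And>y. y \<in> K \<Longrightarrow> \<delta> \<le> H y"
    proof (cases "K = {}")
      case False
      then obtain y0 where "y0 \<in> K" "\<And>y. y \<in> K \<Longrightarrow> H y0 \<le> H y"
        using continuous_attains_inf[OF K, of H] continuous_on_subset[OF Hcont] by auto
      then show thesis using that[of "H y0"] Hpos by blast
    qed (use that[of 1] in auto)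
    \<comment> \<open>Several points of \<open>X\<close> may have the same cover member; their
      functions are merged, so that each \<open>V n\<close> receives one test function and its
      content is counted once.\<close>
    define hn where "hn n y = (\<Sum>x\<in>{x. x \<in> X \<and> idx x = n}. h x y)" for n y
    have hn0: "0 \<le> hn n y" for n y unfolding hn_def using h(2) X(1) by (intro sum_nonneg) auto
    have hnH: "hn n y \<le> H y" for n y unfolding hn_def H_def
      using h(2) X by (intro sum_mono2) auto
    have hncont: "continuous_on UNIV (hn n)" for n unfolding hn_def[abs_def]
      using h(1) X(1) by (intro continuous_on_sum) auto
    \<comment> \<open>The quotients of \<open>hn n\<close> by \<open>H\<close> are a partition of
      unity on \<open>K\<close>. The maximum with \<open>\<delta>\<close> changes nothing there and
      keeps the denominator positive elsewhere, where \<open>\<tau>\<close> vanishes anyway.\<close>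
    define \<psi> where "\<psi> n y = (hn n y / max \<delta> (H y)) *\<^sub>R \<tau> y" for n y
    have m0: "max \<delta> (H y) > 0" for y using \<delta>(1) by auto
    have \<psi>le: "norm (\<psi> n y) \<le> 1 * norm (\<tau> y)" for n y
    proof -
      have "\<bar>hn n y / max \<delta> (H y)\<bar> \<le> 1"
        using hn0[of n y] hnH[of n y] m0[of y] by (auto simp: divide_le_eq)
      then show ?thesis unfolding \<psi>_def norm_scaleR by (rule mult_right_mono) simp
    qed
    have \<psi>cont: "continuous_on UNIV (\<psi> n)" for n
      unfolding \<psi>_def[abs_def] using m0
      by (intro continuous_intros hncont Hcont C0_space_continuous \<tau>C0) (metis less_irrefl)
    have \<psi>C0: "\<psi> n \<in> C0_space" for n
      using C0_space_dominated[OF \<tau>C0 \<psi>cont \<psi>le] .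
    have \<psi>t: "\<psi> n \<in> tests (V n)" for n
    proof -
      have "hn n y = 0" if "y \<notin> V n" for y
        unfolding hn_def using h(4) X(1) that by (intro sum.neutral) auto
      moreover have "norm (\<psi> n y) \<le> 1" for y using \<psi>le[of n y] \<tau>1[of y] by simp
      ultimately show ?thesis using \<psi>C0 by (simp add: tests_def \<psi>_def)
    qed
    have "(\<Sum>n\<in>idx ` X. \<psi> n y) = \<tau> y" for y
    proof (cases "y \<in> K")
      case True
      have "(\<Sum>n\<in>idx ` X. hn n y) = H y"
        unfolding hn_def H_def by (rule sum.image_gen[symmetric, OF X(2)])
      moreover have "max \<delta> (H y) = H y" "H y \<noteq> 0" using \<delta>(2)[OF True] Hpos[OF True] by auto
      ultimately show ?thesis
        unfolding \<psi>_def by (simp add: scaleR_sum_left[symmetric] sum_divide_distrib[symmetric])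
    qed (simp add: \<psi>_def \<tau>0)
    then have "Lam \<tau> = (\<Sum>n\<in>idx ` X. Lam (\<psi> n))"
      using Lam_sum[of "idx ` X" \<psi>] \<psi>C0 by simp
    then have "ennreal (Lam \<tau>) \<le> (\<Sum>n\<in>idx ` X. ennreal (Lam (\<psi> n)))"
    proof -
      have "ennreal (\<Sum>n\<in>I. a n) \<le> (\<Sum>n\<in>I. ennreal (a n))" if "finite I" for I and a :: "nat \<Rightarrow> real"
        using that
      proof (induction I rule: finite_induct)
        case (insert i I)
        have "ennreal (a i + sum a I) \<le> ennreal (a i) + ennreal (sum a I)" by (rule ennreal_add_le)
        then show ?case using insert by (simp add: order_trans add_left_mono)
      qed simp
      then show ?thesis using X(2) \<open>Lam \<tau> = _\<close> by simp
    qed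
    also have "\<dots> \<le> (\<Sum>n\<in>idx ` X. content (V n))"
      by (intro sum_mono content_upper \<psi>t)
    also have "\<dots> \<le> (\<Sum>i. content (V i))"
      using X(2) by (intro sum_le_suminf summableI) auto
    finally have *: "ennreal (Lam \<tau>) \<le> (\<Sum>i. content (V i))" .
    have "ennreal (Lam \<phi>) \<le> ennreal (Lam \<tau> + e)"
      using Lam_le_soft[OF C0, of t] t by (intro ennreal_leI) (auto simp: \<tau>_def)
    also have "\<dots> \<le> ennreal (Lam \<tau>) + ennreal e" by (rule ennreal_add_le)
    also have "\<dots> \<le> (\<Sum>i. content (V i)) + ennreal e" using * by (rule add_right_mono)
    finally show "ennreal (Lam \<phi>) \<le> (\<Sum>i. content (V i)) + ennreal e" .
  qed
qed

section \<open>The outer measure generated by the content, and its Borel measure\<close>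

definition outer :: "'w set \<Rightarrow> ennreal" where
  "outer E = (INF V\<in>{V. open V \<and> E \<subseteq> V}. content V)"

lemma outer_open: "open V \<Longrightarrow> outer V = content V"
  unfolding outer_def by (intro antisym INF_lower INF_greatest content_mono) auto

lemma outer_le: "open V \<Longrightarrow> E \<subseteq> V \<Longrightarrow> outer E \<le> content V"
  unfolding outer_def by (rule INF_lower) auto

lemma outer_mono: "E \<subseteq> E' \<Longrightarrow> outer E \<le> outer E'"
  unfolding outer_def by (rule INF_superset_mono) auto

lemma outer_le_M: "outer E \<le> ennreal M"
  using outer_le[of UNIV E] content_le[of UNIV] by auto

lemma outer_approx:
  assumes "e > 0"
  obtains V where "open V" "E \<subseteq> V" "content V \<le> outer E + ennreal e"
proof -
  have "outer E < outer E + ennreal e"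
    using assms outer_le_M[of E] by (simp add: ennreal_add_left_cancel_less less_top[symmetric])
      (metis ennreal_neq_top top_unique)
  then show ?thesis unfolding outer_def[of E] INF_less_iff using that by (metis (no_types, lifting) less_imp_le mem_Collect_eq outer_def)
qed

lemma outer_measure_space_outer: "outer_measure_space (Pow UNIV) outer"
  unfolding outer_measure_space_def
proof (intro conjI)
  show "positive (Pow UNIV) outer" by (simp add: positive_def outer_open content_empty)
  show "increasing (Pow UNIV) outer" by (simp add: increasing_def outer_mono)
  show "countably_subadditive (Pow UNIV) outer"
    unfolding countably_subadditive_def
  proof (intro allI impI)
    fix A :: "nat \<Rightarrow> 'w set"
    show "outer (\<Union>i. A i) \<le> (\<Sum>i. outer (A i))"
    proof (rule ennreal_le_epsilon)
      fix e :: real assume e: "e > 0"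
      have "\<exists>V. open V \<and> A n \<subseteq> V \<and> content V \<le> outer (A n) + ennreal (e * (1/2)^Suc n)" for n
        using outer_approx[of "e * (1/2)^Suc n" "A n"] e by (metis mult_pos_pos zero_less_power half_gt_zero zero_less_one)
      then obtain V where V: "\<And>n. open (V n)" "\<And>n. A n \<subseteq> V n"
        "\<And>n. content (V n) \<le> outer (A n) + ennreal (e * (1/2)^Suc n)" by metis
      have "outer (\<Union>i. A i) \<le> content (\<Union>i. V i)"
        using V(1,2) by (intro outer_le) auto
      also have "\<dots> \<le> (\<Sum>i. content (V i))" by (rule content_subadditive[OF V(1)])
      also have "\<dots> \<le> (\<Sum>i. outer (A i) + ennreal (e * (1/2)^Suc i))"
        by (intro suminf_le summableI V(3))
      also have "\<dots> = (\<Sum>i. outer (A i)) + (\<Sum>i. ennreal (e * (1/2)^Suc i))"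
        by (intro suminf_add[symmetric] summableI)
      also have "(\<Sum>i. ennreal (e * (1/2)^Suc i)) = ennreal e"
      proof -
        have "(\<lambda>i. e * (1/2)^Suc i) sums (e * 1)" by (intro sums_mult power_half_series)
        then have "(\<lambda>i. ennreal (e * (1/2)^Suc i)) sums ennreal e" using e by (subst sums_ennreal) auto
        then show ?thesis by (simp add: sums_iff)
      qed
      finally show "outer (\<Union>i. A i) \<le> (\<Sum>i. outer (A i)) + ennreal e" .
    qed
  qed
qed

text \<open>The half of Caratheodory's condition with content. A test function for
  \<open>W \<inter> V\<close>, once thresholded, vanishes off a closed
  \<open>K \<subseteq> V\<close>; any test function for the open set \<open>W - K\<close> then lives
  where it vanishes, so their sum still has norm at most 1 and is a test function for
  \<open>W\<close>. Finally \<open>W - K\<close> contains \<open>W - V\<close>.\<close>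

lemma content_split:
  assumes W: "open W" and V: "open V"
  shows "content (W \<inter> V) + outer (W - V) \<le> content W"
  unfolding content_def[of "W \<inter> V"] 
proof (subst ennreal_SUP_add_left[symmetric])
  show "tests (W \<inter> V) \<noteq> {}" using zero_in_tests by blast
  show "(SUP \<phi>\<in>tests (W \<inter> V). ennreal (Lam \<phi>) + outer (W - V)) \<le> content W"
  proof (rule SUP_least)
    fix \<phi> assume \<phi>: "\<phi> \<in> tests (W \<inter> V)"
    then have C0: "\<phi> \<in> C0_space" by (simp add: tests_def)
    show "ennreal (Lam \<phi>) + outer (W - V) \<le> content W"
    proof (rule ennreal_le_epsilon)
      fix e :: real assume e: "e > 0"
      define t where "t = e / (M + 1)"
      have t: "t > 0" "M * t \<le> e" using e M_nonneg by (auto simp: t_def field_simps)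
      define \<tau> where "\<tau> = soft t \<phi>"
      have \<tau>: "\<tau> \<in> tests (W \<inter> V)" using soft_tests[OF \<phi>, of t] t by (simp add: \<tau>_def)
      define K where "K = {x. t \<le> norm (\<phi> x)}"
      have K: "closed K" unfolding K_def
        by (intro closed_Collect_le continuous_intros C0_space_continuous C0)
      have KV: "K \<subseteq> V" using \<phi> t by (force simp: K_def tests_def)
      have \<tau>0: "\<tau> x = 0" if "x \<notin> K" for x
        using that soft_eq_0[of \<phi> x t] by (simp add: K_def \<tau>_def)
      have \<tau>W: "\<tau> \<in> tests W" using \<tau> by (auto simp: tests_def)
      have "ennreal (Lam \<tau>) + content (W - K) \<le> content W"
        unfolding content_def[of "W - K"]
      proof (subst ennreal_SUP_add_right)
        show "tests (W - K) \<noteq> {}" using zero_in_tests by blast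
        show "(SUP \<psi>\<in>tests (W - K). ennreal (Lam \<tau>) + ennreal (Lam \<psi>)) \<le> content W"
        proof (rule SUP_least)
          fix \<psi> assume \<psi>: "\<psi> \<in> tests (W - K)"
          then have \<psi>W: "\<psi> \<in> tests W" by (auto simp: tests_def)
          have "(\<lambda>x. \<tau> x + \<psi> x) \<in> tests W"
          proof -
            have "norm (\<tau> x + \<psi> x) \<le> 1" for x
              using \<tau>0[of x] \<tau> \<psi> by (cases "x \<in> K") (auto simp: tests_def)
            then show ?thesis using \<tau>W \<psi>W by (auto simp: tests_def intro: C0_space_add)
          qed
          then have 1: "ennreal (Lam \<tau> + Lam \<psi>) \<le> content W"
            using content_upper[of "\<lambda>x. \<tau> x + \<psi> x" W] Lam_add[of \<tau> \<psi>] \<tau> \<psi> by (simp add: tests_def)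
          \<comment> \<open>Because \<open>ennreal\<close> truncates at 0, it is additive only on
            nonnegative values; if one value is negative its summand is 0 and the other test
            function alone suffices.\<close>
          consider "0 \<le> Lam \<tau>" "0 \<le> Lam \<psi>" | "Lam \<tau> < 0" | "Lam \<psi> < 0" by linarith
          then show "ennreal (Lam \<tau>) + ennreal (Lam \<psi>) \<le> content W"
          proof cases
            case 1
            then show ?thesis using \<open>ennreal (Lam \<tau> + Lam \<psi>) \<le> content W\<close> by simp
          next
            case 2
            then show ?thesis using content_upper[OF \<psi>W] by (simp add: ennreal_neg)
          next
            case 3
            then show ?thesis using content_upper[OF \<tau>W] by (simp add: ennreal_neg)
          qed
        qed
      qed
      moreover have "outer (W - V) \<le> content (W - K)"
        using KV W K by (intro outer_le open_Diff) auto
      ultimately have *: "ennreal (Lam \<tau>) + outer (W - V) \<le> content W"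
        by (meson add_left_mono order_trans)
      have "ennreal (Lam \<phi>) \<le> ennreal (Lam \<tau> + e)"
        using Lam_le_soft[OF C0, of t] t by (intro ennreal_leI) (auto simp: \<tau>_def)
      also have "\<dots> \<le> ennreal (Lam \<tau>) + ennreal e" by (rule ennreal_add_le)
      finally have "ennreal (Lam \<phi>) + outer (W - V) \<le> (ennreal (Lam \<tau>) + outer (W - V)) + ennreal e"
        by (simp add: add_ac add_left_mono)
      also have "\<dots> \<le> content W + ennreal e" using * by (rule add_right_mono)
      finally show "ennreal (Lam \<phi>) + outer (W - V) \<le> content W + ennreal e" .
    qed
  qed
qed

lemma open_in_lambda_system:
  assumes V: "open V"
  shows "V \<in> lambda_system UNIV (Pow UNIV) outer"
proof -
  interpret P: sigma_algebra UNIV "Pow UNIV :: 'w set set" by (rule sigma_algebra_Pow)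
  have "outer (E \<inter> V) + outer (E - V) = outer E" for E
  proof (rule antisym)
    show "outer (E \<inter> V) + outer (E - V) \<le> outer E"
      unfolding outer_def[of E]
    proof (rule INF_greatest)
      fix W assume "W \<in> {V. open V \<and> E \<subseteq> V}"
      then have W: "open W" "E \<subseteq> W" by auto
      have "outer (E \<inter> V) + outer (E - V) \<le> content (W \<inter> V) + outer (W - V)"
        using W V by (intro add_mono outer_le outer_mono) auto
      also have "\<dots> \<le> content W" by (rule content_split[OF W(1) V])
      finally show "outer (E \<inter> V) + outer (E - V) \<le> content W" .
    qed
    have "subadditive (Pow UNIV) outer"
      using outer_measure_space_outer P.countably_subadditive_subadditive
      by (auto simp: outer_measure_space_def)
    then have "outer ((E \<inter> V) \<union> (E - V)) \<le> outer (E \<inter> V) + outer (E - V)"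
      by (rule subadditiveD) auto
    moreover have "(E \<inter> V) \<union> (E - V) = E" by auto
    ultimately show "outer E \<le> outer (E \<inter> V) + outer (E - V)" by simp
  qed
  then show ?thesis unfolding P.lambda_system_eq by simp
qed

definition riesz :: "'w measure" where
  "riesz = measure_of UNIV (sets borel) outer"

lemma sets_riesz[simp, measurable_cong]: "sets riesz = sets borel"
  and space_riesz[simp]: "space riesz = UNIV"
  unfolding riesz_def
  by (auto simp: sets_measure_of_conv space_measure_of_conv sets.sigma_sets_eq[of borel, unfolded space_borel])

text \<open>\<open>measure_of\<close> takes the prescribed values only for a countably additive set
  function. By Caratheodory, \<open>outer\<close> is one on its \<open>lambda_system\<close>, which
  contains the open sets and hence all Borel sets.\<close>

lemma emeasure_riesz:
  assumes A: "A \<in> sets borel"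
  shows "emeasure riesz A = outer A"
proof -
  interpret P: sigma_algebra UNIV "Pow UNIV :: 'w set set" by (rule sigma_algebra_Pow)
  let ?L = "lambda_system UNIV (Pow UNIV) outer"
  have ms: "measure_space UNIV ?L outer"
    by (rule P.caratheodory_lemma[OF outer_measure_space_outer])
  then interpret L: sigma_algebra UNIV ?L by (simp add: measure_space_def)
  have sub: "sets borel \<subseteq> ?L"
  proof -
    have "sigma_sets UNIV {S :: 'w set. open S} \<subseteq> ?L"
      using open_in_lambda_system by (intro L.sigma_sets_subset) (auto simp del: Pow_UNIV)
    moreover have "sets borel = sigma_sets UNIV {S :: 'w set. open S}" by (simp add: borel_def)
    ultimately show ?thesis by (simp only:)
  qed
  have ca: "countably_additive (sets borel) outer"
    using ms sub unfolding measure_space_def countably_additive_def by (meson order_trans subsetD)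
  show ?thesis
    unfolding riesz_def
  proof (rule emeasure_measure_of_sigma[OF _ _ ca A])
    show "sigma_algebra UNIV (sets (borel :: 'w measure))"
      using sets.sigma_algebra_axioms[of borel] by simp
    show "positive (sets borel) outer" by (simp add: positive_def outer_open content_empty)
  qed
qed

lemma finite_measure_riesz: "finite_measure riesz"
proof (rule finite_measureI)
  show "emeasure riesz (space riesz) \<noteq> \<infinity>"
    using outer_le_M[of UNIV] by (auto simp: emeasure_riesz top_unique)
qed

lemma measure_riesz_le: "measure riesz UNIV \<le> M"
  using outer_le_M[of UNIV] M_nonneg by (simp add: measure_def emeasure_riesz enn2real_leI)

section \<open>Domination of the functional by the measure\<close>

lemma Lam_le_measure:
  assumes "open V" "\<phi> \<in> tests V"
  shows "Lam \<phi> \<le> measure riesz V"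
proof -
  interpret finite_measure riesz by (rule finite_measure_riesz)
  have "ennreal (Lam \<phi>) \<le> ennreal (measure riesz V)"
    using content_upper[OF assms(2)] assms(1) emeasure_riesz[of V] by (simp add: outer_open emeasure_eq_measure)
  then show ?thesis by (metis ennreal_le_iff measure_nonneg)
qed

lemma integrable_C0:
  fixes \<phi> :: "'w \<Rightarrow> 'b::{banach, second_countable_topology}"
  assumes "\<phi> \<in> C0_space"
  shows "integrable riesz \<phi>"
proof -
  interpret finite_measure riesz by (rule finite_measure_riesz)
  obtain c where "\<And>x. norm (\<phi> x) \<le> c" using C0_space_bounded[OF assms] by blast
  then show ?thesis
    using C0_space_measurable[OF assms] by (intro integrable_const_bound[of _ c]) auto
qed

text \<open>Layer-cake estimate: \<open>\<phi>\<close> is cut into slices of height \<open>1/n\<close>, the \<open>k\<close>-th of which is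
  supported in the open set where \<open>\<phi>\<close> exceeds \<open>k/n\<close> in norm.\<close>
lemma Lam_le_integral:
  assumes \<phi>: "\<phi> \<in> C0_space"
  shows "Lam \<phi> \<le> (\<integral>x. norm (\<phi> x) \<partial>riesz)"
proof -
  interpret finite_measure riesz by (rule finite_measure_riesz)
  have cont: "continuous_on UNIV \<phi>" by (rule C0_space_continuous[OF \<phi>])
  obtain c where c: "\<And>x. norm (\<phi> x) \<le> c" "c \<ge> 0" using C0_space_bounded[OF \<phi>] by blast
  have int: "integrable riesz (\<lambda>x. norm (\<phi> x))" using integrable_C0[OF \<phi>] by simp
  have est: "Lam \<phi> \<le> (\<integral>x. norm (\<phi> x) \<partial>riesz) + M * (1 / real (Suc n))" for n
  proof -
    define h where "h = 1 / real (Suc n)"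
    have h: "h > 0" by (simp add: h_def)
    obtain N :: nat where N: "c \<le> real N * h"
      using reals_Archimedean2[of "c / h"] h by (auto simp: field_simps intro: less_imp_le)
    define V where "V k = {x. real k * h < norm (\<phi> x)}" for k :: nat
    have V: "open (V k)" for k unfolding V_def
      by (intro open_Collect_less continuous_intros cont)
    define \<psi> where "\<psi> k x = soft (real k * h) \<phi> x - soft (real (Suc k) * h) \<phi> x" for k x
    have sC: "soft (real k * h) \<phi> \<in> C0_space" for k using h by (intro C0_space_soft \<phi>) simp
    have \<psi>C: "\<psi> k \<in> C0_space" for k
      using Lam_diff(1)[OF sC sC] unfolding \<psi>_def[abs_def] .
    have tel: "Lam (soft (real N * h) \<phi>) + (\<Sum>k<N. Lam (\<psi> k)) = Lam (soft (real 0 * h) \<phi>)" for N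
    proof (induction N)
      case (Suc N)
      have "Lam (\<psi> N) = Lam (soft (real N * h) \<phi>) - Lam (soft (real (Suc N) * h) \<phi>)"
        using Lam_diff(2)[OF sC sC] unfolding \<psi>_def[abs_def] .
      then show ?case using Suc by simp
    qed simp
    have "soft (real N * h) \<phi> = (\<lambda>x. 0)"
      using c(1) N by (intro ext soft_eq_0) (meson order_trans)
    then have "Lam \<phi> = (\<Sum>k<N. Lam (\<psi> k))" using tel[of N] by (simp add: soft_zero)
    also have "\<dots> \<le> (\<Sum>k<N. h * measure riesz (V k))"
    proof (rule sum_mono)
      fix k
      \<comment> \<open>Consecutive thresholds differ by \<open>h\<close>, so a slice has norm at
        most \<open>h\<close>, and it vanishes where \<open>\<phi>\<close> does not exceed the lower
        threshold.\<close>
      have "(\<lambda>x. (1 / h) *\<^sub>R \<psi> k x) \<in> tests (V k)"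
        unfolding tests_def
      proof (intro CollectI conjI allI impI C0_space_scaleR \<psi>C)
        fix x
        have "norm (\<psi> k x) \<le> real (Suc k) * h - real k * h"
          unfolding \<psi>_def using h by (intro norm_soft_diff) auto
        then have "norm (\<psi> k x) \<le> h" by (simp add: algebra_simps)
        then show "norm ((1 / h) *\<^sub>R \<psi> k x) \<le> 1" using h by (simp add: field_simps)
        assume "x \<notin> V k"
        then have "norm (\<phi> x) \<le> real k * h" "norm (\<phi> x) \<le> real (Suc k) * h"
          using h by (auto simp: V_def algebra_simps)
        then show "(1 / h) *\<^sub>R \<psi> k x = 0" by (simp only: \<psi>_def soft_eq_0) simp
      qed
      from Lam_le_measure[OF V this] have "(1 / h) * Lam (\<psi> k) \<le> measure riesz (V k)"
        by (simp add: Lam_scaleR[OF \<psi>C])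
      then show "Lam (\<psi> k) \<le> h * measure riesz (V k)" using h by (simp add: field_simps)
    qed
    also have "\<dots> = (\<integral>x. (\<Sum>k<N. h * indicator (V k) x) \<partial>riesz)"
      using V by (subst Bochner_Integration.integral_sum) (auto simp: emeasure_eq_measure)
    also have "\<dots> \<le> (\<integral>x. norm (\<phi> x) + h \<partial>riesz)"
    proof (rule integral_mono)
      show "integrable riesz (\<lambda>x. \<Sum>k<N. h * indicator (V k) x)"
        using V by (intro Bochner_Integration.integrable_sum) (auto simp: emeasure_eq_measure)
      show "integrable riesz (\<lambda>x. norm (\<phi> x) + h)" using int by simp
      fix x
      define s where "s m = (\<Sum>k<m. h * indicat_real (V k) x)" for m
      have s_Suc: "s (Suc m) = s m + h * indicat_real (V m) x" for m
        by (simp only: s_def sum.lessThan_Suc)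
      \<comment> \<open>Counting the slices that reach \<open>x\<close>. The trivial bound
        \<open>real m * h\<close> is carried along because in the case \<open>x \<in> V m\<close> it
        lies below \<open>norm (\<phi> x)\<close>, leaving exactly one further
        \<open>h\<close>.\<close>
      have "s m \<le> norm (\<phi> x) + h \<and> s m \<le> real m * h" for m
      proof (induction m)
        case (Suc m)
        show ?case
        proof (cases "x \<in> V m")
          case True
          then have "real m * h < norm (\<phi> x)" by (simp add: V_def)
          then show ?thesis using Suc True h by (simp add: s_Suc algebra_simps)
        qed (use Suc h in \<open>auto simp: s_Suc algebra_simps\<close>)
      qed (use h in \<open>simp add: s_def\<close>)
      then show "(\<Sum>k<N. h * indicat_real (V k) x) \<le> norm (\<phi> x) + h" by (simp only: s_def)
    qed
    also have "\<dots> = (\<integral>x. norm (\<phi> x) \<partial>riesz) + h * measure riesz UNIV" using int by simp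
    also have "\<dots> \<le> (\<integral>x. norm (\<phi> x) \<partial>riesz) + h * M"
      using h measure_riesz_le by simp
    finally show ?thesis by (simp add: h_def)
  qed
  have "(\<lambda>n. (\<integral>x. norm (\<phi> x) \<partial>riesz) + M * (1 / real (Suc n))) \<longlonglongrightarrow> (\<integral>x. norm (\<phi> x) \<partial>riesz) + M * 0"
    using LIMSEQ_inverse_real_of_nat by (intro tendsto_intros) (simp add: inverse_eq_divide)
  then show ?thesis using est by (intro LIMSEQ_le_const[of _ "(\<integral>x. norm (\<phi> x) \<partial>riesz)"]) auto
qed

lemma abs_Lam_le_integral:
  assumes \<phi>: "\<phi> \<in> C0_space"
  shows "\<bar>Lam \<phi>\<bar> \<le> (\<integral>x. norm (\<phi> x) \<partial>riesz)"
  using Lam_le_integral[OF \<phi>] Lam_le_integral[OF C0_space_scaleR[OF \<phi>, of "-1"]]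
    Lam_scaleR[OF \<phi>, of "-1"] by simp

text \<open>The content of an open set is approached by test functions, whose norms then
  approximate its indicator in mean: no further use of Urysohn's lemma is needed.\<close>
lemma indicator_approx:
  assumes A: "A \<in> sets borel" and e: "e > 0"
  shows "\<exists>f. f \<in> C0_space \<and> (\<integral>x. \<bar>f x - indicat_real A x\<bar> \<partial>riesz) \<le> e"
proof -
  interpret finite_measure riesz by (rule finite_measure_riesz)
  have e2: "e / 2 > 0" using e by simp
  obtain V where V: "open V" "A \<subseteq> V" "content V \<le> outer A + ennreal (e / 2)"
    using outer_approx[OF e2] .
  have Vb: "V \<in> sets borel" using V(1) by simp
  have cV: "content V = ennreal (measure riesz V)"
    using emeasure_riesz[OF Vb] V(1) by (simp add: outer_open emeasure_eq_measure)
  have "ennreal (measure riesz V) \<le> ennreal (measure riesz A) + ennreal (e / 2)"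
    using V(3) cV emeasure_riesz[OF A] by (simp add: emeasure_eq_measure)
  then have VA: "measure riesz V \<le> measure riesz A + e / 2"
    using e by (simp flip: ennreal_plus)
  have "\<exists>\<phi>\<in>tests V. measure riesz V - e / 2 < Lam \<phi>"
  proof (cases "measure riesz V - e / 2 < 0")
    case True
    then show ?thesis by (intro bexI[of _ "\<lambda>x. 0"] zero_in_tests) auto
  next
    case False
    then have "ennreal (measure riesz V - e / 2) < content V"
      unfolding cV using e by (intro ennreal_lessI) auto
    then obtain \<phi> where "\<phi> \<in> tests V" "ennreal (measure riesz V - e / 2) < ennreal (Lam \<phi>)"
      unfolding content_def less_SUP_iff by blast
    then show ?thesis using False by (auto simp: ennreal_less_iff)
  qed
  then obtain \<phi> where \<phi>: "\<phi> \<in> tests V" "measure riesz V - e / 2 < Lam \<phi>" by blast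
  then have C0: "\<phi> \<in> C0_space" by (simp add: tests_def)
  have f: "(\<lambda>x. norm (\<phi> x)) \<in> C0_space"
    using C0 C0_space_continuous[OF C0] by (intro C0_space_dominated[OF C0, where c = 1] continuous_intros) auto
  have fi: "integrable riesz (\<lambda>x. norm (\<phi> x))" by (rule integrable_C0[OF f])
  have iV: "integrable riesz (indicat_real V)" and iA: "integrable riesz (indicat_real A)"
    using Vb A by (auto simp: emeasure_eq_measure)
  have "(\<integral>x. \<bar>norm (\<phi> x) - indicat_real A x\<bar> \<partial>riesz)
      \<le> (\<integral>x. (indicat_real V x - norm (\<phi> x)) + (indicat_real V x - indicat_real A x) \<partial>riesz)"
  proof (rule integral_mono)
    fix x
    have "norm (\<phi> x) \<le> indicat_real V x" "indicat_real A x \<le> indicat_real V x"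
      using \<phi>(1) V(2) by (auto simp: tests_def indicator_def)
    then show "\<bar>norm (\<phi> x) - indicat_real A x\<bar>
        \<le> (indicat_real V x - norm (\<phi> x)) + (indicat_real V x - indicat_real A x)" by linarith
  qed (use fi iV iA in auto)
  also have "\<dots> = (measure riesz V - (\<integral>x. norm (\<phi> x) \<partial>riesz)) + (measure riesz V - measure riesz A)"
    using fi iV iA Vb A by simp
  \<comment> \<open>The layer-cake estimate converts near-maximality of \<open>Lam \<phi>\<close>
    into near-maximality of the integral of its norm.\<close>
  also have "\<dots> \<le> e" using Lam_le_integral[OF C0] \<phi>(2) VA by linarith
  finally show ?thesis using f by blast
qed

definition approx :: "'w set \<Rightarrow> nat \<Rightarrow> 'w \<Rightarrow> real" where
  "approx A n = (SOME f. f \<in> C0_space \<and> (\<integral>x. \<bar>f x - indicat_real A x\<bar> \<partial>riesz) \<le> 1 / real (Suc n))"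

lemma approx:
  assumes "A \<in> sets borel"
  shows "approx A n \<in> C0_space" "(\<integral>x. \<bar>approx A n x - indicat_real A x\<bar> \<partial>riesz) \<le> 1 / real (Suc n)"
proof -
  have "0 < 1 / real (Suc n)" by simp
  from someI_ex[OF indicator_approx[OF assms this]]
  show "approx A n \<in> C0_space" "(\<integral>x. \<bar>approx A n x - indicat_real A x\<bar> \<partial>riesz) \<le> 1 / real (Suc n)"
    unfolding approx_def by (rule conjunct1, rule conjunct2)
qed

section \<open>Extension to indicator functions and the representing vector measure\<close>

lemma C0_space_scaleR_const:
  fixes f :: "'w \<Rightarrow> real" and y :: 'u
  assumes "f \<in> C0_space"
  shows "(\<lambda>x. f x *\<^sub>R y) \<in> C0_space"
proof (rule C0_space_dominated[OF assms])
  show "continuous_on UNIV (\<lambda>x. f x *\<^sub>R y)"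
    by (intro continuous_intros C0_space_continuous assms)
  show "norm (f x *\<^sub>R y) \<le> norm y * norm (f x)" for x by simp
qed

text \<open>The value, at the indicator of \<open>A\<close> times \<open>y\<close>, of the extension
  of \<open>Lam\<close> that is continuous in the mean with respect to \<open>riesz\<close>.\<close>

definition coord :: "'w set \<Rightarrow> 'u \<Rightarrow> real" where
  "coord A y = lim (\<lambda>n. Lam (\<lambda>x. approx A n x *\<^sub>R y))"

lemma integrable_indicator_scaleR:
  assumes "A \<in> sets borel"
  shows "integrable riesz (\<lambda>x. indicat_real A x *\<^sub>R (y::'u))"
proof -
  interpret finite_measure riesz by (rule finite_measure_riesz)
  show ?thesis using assms by (simp add: emeasure_eq_measure)
qed

text \<open>\<open>Lam\<close> is dominated by the mean norm, in which the approximations of the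
  indicator form a Cauchy sequence.\<close>

lemma coord_tendsto:
  assumes A: "A \<in> sets borel"
  shows "(\<lambda>n. Lam (\<lambda>x. approx A n x *\<^sub>R y)) \<longlonglongrightarrow> coord A y"
proof -
  interpret finite_measure riesz by (rule finite_measure_riesz)
  have iA: "integrable riesz (indicat_real A)" using A by (auto simp: emeasure_eq_measure)
  have est: "\<bar>Lam (\<lambda>x. approx A m x *\<^sub>R y) - Lam (\<lambda>x. approx A n x *\<^sub>R y)\<bar>
      \<le> norm y * (1 / real (Suc m) + 1 / real (Suc n))" for m n
  proof -
    let ?f = "approx A m" and ?g = "approx A n"
    have fg: "integrable riesz ?f" "integrable riesz ?g" using integrable_C0 approx(1)[OF A] by auto
    have "\<bar>Lam (\<lambda>x. ?f x *\<^sub>R y) - Lam (\<lambda>x. ?g x *\<^sub>R y)\<bar> \<le> (\<integral>x. norm (?f x *\<^sub>R y - ?g x *\<^sub>R y) \<partial>riesz)"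
      using abs_Lam_le_integral[OF Lam_diff(1)[OF C0_space_scaleR_const C0_space_scaleR_const], OF approx(1)[OF A] approx(1)[OF A]]
        Lam_diff(2)[OF C0_space_scaleR_const C0_space_scaleR_const, OF approx(1)[OF A] approx(1)[OF A]]
      by simp
    also have "\<dots> \<le> (\<integral>x. norm y * \<bar>?f x - indicat_real A x\<bar> + norm y * \<bar>?g x - indicat_real A x\<bar> \<partial>riesz)"
    proof (rule integral_mono)
      fix x
      have "norm (?f x *\<^sub>R y - ?g x *\<^sub>R y) = norm y * \<bar>?f x - ?g x\<bar>"
        by (simp add: scaleR_diff_left[symmetric])
      also have "\<dots> \<le> norm y * (\<bar>?f x - indicat_real A x\<bar> + \<bar>?g x - indicat_real A x\<bar>)"
        by (intro mult_left_mono) auto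
      finally show "norm (?f x *\<^sub>R y - ?g x *\<^sub>R y)
          \<le> norm y * \<bar>?f x - indicat_real A x\<bar> + norm y * \<bar>?g x - indicat_real A x\<bar>"
        by (simp add: distrib_left)
    qed (use fg iA in auto)
    also have "\<dots> = norm y * ((\<integral>x. \<bar>?f x - indicat_real A x\<bar> \<partial>riesz) + (\<integral>x. \<bar>?g x - indicat_real A x\<bar> \<partial>riesz))"
      using fg iA by (simp add: distrib_left)
    also have "\<dots> \<le> norm y * (1 / real (Suc m) + 1 / real (Suc n))"
      by (intro mult_left_mono add_mono approx(2)[OF A]) simp
    finally show ?thesis .
  qed
  have "Cauchy (\<lambda>n. Lam (\<lambda>x. approx A n x *\<^sub>R y))"
  proof (rule metric_CauchyI)
    fix e :: real assume e: "e > 0"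
    have "(\<lambda>n. 2 * norm y * (1 / real (Suc n))) \<longlonglongrightarrow> 2 * norm y * 0"
      using LIMSEQ_inverse_real_of_nat by (intro tendsto_intros) (simp add: inverse_eq_divide)
    then have "eventually (\<lambda>n. 2 * norm y * (1 / real (Suc n)) < e) sequentially"
      using e by (intro order_tendstoD(2)) auto
    then obtain N where "2 * norm y * (1 / real (Suc N)) < e"
      unfolding eventually_sequentially by blast
    then have N: "norm y * (1 / real (Suc N) + 1 / real (Suc N)) < e" by (simp add: mult.commute)
    have "dist (Lam (\<lambda>x. approx A m x *\<^sub>R y)) (Lam (\<lambda>x. approx A n x *\<^sub>R y)) < e" if mn: "m \<ge> N" "n \<ge> N" for m n
    proof -
      have "norm y * (1 / real (Suc m) + 1 / real (Suc n)) \<le> norm y * (1 / real (Suc N) + 1 / real (Suc N))"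
        using mn by (intro mult_left_mono add_mono divide_left_mono) auto
      then show ?thesis using est[of m n] N unfolding dist_real_def by linarith
    qed
    then show "\<exists>N. \<forall>m\<ge>N. \<forall>n\<ge>N. dist (Lam (\<lambda>x. approx A m x *\<^sub>R y)) (Lam (\<lambda>x. approx A n x *\<^sub>R y)) < e"
      by blast
  qed
  then show ?thesis unfolding coord_def by (simp add: Cauchy_convergent_iff convergent_LIMSEQ_iff)
qed

text \<open>The extension is still dominated by the mean norm: the inequality holds with
  \<open>approx (A i) n\<close> in place of the indicators up to an error of order 1/n. With
  \<open>\<phi> = 0\<close> it bounds sums of \<open>coord\<close>; with simple functions
  approaching \<open>\<phi>\<close> it recovers \<open>Lam \<phi>\<close>.\<close>

lemma Lam_minus_coord_le:
  fixes A :: "'i \<Rightarrow> 'w set" and y :: "'i \<Rightarrow> 'u"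
  assumes \<phi>: "\<phi> \<in> C0_space" and I: "finite I" and A: "\<And>i. i \<in> I \<Longrightarrow> A i \<in> sets borel"
  shows "\<bar>Lam \<phi> - (\<Sum>i\<in>I. coord (A i) (y i))\<bar>
    \<le> (\<integral>x. norm (\<phi> x - (\<Sum>i\<in>I. indicat_real (A i) x *\<^sub>R y i)) \<partial>riesz)"
proof -
  interpret finite_measure riesz by (rule finite_measure_riesz)
  let ?s = "\<lambda>x. \<Sum>i\<in>I. indicat_real (A i) x *\<^sub>R y i"
  have si: "integrable riesz ?s"
    using A by (intro Bochner_Integration.integrable_sum integrable_indicator_scaleR) auto
  have \<phi>i: "integrable riesz \<phi>" by (rule integrable_C0[OF \<phi>])
  have iA: "integrable riesz (indicat_real (A i))" if "i \<in> I" for i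
    using A[OF that] by (auto simp: emeasure_eq_measure)
  have est: "\<bar>Lam \<phi> - (\<Sum>i\<in>I. Lam (\<lambda>x. approx (A i) n x *\<^sub>R y i))\<bar>
      \<le> (\<integral>x. norm (\<phi> x - ?s x) \<partial>riesz) + (\<Sum>i\<in>I. norm (y i) * (1 / real (Suc n)))" for n
  proof -
    let ?f = "\<lambda>i x. approx (A i) n x *\<^sub>R y i"
    have fC: "?f i \<in> C0_space" if "i \<in> I" for i
      by (intro C0_space_scaleR_const approx(1) A that)
    have SC: "(\<lambda>x. \<Sum>i\<in>I. ?f i x) \<in> C0_space" by (rule C0_space_sum) (rule fC)
    have ai: "integrable riesz (approx (A i) n)" if "i \<in> I" for i
      by (rule integrable_C0[OF approx(1)[OF A[OF that]]])
    have "\<bar>Lam \<phi> - (\<Sum>i\<in>I. Lam (?f i))\<bar> = \<bar>Lam (\<lambda>x. \<phi> x - (\<Sum>i\<in>I. ?f i x))\<bar>"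
      using Lam_diff(2)[OF \<phi> SC] Lam_sum[of I ?f, OF fC] by simp
    also have "\<dots> \<le> (\<integral>x. norm (\<phi> x - (\<Sum>i\<in>I. ?f i x)) \<partial>riesz)"
      by (rule abs_Lam_le_integral[OF Lam_diff(1)[OF \<phi> SC]])
    also have "\<dots> \<le> (\<integral>x. norm (\<phi> x - ?s x) + (\<Sum>i\<in>I. norm (y i) * \<bar>approx (A i) n x - indicat_real (A i) x\<bar>) \<partial>riesz)"
    proof (rule integral_mono)
      show "integrable riesz (\<lambda>x. norm (\<phi> x - (\<Sum>i\<in>I. ?f i x)))"
        using integrable_C0[OF Lam_diff(1)[OF \<phi> SC]] by simp
      show "integrable riesz (\<lambda>x. norm (\<phi> x - ?s x) + (\<Sum>i\<in>I. norm (y i) * \<bar>approx (A i) n x - indicat_real (A i) x\<bar>))"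
        using \<phi>i si ai iA
        by (intro Bochner_Integration.integrable_add integrable_norm Bochner_Integration.integrable_diff
            Bochner_Integration.integrable_sum integrable_mult_right integrable_abs) auto
      fix x
      have "\<phi> x - (\<Sum>i\<in>I. ?f i x) = (\<phi> x - ?s x) - (\<Sum>i\<in>I. (approx (A i) n x - indicat_real (A i) x) *\<^sub>R y i)"
        by (simp add: scaleR_diff_left sum_subtractf)
      then have "norm (\<phi> x - (\<Sum>i\<in>I. ?f i x)) \<le> norm (\<phi> x - ?s x)
          + norm (\<Sum>i\<in>I. (approx (A i) n x - indicat_real (A i) x) *\<^sub>R y i)"
        by (simp only: norm_triangle_ineq4)
      also have "norm (\<Sum>i\<in>I. (approx (A i) n x - indicat_real (A i) x) *\<^sub>R y i)
          \<le> (\<Sum>i\<in>I. norm (y i) * \<bar>approx (A i) n x - indicat_real (A i) x\<bar>)"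
        by (rule order_trans[OF norm_sum]) (simp add: mult.commute)
      finally show "norm (\<phi> x - (\<Sum>i\<in>I. ?f i x)) \<le> norm (\<phi> x - ?s x)
          + (\<Sum>i\<in>I. norm (y i) * \<bar>approx (A i) n x - indicat_real (A i) x\<bar>)" by simp
    qed
    also have "\<dots> = (\<integral>x. norm (\<phi> x - ?s x) \<partial>riesz)
        + (\<Sum>i\<in>I. norm (y i) * (\<integral>x. \<bar>approx (A i) n x - indicat_real (A i) x\<bar> \<partial>riesz))"
      using \<phi>i si ai iA
      by (subst Bochner_Integration.integral_add Bochner_Integration.integral_sum;
          auto intro!: Bochner_Integration.integrable_sum)+
    also have "\<dots> \<le> (\<integral>x. norm (\<phi> x - ?s x) \<partial>riesz) + (\<Sum>i\<in>I. norm (y i) * (1 / real (Suc n)))"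
      by (intro add_left_mono sum_mono mult_left_mono approx(2) A) auto
    finally show ?thesis .
  qed
  have inv: "(\<lambda>n. 1 / real (Suc n)) \<longlonglongrightarrow> 0"
    using LIMSEQ_inverse_real_of_nat by (simp add: inverse_eq_divide)
  show ?thesis
  proof (rule LIMSEQ_le)
    show "(\<lambda>n. \<bar>Lam \<phi> - (\<Sum>i\<in>I. Lam (\<lambda>x. approx (A i) n x *\<^sub>R y i))\<bar>)
        \<longlonglongrightarrow> \<bar>Lam \<phi> - (\<Sum>i\<in>I. coord (A i) (y i))\<bar>"
      by (intro tendsto_intros coord_tendsto A)
    have "(\<lambda>n. (\<integral>x. norm (\<phi> x - ?s x) \<partial>riesz) + (\<Sum>i\<in>I. norm (y i) * (1 / real (Suc n))))
        \<longlonglongrightarrow> (\<integral>x. norm (\<phi> x - ?s x) \<partial>riesz) + (\<Sum>i\<in>I. norm (y i) * 0)"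
      by (intro tendsto_intros inv)
    then show "(\<lambda>n. (\<integral>x. norm (\<phi> x - ?s x) \<partial>riesz) + (\<Sum>i\<in>I. norm (y i) * (1 / real (Suc n))))
        \<longlonglongrightarrow> (\<integral>x. norm (\<phi> x - ?s x) \<partial>riesz)" by simp
  qed (use est in auto)
qed

lemma coord_sum_le:
  fixes A :: "'i \<Rightarrow> 'w set" and y :: "'i \<Rightarrow> 'u"
  assumes "finite I" "\<And>i. i \<in> I \<Longrightarrow> A i \<in> sets borel"
  shows "\<bar>\<Sum>i\<in>I. coord (A i) (y i)\<bar> \<le> (\<integral>x. norm (\<Sum>i\<in>I. indicat_real (A i) x *\<^sub>R y i) \<partial>riesz)"
  using Lam_minus_coord_le[OF C0_space_zero assms] by simp

lemma coord_add:
  assumes A: "A \<in> sets borel"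
  shows "coord A (y + z) = coord A y + coord A z"
proof (rule LIMSEQ_unique[OF coord_tendsto[OF A]])
  have "Lam (\<lambda>x. approx A n x *\<^sub>R (y + z)) = Lam (\<lambda>x. approx A n x *\<^sub>R y) + Lam (\<lambda>x. approx A n x *\<^sub>R z)" for n
    using Lam_add[OF C0_space_scaleR_const C0_space_scaleR_const, OF approx(1)[OF A] approx(1)[OF A]]
    by (simp add: scaleR_add_right)
  then show "(\<lambda>n. Lam (\<lambda>x. approx A n x *\<^sub>R (y + z))) \<longlonglongrightarrow> coord A y + coord A z"
    using tendsto_add[OF coord_tendsto[OF A] coord_tendsto[OF A]] by simp
qed

lemma coord_scaleR:
  assumes A: "A \<in> sets borel"
  shows "coord A (a *\<^sub>R y) = a * coord A y"
proof (rule LIMSEQ_unique[OF coord_tendsto[OF A]])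
  have "Lam (\<lambda>x. approx A n x *\<^sub>R (a *\<^sub>R y)) = a * Lam (\<lambda>x. approx A n x *\<^sub>R y)" for n
    using Lam_scaleR[OF C0_space_scaleR_const, OF approx(1)[OF A], of a n y]
    by (simp add: mult.commute)
  then show "(\<lambda>n. Lam (\<lambda>x. approx A n x *\<^sub>R (a *\<^sub>R y))) \<longlonglongrightarrow> a * coord A y"
    using tendsto_mult[OF tendsto_const coord_tendsto[OF A]] by simp
qed

lemma coord_le:
  assumes A: "A \<in> sets borel"
  shows "\<bar>coord A y\<bar> \<le> measure riesz A * norm y"
proof -
  interpret finite_measure riesz by (rule finite_measure_riesz)
  have "\<bar>coord A y\<bar> \<le> (\<integral>x. norm (indicat_real A x *\<^sub>R y) \<partial>riesz)"
    using coord_sum_le[of "{0::nat}" "\<lambda>_. A" "\<lambda>_. y"] A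
    by (simp only: sum.insert sum.empty finite.emptyI finite.insertI empty_iff simp_thms add_0_right)
  also have "\<dots> = measure riesz A * norm y" using A by simp
  finally show ?thesis .
qed

text \<open>The Riesz vector of the functional \<open>coord A\<close>; the value 0 off the Borel
  sets is the convention built into \<open>vmeasures\<close>.\<close>

definition rep :: "'w set \<Rightarrow> 'u" where
  "rep A = (if A \<in> sets borel then SOME v. \<forall>y. coord A y = inner v y else 0)"

lemma inner_rep:
  assumes A: "A \<in> sets borel"
  shows "inner (rep A) y = coord A y"
proof -
  \<comment> \<open>With the whole space as \<open>E\<close>, the rational version is the usual
    Riesz representation theorem.\<close>
  have "\<exists>v. \<forall>y\<in>UNIV. coord A y = inner v y"
  proof (rule riesz_representation_rational)
    show "coord A y \<le> measure riesz A * norm y" for y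
      using coord_le[OF A, of y] by linarith
  qed (simp_all only: coord_add[OF A] coord_scaleR[OF A] UNIV_I UNIV_not_empty not_False_eq_True)
  then have "\<exists>v. \<forall>y. coord A y = inner v y" by (simp only: ball_UNIV)
  then have "\<forall>y. coord A y = inner (SOME v. \<forall>y. coord A y = inner v y) y"
    by (rule someI_ex)
  then have c: "coord A y = inner (SOME v. \<forall>y. coord A y = inner v y) y" by (rule spec)
  have rep_eq: "rep A = (SOME v. \<forall>y. coord A y = inner v y)"
    unfolding rep_def using A by (rule if_P)
  show ?thesis unfolding rep_eq by (rule c[symmetric])
qed

lemma norm_le_if_inner_le:
  fixes v :: 'u
  assumes "0 \<le> r" "\<And>y. inner v y \<le> r * norm y"
  shows "norm v \<le> r"
proof -
  have "norm v * norm v \<le> r * norm v"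
    using assms(2)[of v] by (simp add: power2_norm_eq_inner[symmetric] power2_eq_square)
  then show ?thesis using assms(1) by (cases "v = 0") auto
qed

lemma norm_rep_le:
  assumes A: "A \<in> sets borel"
  shows "norm (rep A) \<le> measure riesz A"
proof (rule norm_le_if_inner_le)
  show "inner (rep A) y \<le> measure riesz A * norm y" for y
    using coord_le[OF A, of y] by (simp add: inner_rep[OF A])
qed simp

text \<open>Tested against \<open>y\<close>, the remainder of the series is the extended functional
  at a simple function concentrated on the tail of the union, so its norm is at most the mass of the
  tail.\<close>

lemma rep_sums:
  assumes A: "range A \<subseteq> sets borel" and dA: "disjoint_family A"
  shows "(\<lambda>n. rep (A n)) sums rep (\<Union>n. A n)"
proof -
  interpret finite_measure riesz by (rule finite_measure_riesz)
  have Am: "A n \<in> sets borel" for n using A by auto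
  have U: "(\<Union>n. A n) \<in> sets borel" using Am by auto
  have iA: "integrable riesz (indicat_real S)" if "S \<in> sets borel" for S
    using that by (auto simp: emeasure_eq_measure)
  have est: "norm ((\<Sum>n<N. rep (A n)) - rep (\<Union>n. A n)) \<le> measure riesz (\<Union>n. A n) - (\<Sum>n<N. measure riesz (A n))" for N
  proof -
    have UN: "(\<Sum>n<N. indicat_real (A n) x) = indicat_real (\<Union>n<N. A n) x" for x
      using dA by (intro indicator_UN_disjoint[symmetric]) (auto simp: disjoint_family_on_def)
    have int: "(\<integral>x. indicat_real (\<Union>n. A n) x - (\<Sum>n<N. indicat_real (A n) x) \<partial>riesz)
        = measure riesz (\<Union>n. A n) - (\<Sum>n<N. measure riesz (A n))"
      using Am U iA by (simp add: Bochner_Integration.integral_diff Bochner_Integration.integral_sum)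
    have nn: "0 \<le> indicat_real (\<Union>n. A n) x - (\<Sum>n<N. indicat_real (A n) x)" for x
      unfolding UN by (auto simp: indicator_def)
    show ?thesis
    proof (rule norm_le_if_inner_le)
      show "0 \<le> measure riesz (\<Union>n. A n) - (\<Sum>n<N. measure riesz (A n))"
        unfolding int[symmetric] by (rule Bochner_Integration.integral_nonneg) (rule nn)
      fix y :: 'u
      \<comment> \<open>The index \<open>None\<close> stands for the whole union with coefficient
        \<open>- y\<close>, the indices \<open>Some n\<close> for the pieces with coefficient
        \<open>y\<close>; the simple function so obtained is minus \<open>y\<close> on the
        tail.\<close>
      let ?B = "\<lambda>i. case i of None \<Rightarrow> (\<Union>n. A n) | Some n \<Rightarrow> A n"
      let ?y = "\<lambda>i. case i of None \<Rightarrow> - y | Some n \<Rightarrow> y"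
      let ?I = "insert None (Some ` {..<N})"
      have sI: "(\<Sum>i\<in>?I. g i) = g None + (\<Sum>n<N. g (Some n))" for g :: "nat option \<Rightarrow> 'c::comm_monoid_add"
        by (subst sum.insert) (auto simp: sum.reindex)
      have "inner ((\<Sum>n<N. rep (A n)) - rep (\<Union>n. A n)) y = (\<Sum>i\<in>?I. coord (?B i) (?y i))"
        using coord_scaleR[OF U, of "-1" y]
        by (simp add: sI inner_diff_left inner_sum_left inner_rep[OF Am] inner_rep[OF U])
      also have "\<dots> \<le> (\<integral>x. norm (\<Sum>i\<in>?I. indicat_real (?B i) x *\<^sub>R ?y i) \<partial>riesz)"
        by (rule order_trans[OF abs_ge_self coord_sum_le]) (use Am U in auto)
      also have "\<dots> = (\<integral>x. norm y * (indicat_real (\<Union>n. A n) x - (\<Sum>n<N. indicat_real (A n) x)) \<partial>riesz)"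
      proof (intro Bochner_Integration.integral_cong refl)
        fix x
        have "(\<Sum>i\<in>?I. indicat_real (?B i) x *\<^sub>R ?y i)
            = - ((indicat_real (\<Union>n. A n) x - (\<Sum>n<N. indicat_real (A n) x)) *\<^sub>R y)"
          by (simp add: sI scaleR_diff_left scaleR_sum_left)
        then show "norm (\<Sum>i\<in>?I. indicat_real (?B i) x *\<^sub>R ?y i)
            = norm y * (indicat_real (\<Union>n. A n) x - (\<Sum>n<N. indicat_real (A n) x))"
          using nn[of x] by (simp add: mult.commute)
      qed
      also have "\<dots> = (measure riesz (\<Union>n. A n) - (\<Sum>n<N. measure riesz (A n))) * norm y"
        using int by simp
      finally show "inner ((\<Sum>n<N. rep (A n)) - rep (\<Union>n. A n)) y
          \<le> (measure riesz (\<Union>n. A n) - (\<Sum>n<N. measure riesz (A n))) * norm y" .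
    qed
  qed
  have "(\<lambda>n. measure riesz (A n)) sums measure riesz (\<Union>n. A n)"
    using A dA by (intro finite_measure_UNION) auto
  then have "(\<lambda>N. measure riesz (\<Union>n. A n) - (\<Sum>n<N. measure riesz (A n))) \<longlonglongrightarrow>
      measure riesz (\<Union>n. A n) - measure riesz (\<Union>n. A n)"
    unfolding sums_def by (intro tendsto_intros)
  then have lim0: "(\<lambda>N. measure riesz (\<Union>n. A n) - (\<Sum>n<N. measure riesz (A n))) \<longlonglongrightarrow> 0" by simp
  have "(\<lambda>N. (\<Sum>n<N. rep (A n)) - rep (\<Union>n. A n)) \<longlonglongrightarrow> 0"
    by (rule Lim_null_comparison[OF _ lim0]) (use est in simp)
  then show ?thesis unfolding sums_def by (simp add: LIM_zero_iff)
qed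

lemma total_variation_rep_le:
  assumes A: "A \<in> sets borel"
  shows "total_variation rep A \<le> emeasure riesz A"
  unfolding total_variation_def
proof (rule SUP_least, clarify)
  interpret finite_measure riesz by (rule finite_measure_riesz)
  fix P assume P: "finite P" "disjoint P" "A = \<Union>P" "P \<subseteq> sets borel"
  have "(\<Sum>B\<in>P. ennreal (norm (rep B))) \<le> (\<Sum>B\<in>P. emeasure riesz B)"
    using P norm_rep_le by (intro sum_mono) (auto simp: emeasure_eq_measure intro: ennreal_leI)
  also have "\<dots> = emeasure riesz (\<Union>B\<in>P. B)"
    using P by (intro sum_emeasure) (auto simp: disjoint_family_on_def disjoint_def)
  finally show "(\<Sum>B\<in>P. ennreal (norm (rep B))) \<le> emeasure riesz (\<Union>P)" by simp
qed

lemma rep_vmeasure: "rep \<in> vmeasures"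
proof -
  have "total_variation rep UNIV < \<infinity>"
    using total_variation_rep_le[of UNIV] finite_measure.emeasure_finite[OF finite_measure_riesz, of UNIV]
    by (simp add: less_top order_le_less_trans)
  then show ?thesis
    unfolding vmeasures_def using rep_sums by (auto simp: rep_def)
qed

lemma vm_norm_rep_le: "vm_norm rep \<le> M"
proof -
  have "total_variation rep UNIV \<le> ennreal M"
    using total_variation_rep_le[of UNIV] outer_le_M[of UNIV] by (simp add: emeasure_riesz)
  then show ?thesis using M_nonneg by (simp add: vm_norm_def enn2real_leI)
qed

text \<open>On simple functions both sides are the same sum \<open>S i\<close>. Simple functions
  \<open>s i\<close> tending to \<open>\<phi>\<close> and bounded by twice its norm then give two
  limits of \<open>S i\<close>, by dominated convergence with respect to two different measures:
  \<open>riesz\<close> for \<open>Lam\<close> and the variation of \<open>rep\<close> for the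
  pairing.\<close>

lemma vm_pair_rep:
  assumes \<phi>: "\<phi> \<in> C0_space"
  shows "vm_pair rep \<phi> = Lam \<phi>"
proof -
  let ?\<nu> = "vm_abs rep"
  interpret finite_measure riesz by (rule finite_measure_riesz)
  note \<phi>m = C0_space_measurable[OF \<phi>]
  obtain c where c: "\<And>x. norm (\<phi> x) \<le> c" "c \<ge> 0" using C0_space_bounded[OF \<phi>] by blast
  obtain g where g: "vm_density rep g" using vmeasure_density_exists[OF rep_vmeasure] by blast
  have gi: "integrable ?\<nu> g" using g by (simp add: vm_density_def)
  have gm: "g \<in> borel_measurable borel" using borel_measurable_integrable[OF gi] by simp
  obtain s where s: "\<And>i. simple_function borel (s i)" "\<And>x. (\<lambda>i. s i x) \<longlonglongrightarrow> \<phi> x"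
    "\<And>i x. dist (s i x) 0 \<le> 2 * dist (\<phi> x) 0"
    using borel_measurable_implies_sequence_metric[OF \<phi>m, of 0] by auto
  have sm: "s i \<in> borel_measurable borel" for i
    using s(1) by (rule borel_measurable_simple_function)
  have sb: "norm (s i x) \<le> 2 * c" for i x using s(3)[of i x] c(1)[of x] by simp
  define S where "S i = (\<Sum>y\<in>range (s i). coord (s i -` {y}) y)" for i
  have fin: "finite (range (s i))" for i using s(1)[of i] by (simp add: simple_function_def)
  have pre: "s i -` {y} \<in> sets borel" for i y
    using measurable_sets[OF sm, of "{y}" i] by simp
  have dec: "s i x = (\<Sum>y\<in>range (s i). indicat_real (s i -` {y}) x *\<^sub>R y)" for i x
  proof -
    have "(\<Sum>y\<in>range (s i). indicat_real (s i -` {y}) x *\<^sub>R y) = (\<Sum>y\<in>{s i x}. indicat_real (s i -` {y}) x *\<^sub>R y)"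
      using fin by (intro sum.mono_neutral_right) (auto simp: indicator_def)
    then show ?thesis by simp
  qed
  have lim1: "S \<longlonglongrightarrow> Lam \<phi>"
  proof -
    have est: "norm (S i - Lam \<phi>) \<le> (\<integral>x. norm (\<phi> x - s i x) \<partial>riesz)" for i
      using Lam_minus_coord_le[OF \<phi> fin[of i], of "\<lambda>y. s i -` {y}" "\<lambda>y. y"] pre
      by (simp add: S_def dec[symmetric] abs_minus_commute)
    have "(\<lambda>i. \<integral>x. norm (\<phi> x - s i x) \<partial>riesz) \<longlonglongrightarrow> (\<integral>x. 0 \<partial>riesz)"
    proof (rule integral_dominated_convergence[where w = "\<lambda>x. 3 * c"])
      show "AE x in riesz. (\<lambda>i. norm (\<phi> x - s i x)) \<longlonglongrightarrow> 0"
      proof (rule AE_I2)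
        fix x
        have "(\<lambda>i. norm (\<phi> x - s i x)) \<longlonglongrightarrow> norm (\<phi> x - \<phi> x)" by (intro tendsto_intros s(2))
        then show "(\<lambda>i. norm (\<phi> x - s i x)) \<longlonglongrightarrow> 0" by simp
      qed
      show "AE x in riesz. norm (norm (\<phi> x - s i x)) \<le> 3 * c" for i
      proof (rule AE_I2)
        fix x
        show "norm (norm (\<phi> x - s i x)) \<le> 3 * c"
          using norm_triangle_ineq4[of "\<phi> x" "s i x"] c(1)[of x] sb[of i x] by simp
      qed
    qed (use \<phi>m sm in auto)
    then have "(\<lambda>i. \<integral>x. norm (\<phi> x - s i x) \<partial>riesz) \<longlonglongrightarrow> 0" by simp
    then have "(\<lambda>i. S i - Lam \<phi>) \<longlonglongrightarrow> 0"
      by (rule Lim_null_comparison[rotated]) (use est in simp)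
    then show ?thesis by (simp add: LIM_zero_iff)
  qed
  have S_eq: "S i = (\<integral>x. inner (g x) (s i x) \<partial>?\<nu>)" for i
  proof -
    have "(\<integral>x. inner (g x) (s i x) \<partial>?\<nu>)
        = (\<integral>x. (\<Sum>y\<in>range (s i). inner (indicat_real (s i -` {y}) x *\<^sub>R g x) y) \<partial>?\<nu>)"
    proof (intro Bochner_Integration.integral_cong refl)
      fix x
      show "inner (g x) (s i x) = (\<Sum>y\<in>range (s i). inner (indicat_real (s i -` {y}) x *\<^sub>R g x) y)"
        by (subst dec) (simp add: inner_sum_right)
    qed
    also have "\<dots> = (\<Sum>y\<in>range (s i). inner (LINT x:(s i -` {y})|?\<nu>. g x) y)"
      unfolding set_lebesgue_integral_def
      using gi pre integrable_mult_indicator[of _ ?\<nu> g]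
      by (subst Bochner_Integration.integral_sum) (auto simp del: inner_scaleR_left)
    also have "\<dots> = S i"
      unfolding S_def using g pre by (intro sum.cong refl) (simp add: vm_density_def inner_rep[symmetric])
    finally show ?thesis by simp
  qed
  have "(\<lambda>i. \<integral>x. inner (g x) (s i x) \<partial>?\<nu>) \<longlonglongrightarrow> (\<integral>x. inner (g x) (\<phi> x) \<partial>?\<nu>)"
  proof (rule integral_dominated_convergence[where w = "\<lambda>x. norm (g x) * (2 * c)"])
    show "AE x in ?\<nu>. (\<lambda>i. inner (g x) (s i x)) \<longlonglongrightarrow> inner (g x) (\<phi> x)"
      by (intro AE_I2 tendsto_intros s(2))
    show "AE x in ?\<nu>. norm (inner (g x) (s i x)) \<le> norm (g x) * (2 * c)" for i
    proof (rule AE_I2)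
      fix x
      have "\<bar>inner (g x) (s i x)\<bar> \<le> norm (g x) * norm (s i x)" by (rule Cauchy_Schwarz_ineq2)
      also have "\<dots> \<le> norm (g x) * (2 * c)" using sb by (intro mult_left_mono) auto
      finally show "norm (inner (g x) (s i x)) \<le> norm (g x) * (2 * c)" by simp
    qed
  qed (use gi gm \<phi>m sm in auto)
  then have "S \<longlonglongrightarrow> (\<integral>x. inner (g x) (\<phi> x) \<partial>?\<nu>)" by (simp only: S_eq[symmetric])
  then have "Lam \<phi> = (\<integral>x. inner (g x) (\<phi> x) \<partial>?\<nu>)" using lim1 LIMSEQ_unique by blast
  then show ?thesis by (simp add: vm_pair_eq[OF rep_vmeasure g \<phi>m])
qed

end


subsection \<open>Interaction picture\<close>

lemma complex_structure_norm:
  assumes "complex_structure J"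
  shows "norm (J x) = norm x"
  using assms by (simp add: complex_structure_def norm_eq_sqrt_inner)

lemma complex_structure_skew:
  assumes "complex_structure J"
  shows "inner (J x) y = - inner x (J y)"
proof -
  have "inner (J (J x)) (J y) = inner (J x) y" "J (J x) = - x"
    using assms unfolding complex_structure_def by blast+
  then show ?thesis by simp
qed

lemma unitary_group_inner:
  assumes "unitary_group_generated J D A G"
  shows "inner (G t x) (G t y) = inner x y"
proof -
  have "bounded_linear (G t)" and n: "\<And>x. norm (G t x) = norm x"
    using assms by (auto simp: unitary_group_generated_def cbounded_linear_def)
  then have "G t x + G t y = G t (x + y)" by (simp add: linear_simps)
  then show ?thesis by (simp add: dot_norm n)
qed

lemma unitary_group_inverse:
  assumes "unitary_group_generated J D A G"
  shows "G s (G (- s) x) = x" "G (- s) (G s x) = x" "G (- t) (G (t - s) x) = G (- s) x"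
proof -
  have *: "G a (G b x) = G (a + b) x" "G 0 x = x" for a b x
    using assms unfolding unitary_group_generated_def by (metis comp_apply, metis id_apply)
  show "G s (G (- s) x) = x" "G (- s) (G s x) = x" "G (- t) (G (t - s) x) = G (- s) x"
    by (simp_all add: *)
qed

text \<open>Strong continuity becomes joint continuity because the operators are isometries: the
  argument is split into its limit, where strong continuity applies, and a remainder whose norm is
  preserved.\<close>

lemma unitary_group_continuous:
  assumes G: "unitary_group_generated J D A G" and h: "continuous_on S h" and k: "continuous_on S k"
  shows "continuous_on S (\<lambda>s. G (k s) (h s))"
proof -
  have lin: "bounded_linear (G t)" and n: "norm (G t x) = norm x"
    and cont: "continuous_on UNIV (\<lambda>t. G t x)" for t x
    using G by (auto simp: unitary_group_generated_def cbounded_linear_def)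
  show ?thesis
    unfolding continuous_on_def
  proof
    fix s assume s: "s \<in> S"
    have "((\<lambda>r. G (k r) (h s)) \<longlongrightarrow> G (k s) (h s)) (at s within S)"
      using continuous_on_compose2[OF cont k] s unfolding continuous_on_def by auto
    moreover have "((\<lambda>r. G (k r) (h r - h s)) \<longlongrightarrow> 0) (at s within S)"
    proof (rule Lim_null_comparison)
      show "((\<lambda>r. norm (h r - h s)) \<longlongrightarrow> 0) (at s within S)"
        using h s unfolding continuous_on_def by (simp add: tendsto_norm_zero LIM_zero)
    qed (simp add: n)
    ultimately have "((\<lambda>r. G (k r) (h s) + G (k r) (h r - h s)) \<longlongrightarrow> G (k s) (h s) + 0) (at s within S)"
      by (rule tendsto_add)
    moreover have "G (k r) (h s) + G (k r) (h r - h s) = G (k r) (h r)" for r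
      using lin[of "k r"] by (simp add: linear_simps)
    ultimately show "((\<lambda>r. G (k r) (h r)) \<longlongrightarrow> G (k s) (h s)) (at s within S)" by simp
  qed
qed

text \<open>Each -i H_l is skew for the real inner product because H_l is symmetric and commutes
  with \<open>J\<close>; conjugation by the isometries \<open>G s\<close> preserves skewness and the
  bound.\<close>

lemma skew_family_interaction:
  fixes Hs :: "'l::finite \<Rightarrow> 'h::real_inner \<Rightarrow> 'h"
  assumes J: "complex_structure J" and G: "unitary_group_generated J D A G"
    and Hs: "\<forall>l. bounded_selfadjoint J (Hs l)" and T: "T > 0"
  shows "\<exists>c. skew_family (\<lambda>l s x. G (- s) (- J (Hs l (G s x)))) c T"
proof -
  have Jl: "bounded_linear J" using J by (simp add: complex_structure_def)
  have Hl: "bounded_linear (Hs l)" and HJ: "Hs l (J x) = J (Hs l x)"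
    and Hsym: "inner (Hs l x) y = inner x (Hs l y)" for l x y
    using Hs by (auto simp: bounded_selfadjoint_def cbounded_linear_def)
  have Gl: "bounded_linear (G t)" and Gn: "norm (G t x) = norm x" for t x
    using G by (auto simp: unitary_group_generated_def cbounded_linear_def)
  have "\<exists>c. \<forall>x. norm (Hs l x) \<le> c * norm x" for l
    using bounded_linear.bounded[OF Hl] by (metis mult.commute)
  then obtain c where c: "\<And>l x. norm (Hs l x) \<le> c l * norm x" by metis
  \<comment> \<open>The sum of absolute values dominates all the individual bounds at once; the
    summand 1 makes it positive.\<close>
  define C where "C = (\<Sum>l\<in>UNIV. \<bar>c l\<bar>) + 1"
  have C: "0 < C" "c l \<le> C" for l
    unfolding C_def using member_le_sum[of l UNIV "\<lambda>l. \<bar>c l\<bar>"]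
    by (auto intro: add_nonneg_pos sum_nonneg)
  have skewJH: "inner (J (Hs l z)) z = 0" for l z
    using complex_structure_skew[OF J, of "Hs l z" z] Hsym[of l z "J z"] HJ[of l z]
      inner_commute[of z "J (Hs l z)"] by simp
  have "skew_family (\<lambda>l s x. G (- s) (- J (Hs l (G s x)))) C T"
  proof
    show "G (- s) (- J (Hs l (G s (x - y)))) = G (- s) (- J (Hs l (G s x))) - G (- s) (- J (Hs l (G s y)))" for l s x y
      using Jl Hl[of l] Gl[of s] Gl[of "- s"] by (simp add: linear_simps)
    show "norm (G (- s) (- J (Hs l (G s x)))) \<le> C * norm x" for l s x
    proof -
      have "norm (Hs l (G s x)) \<le> c l * norm (G s x)" by (rule c)
      also have "\<dots> \<le> C * norm x" unfolding Gn using C(2) by (intro mult_right_mono) auto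
      finally show ?thesis by (simp add: Gn complex_structure_norm[OF J])
    qed
    show "inner (G (- s) (- J (Hs l (G s x)))) x = 0" for l s x
    proof -
      have "inner (G (- s) (- J (Hs l (G s x)))) (G (- s) (G s x)) = 0"
        unfolding unitary_group_inner[OF G] by (simp add: skewJH)
      then show ?thesis by (simp add: unitary_group_inverse[OF G])
    qed
    show "continuous_on {0..T} (\<lambda>s. G (- s) (- J (Hs l (G s (\<phi> s)))))" if "continuous_on {0..T} \<phi>" for \<phi> l
      by (intro unitary_group_continuous[OF G] continuous_intros bounded_linear.continuous_on[OF Jl]
          bounded_linear.continuous_on[OF Hl] that)
  qed (use T C in auto)
  then show ?thesis by blast
qed

text \<open>Applying G(-t) to the mild equation turns G(t-s) into G(-s). The integrand no longer
  depends on the upper limit \<open>t\<close>, so increments over subintervals can be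
  formed.\<close>

lemma mild_solution_evolves:
  fixes Hs :: "'l::finite \<Rightarrow> 'h::real_inner \<Rightarrow> 'h"
  assumes sf: "skew_family (\<lambda>l s x. G (- s) (- J (Hs l (G s x)))) c T"
    and G: "unitary_group_generated J D A G"
    and mild: "mild_solution J G Hs psi0 T w psi"
  shows "skew_family.evolves (\<lambda>l s x. G (- s) (- J (Hs l (G s x)))) T w (\<lambda>t. G (- t) (psi t))"
    and "psi 0 = psi0"
proof -
  interpret skew_family "\<lambda>l s x. G (- s) (- J (Hs l (G s x)))" c T by (rule sf)
  have Gl: "bounded_linear (G t)" for t
    using G by (auto simp: unitary_group_generated_def cbounded_linear_def)
  have G0: "G 0 x = x" for x using G by (simp add: unitary_group_generated_def)
  have cont: "continuous_on {0..T} psi"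
    and int: "\<And>t. t \<in> {0..T} \<Longrightarrow>
      ((\<lambda>s. G (t - s) (ctrl_op J Hs (w s) (psi s))) has_integral (psi t - G t psi0)) {0..t}"
    using mild by (auto simp: mild_solution_def)
  have "((\<lambda>s. G (0 - s) (ctrl_op J Hs (w s) (psi s))) has_integral (psi 0 - G 0 psi0)) {0..0}"
    using T_pos by (intro int) auto
  moreover have "((\<lambda>s. G (0 - s) (ctrl_op J Hs (w s) (psi s))) has_integral 0) {0..0}"
    using has_integral_refl(2)[of _ "0::real"] by simp
  ultimately have "psi 0 - G 0 psi0 = 0" by (rule has_integral_unique)
  then show p0: "psi 0 = psi0" by (simp add: G0)
  have field: "field (w s) s (G (- s) (psi s)) = G (- s) (ctrl_op J Hs (w s) (psi s))" for s
    using Gl[of "- s"]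
    by (simp add: field_def ctrl_op_def unitary_group_inverse[OF G] linear_sum[OF bounded_linear.linear]
        linear_simps)
  show "evolves w (\<lambda>t. G (- t) (psi t))"
    unfolding evolves_def
  proof (intro conjI allI ballI)
    show "continuous_on {0..T} (\<lambda>t. G (- t) (psi t))"
      by (intro unitary_group_continuous[OF G] continuous_intros cont)
    fix x t assume t: "t \<in> {0..T}"
    have bl: "bounded_linear (\<lambda>y. inner (G (- t) y) x)"
      by (intro bounded_linear_compose[OF bounded_linear_inner_left Gl])
    have "((\<lambda>s. inner (G (- t) (G (t - s) (ctrl_op J Hs (w s) (psi s)))) x) has_integral
        inner (G (- t) (psi t - G t psi0)) x) {0..t}"
      using has_integral_linear[OF int[OF t] bl] by (simp add: o_def)
    moreover have "G (- t) (psi t - G t psi0) = G (- t) (psi t) - G (- 0) (psi 0)"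
      using Gl[of "- t"] by (simp add: linear_simps unitary_group_inverse[OF G] p0 G0)
    ultimately show "((\<lambda>s. inner (field (w s) s (G (- s) (psi s))) x) has_integral
        inner (G (- t) (psi t) - G (- 0) (psi 0)) x) {0..t}"
      by (simp only: field unitary_group_inverse[OF G])
  qed
qed

subsection \<open>Controls in Lebesgue spaces\<close>

lemma integrable_Lp:
  assumes p: "1 < p" and w: "w \<in> Lp_space p T"
  shows "integrable (lebesgue_on {0..T}) w"
proof (cases "p = \<infinity>")
  case True
  then obtain C where C: "AE t in lebesgue_on {0..T}. norm (w t) \<le> C" "w \<in> borel_measurable (lebesgue_on {0..T})"
    using w by (auto simp: Lp_space_def)
  have "finite_measure (lebesgue_on {0..T})" by (intro finite_measure_lebesgue_on) auto
  then show ?thesis using C by (intro finite_measure.integrable_const_bound[of _ _ C]) auto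
next
  case False
  define P where "P = real_of_ereal p"
  have P: "1 < P" "p = ereal P" using p False by (cases p; simp add: P_def)+
  have w': "w \<in> borel_measurable (lebesgue_on {0..T})" "integrable (lebesgue_on {0..T}) (\<lambda>t. norm (w t) powr P)"
    using w P by (auto simp: Lp_space_def)
  interpret finite_measure "lebesgue_on {0..T}" by (intro finite_measure_lebesgue_on) auto
  have "integrable (lebesgue_on {0..T}) (\<lambda>t. 1 + norm (w t) powr P)" using w'(2) by simp
  then show ?thesis
  proof (rule Bochner_Integration.integrable_bound[OF _ w'(1)])
    have "norm (w t) \<le> 1 + norm (w t) powr P" for t
    proof (cases "norm (w t) \<le> 1")
      case False
      then have "norm (w t) powr 1 \<le> norm (w t) powr P" using P by (intro powr_mono) auto
      then show ?thesis using False by simp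
    qed (simp add: add_increasing2)
    then show "AE t in lebesgue_on {0..T}. norm (w t) \<le> norm (1 + norm (w t) powr P)"
      by (intro AE_I2) (simp add: add_nonneg_nonneg)
  qed
qed

lemma Lp_absolutely_integrable:
  fixes w :: "real \<Rightarrow> real^'l::finite"
  assumes "1 < p" "w \<in> Lp_space p T"
  shows "w absolutely_integrable_on {0..T}"
  using integrable_Lp[OF assms] unfolding set_integrable_def
  by (subst (asm) integrable_restrict_space) auto

lemma Lp_subset_L1:
  assumes "1 < p" "w \<in> Lp_space p T"
  shows "w \<in> Lp_space 1 T"
  using integrable_Lp[OF assms] by (auto simp: Lp_space_def)

text \<open>In the pointwise bound the constant \<open>a\<close> is charged on \<open>{r..s}\<close>
  only, hence small for short intervals, whereas \<open>k\<close> is charged on all of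
  \<open>{0..T}\<close> and must be small in itself. The lemma also passes from the Lebesgue
  integral on \<open>{0..T}\<close> to the gauge integral on the subinterval.\<close>

lemma integral_interval_le:
  fixes w :: "real \<Rightarrow> 'b::euclidean_space"
  assumes w: "integrable (lebesgue_on {0..T}) w" and k: "integrable (lebesgue_on {0..T}) k" "\<And>t. 0 \<le> k t"
    and le: "AE t in lebesgue_on {0..T}. norm (w t) \<le> a + k t"
    and rs: "0 \<le> r" "r \<le> s" "s \<le> T"
  shows "integral {r..s} (\<lambda>t. norm (w t)) \<le> a * (s - r) + integral\<^sup>L (lebesgue_on {0..T}) k"
proof -
  let ?M = "lebesgue_on {0..T}" and ?i = "indicat_real {r..s}"
  have sub: "{r..s} \<subseteq> {0..T}" using rs by auto
  have im: "{r..s} \<in> sets ?M" using sub by (simp add: sets_restrict_space_iff)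
  have iw: "integrable ?M (\<lambda>t. ?i t * norm (w t))"
    using integrable_mult_indicator[OF im integrable_norm[OF w]] by simp
  interpret finite_measure ?M by (intro finite_measure_lebesgue_on) auto
  have i1: "integrable ?M (\<lambda>t. ?i t * 1)"
    using integrable_mult_indicator[OF im integrable_const[of "1::real"]] by simp
  have restr: "integral\<^sup>L ?M (\<lambda>t. ?i t * f t) = integral {r..s} f"
    if "integrable ?M (\<lambda>t. ?i t * f t)" for f
  proof -
    have "integral\<^sup>L ?M (\<lambda>t. ?i t * f t) = integral {0..T} (\<lambda>t. ?i t * f t)"
      using that by (rule lebesgue_integral_eq_integral) simp
    also have "\<dots> = integral {0..T} (\<lambda>t. if t \<in> {r..s} then f t else 0)"
      by (intro arg_cong[of _ _ "integral {0..T}"]) (auto simp: indicator_def)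
    also have "\<dots> = integral {r..s} f"
      by (simp only: integral_restrict_Int Int_absorb2[OF sub])
    finally show ?thesis .
  qed
  have "integral {r..s} (\<lambda>t. norm (w t)) = integral\<^sup>L ?M (\<lambda>t. ?i t * norm (w t))"
    by (rule restr[OF iw, symmetric])
  also have "\<dots> \<le> integral\<^sup>L ?M (\<lambda>t. a * (?i t * 1) + k t)"
  proof (rule integral_mono_AE[OF iw])
    show "integrable ?M (\<lambda>t. a * (?i t * 1) + k t)"
      using i1 k(1) by (intro Bochner_Integration.integrable_add integrable_mult_right)
    show "AE t in ?M. ?i t * norm (w t) \<le> a * (?i t * 1) + k t"
      using le by eventually_elim (auto simp: indicator_def k(2))
  qed
  also have "\<dots> = a * integral\<^sup>L ?M (\<lambda>t. ?i t * 1) + integral\<^sup>L ?M k"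
    using i1 k(1) by (simp only: Bochner_Integration.integral_add integrable_mult_right integral_mult_right_zero)
  also have "integral\<^sup>L ?M (\<lambda>t. ?i t * 1) = s - r"
    using restr[OF i1] rs by simp
  finally show ?thesis .
qed

text \<open>Instead of Hoelder's inequality: \<open>x \<le> a + a\<^bsup>1-P\<^esup> x\<^bsup>P\<^esup>\<close> for every \<open>a > 0\<close>.\<close>
lemma Lp_interval_bound:
  assumes p: "1 < p" and e: "e > 0"
  shows "\<exists>a\<ge>0. \<forall>w::real \<Rightarrow> real^'l::finite. w \<in> Lp_space p T \<longrightarrow> Lp_norm p T w \<le> R \<longrightarrow>
    (\<forall>r s. 0 \<le> r \<longrightarrow> r \<le> s \<longrightarrow> s \<le> T \<longrightarrow> integral {r..s} (\<lambda>t. norm (w t)) \<le> a * (s - r) + e)"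
proof (cases "p = \<infinity>")
  case True
  show ?thesis
  proof (intro exI[of _ "\<bar>R\<bar> + 1"] conjI allI impI)
    fix w :: "real \<Rightarrow> real^'l" and r s :: real
    assume w: "w \<in> Lp_space p T" and R: "Lp_norm p T w \<le> R" and rs: "0 \<le> r" "r \<le> s" "s \<le> T"
    let ?S = "{C. 0 \<le> C \<and> (AE t in lebesgue_on {0..T}. norm (w t) \<le> C)}"
    obtain C where C: "AE t in lebesgue_on {0..T}. norm (w t) \<le> C"
      using w True by (auto simp: Lp_space_def)
    then have "AE t in lebesgue_on {0..T}. norm (w t) \<le> max 0 C"
      by eventually_elim auto
    then have "?S \<noteq> {}" by (intro ex_in_conv[THEN iffD1] exI[of _ "max 0 C"]) simp
    \<comment> \<open>The summand 1 leaves room above the infimum, so that some essential bound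
      \<open>C'\<close> lies below \<open>\<bar>R\<bar> + 1\<close>.\<close>
    moreover have "Inf ?S < \<bar>R\<bar> + 1" using R True by (simp add: Lp_norm_def)
    ultimately obtain C' where C': "C' \<in> ?S" "C' < \<bar>R\<bar> + 1"
      using cInf_lessD[of ?S] by blast
    have "AE t in lebesgue_on {0..T}. norm (w t) \<le> C'" using C'(1) by simp
    then have "AE t in lebesgue_on {0..T}. norm (w t) \<le> (\<bar>R\<bar> + 1) + 0"
      by eventually_elim (use C'(2) in auto)
    then have "integral {r..s} (\<lambda>t. norm (w t)) \<le> (\<bar>R\<bar> + 1) * (s - r) + integral\<^sup>L (lebesgue_on {0..T}) (\<lambda>t. 0)"
      by (intro integral_interval_le integrable_Lp[OF p w] rs) auto
    then show "integral {r..s} (\<lambda>t. norm (w t)) \<le> (\<bar>R\<bar> + 1) * (s - r) + e" using e by simp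
  qed simp
next
  case False
  define P where "P = real_of_ereal p"
  have P: "1 < P" "p = ereal P" using p False by (cases p; simp add: P_def)+
  define R' where "R' = (\<bar>R\<bar> + 1) powr P"
  have R': "R' > 0" by (simp add: R'_def)
  \<comment> \<open>Solves \<open>a powr (1 - P) * R' = e\<close>, so that the term with the power
    contributes at most \<open>e\<close>.\<close>
  define a where "a = (R' / e) powr (1 / (P - 1))"
  have a: "a > 0" using R' e by (simp add: a_def)
  have aR: "a powr (1 - P) * R' = e"
  proof -
    have "1 / (P - 1) * (1 - P) = - 1" using P(1) by (simp add: field_simps)
    then have "a powr (1 - P) = (R' / e) powr (- 1)" by (simp add: a_def powr_powr)
    also have "\<dots> = e / R'" using R' e by (simp add: powr_minus field_simps)
    finally show ?thesis using R' by simp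
  qed
  show ?thesis
  proof (intro exI[of _ a] conjI allI impI)
    fix w :: "real \<Rightarrow> real^'l" and r s :: real
    assume w: "w \<in> Lp_space p T" and R: "Lp_norm p T w \<le> R" and rs: "0 \<le> r" "r \<le> s" "s \<le> T"
    let ?I = "integral\<^sup>L (lebesgue_on {0..T}) (\<lambda>t. norm (w t) powr P)"
    have wi: "integrable (lebesgue_on {0..T}) (\<lambda>t. norm (w t) powr P)"
      using w P by (auto simp: Lp_space_def)
    have I0: "0 \<le> ?I" by (rule Bochner_Integration.integral_nonneg) simp
    have "?I powr (1 / P) \<le> \<bar>R\<bar> + 1" using R P by (simp add: Lp_norm_def)
    then have "(?I powr (1 / P)) powr P \<le> R'" unfolding R'_def using P by (intro powr_mono2) auto
    then have IR: "?I \<le> R'" using P I0 by (simp add: powr_powr)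
    have "norm (w t) \<le> a + a powr (1 - P) * norm (w t) powr P" for t
    proof (cases "norm (w t) \<le> a")
      case False
      then have pos: "norm (w t) > 0" using a by linarith
      have "norm (w t) = norm (w t) powr (1 - P) * norm (w t) powr P"
        using pos by (simp flip: powr_add)
      also have "\<dots> \<le> a powr (1 - P) * norm (w t) powr P"
        using False P a by (intro mult_right_mono powr_mono2') auto
      finally show ?thesis using a by linarith
    qed (simp add: add_increasing2)
    then have "integral {r..s} (\<lambda>t. norm (w t)) \<le> a * (s - r)
        + integral\<^sup>L (lebesgue_on {0..T}) (\<lambda>t. a powr (1 - P) * norm (w t) powr P)"
      by (intro integral_interval_le integrable_Lp[OF p w] rs integrable_mult_right wi AE_I2) auto
    also have "integral\<^sup>L (lebesgue_on {0..T}) (\<lambda>t. a powr (1 - P) * norm (w t) powr P) = a powr (1 - P) * ?I"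
      by simp
    also have "\<dots> \<le> a powr (1 - P) * R'" using IR by (intro mult_left_mono) auto
    finally show "integral {r..s} (\<lambda>t. norm (w t)) \<le> a * (s - r) + e" using aR by simp
  qed (use a in simp)
qed

lemma Lp_equiintegrable:
  assumes p: "1 < p" and e: "e > 0"
  shows "\<exists>d>0. \<forall>w::real \<Rightarrow> real^'l::finite. w \<in> Lp_space p T \<longrightarrow> Lp_norm p T w \<le> R \<longrightarrow>
    (\<forall>r s. 0 \<le> r \<longrightarrow> r \<le> s \<longrightarrow> s \<le> T \<longrightarrow> s - r \<le> d \<longrightarrow> integral {r..s} (\<lambda>t. norm (w t)) \<le> e)"
proof -
  obtain a where a: "a \<ge> 0" "\<forall>w::real \<Rightarrow> real^'l. w \<in> Lp_space p T \<longrightarrow> Lp_norm p T w \<le> R \<longrightarrow>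
    (\<forall>r s. 0 \<le> r \<longrightarrow> r \<le> s \<longrightarrow> s \<le> T \<longrightarrow> integral {r..s} (\<lambda>t. norm (w t)) \<le> a * (s - r) + e / 2)"
    using Lp_interval_bound[where T = T and R = R, OF p half_gt_zero[OF e]] by blast
  show ?thesis
  proof (intro exI[of _ "e / (2 * (a + 1))"] conjI allI impI)
    show "0 < e / (2 * (a + 1))" using a(1) e by simp
    fix w :: "real \<Rightarrow> real^'l" and r s :: real
    assume w: "w \<in> Lp_space p T" "Lp_norm p T w \<le> R"
      and rs: "0 \<le> r" "r \<le> s" "s \<le> T" "s - r \<le> e / (2 * (a + 1))"
    have "integral {r..s} (\<lambda>t. norm (w t)) \<le> a * (s - r) + e / 2" using a(2) w rs by blast
    also have "a * (s - r) \<le> (a + 1) * (e / (2 * (a + 1)))" using a(1) rs by (intro mult_mono) auto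
    also have "\<dots> = e / 2" using a(1) by (simp add: field_simps)
    finally show "integral {r..s} (\<lambda>t. norm (w t)) \<le> e" by simp
  qed
qed

lemma Lp_L1_bound:
  assumes p: "1 < p" and T: "0 \<le> T"
  shows "\<exists>M. \<forall>w::real \<Rightarrow> real^'l::finite. w \<in> Lp_space p T \<longrightarrow> Lp_norm p T w \<le> R \<longrightarrow>
    integral {0..T} (\<lambda>t. norm (w t)) \<le> M"
  using Lp_interval_bound[where T = T and R = R and 'l = 'l, OF p zero_less_one] T by (meson order_refl)

text \<open>From \<open>1 < p\<close> the inverse of \<open>p\<close> is below 1, so that of
  \<open>q\<close> is positive. Finiteness of \<open>q\<close> is what places indicators of
  intervals into \<open>Lp_space q T\<close> through the integrability clause.\<close>

lemma conjugate_exponent_real: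
  fixes p q :: ereal
  assumes "1 < p" "inverse p + inverse q = 1"
  shows "q \<noteq> \<infinity>" "0 < real_of_ereal q"
proof -
  have "q \<noteq> \<infinity> \<and> 0 < real_of_ereal q"
  proof (cases p)
    case (real P)
    then have P: "1 < P" "inverse p = ereal (inverse P)" using assms(1) by auto
    then have P': "0 < inverse P" "inverse P < 1" by (auto simp: inverse_eq_divide)
    show ?thesis
    proof (cases q)
      case (real Q)
      show ?thesis
      \<comment> \<open>For \<open>Q = 0\<close> the extended inverse is infinite, which the
        relation between the exponents excludes.\<close>
      proof (cases "Q = 0")
        case False
        then have "inverse P + inverse Q = 1" using assms(2) P(2) real by simp
        then have "0 < inverse Q" using P' by linarith
        then show ?thesis using real by simp
      qed (use assms(2) P(2) real in \<open>simp add: zero_ereal_def[symmetric]\<close>)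
    qed (use assms(2) P(2) P' in auto)
  next
    case PInf
    then have "inverse q = 1" using assms(2) by simp
    then show ?thesis
      by (cases q) (auto split: if_splits simp: one_ereal_def)
  qed (use assms(1) in auto)
  then show "q \<noteq> \<infinity>" "0 < real_of_ereal q" by auto
qed

lemma Lp_space_indicator:
  assumes "0 < real_of_ereal q" "q \<noteq> \<infinity>" "t \<in> {0..T}"
  shows "(\<lambda>s. indicat_real {0..t} s *\<^sub>R axis l 1) \<in> (Lp_space q T :: (real \<Rightarrow> real^'l::finite) set)"
proof -
  interpret finite_measure "lebesgue_on {0..T}" by (intro finite_measure_lebesgue_on) auto
  have "{0..t} \<in> sets (lebesgue_on {0..T})" using assms(3) by (simp add: sets_restrict_space_iff)
  then have m: "indicat_real {0..t} \<in> borel_measurable (lebesgue_on {0..T})" by simp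
  have "integrable (lebesgue_on {0..T}) (\<lambda>s. norm (indicat_real {0..t} s *\<^sub>R (axis l 1 :: real^'l)) powr real_of_ereal q)"
  proof (rule integrable_const_bound[of _ 1])
    show "AE s in lebesgue_on {0..T}. norm (norm (indicat_real {0..t} s *\<^sub>R (axis l 1 :: real^'l)) powr real_of_ereal q) \<le> 1"
      by (intro AE_I2) (auto simp: indicator_def)
  qed (use m in measurable)
  then show ?thesis using m assms(2) by (simp add: Lp_space_def)
qed

lemma integral_indicator_inner:
  fixes w :: "real \<Rightarrow> real^'l::finite"
  assumes w: "integrable (lebesgue_on {0..T}) w" and t: "t \<in> {0..T}"
  shows "(\<integral>s. (indicat_real {0..t} s *\<^sub>R axis l 1) \<bullet> w s \<partial>lebesgue_on {0..T}) = integral {0..t} (\<lambda>s. w s $ l)"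
proof -
  have sub: "{0..t} \<subseteq> {0..T}" using t by auto
  have im: "{0..t} \<in> sets (lebesgue_on {0..T})" using sub by (simp add: sets_restrict_space_iff)
  have eq: "(\<lambda>s. (indicat_real {0..t} s *\<^sub>R axis l 1) \<bullet> w s) = (\<lambda>s. if s \<in> {0..t} then w s $ l else 0)"
    by (auto simp: indicator_def inner_axis')
  have "integrable (lebesgue_on {0..T}) (\<lambda>s. (axis l 1) \<bullet> (indicat_real {0..t} s *\<^sub>R w s))"
    using integrable_mult_indicator[OF im w] by (rule integrable_inner_right)
  moreover have "(\<lambda>s. (axis l 1) \<bullet> (indicat_real {0..t} s *\<^sub>R w s)) = (\<lambda>s. (indicat_real {0..t} s *\<^sub>R axis l 1) \<bullet> w s)"
    by simp
  ultimately have "(\<integral>s. (indicat_real {0..t} s *\<^sub>R axis l 1) \<bullet> w s \<partial>lebesgue_on {0..T})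
      = integral {0..T} (\<lambda>s. (indicat_real {0..t} s *\<^sub>R axis l 1) \<bullet> w s)"
    by (intro lebesgue_integral_eq_integral) auto
  then show ?thesis
    unfolding eq by (simp only: integral_restrict_Int Int_absorb2[OF sub])
qed

subsection \<open>Weak-star compactness\<close>

lemma vmeasure_zero: "(\<lambda>A::'w::topological_space set. 0::'u::real_normed_vector) \<in> vmeasures"
proof -
  have "total_variation (\<lambda>A::'w set. 0::'u) UNIV \<le> 0" unfolding total_variation_def by (intro SUP_least) simp
  then show ?thesis by (simp add: vmeasures_def)
qed

lemma vm_norm_nonneg: "0 \<le> vm_norm u"
  by (simp add: vm_norm_def)

text \<open>Convergence of the norms is assumed so that the limit functional is bounded by their
  limit \<open>m\<close>. The representing measure then has norm at most \<open>m\<close>, which is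
  the lower semicontinuity required later.\<close>

lemma weak_star_limit:
  fixes u :: "nat \<Rightarrow> 'w::t2_space set \<Rightarrow> 'u::{real_inner, banach, second_countable_topology}"
  assumes lc: "locally_compact_space (euclidean :: 'w topology)"
    and u: "\<And>n. u n \<in> vmeasures" and m: "(\<lambda>n. vm_norm (u n)) \<longlonglongrightarrow> m"
  shows "\<exists>v\<in>vmeasures. vm_norm v \<le> m \<and> (\<exists>F. F \<noteq> bot \<and> F \<le> sequentially \<and>
    (\<forall>\<phi>\<in>C0_space. ((\<lambda>n. vm_pair (u n) \<phi>) \<longlongrightarrow> vm_pair v \<phi>) F))"
proof -
  have "Bseq (\<lambda>n. vm_norm (u n))" using m by (intro convergent_imp_Bseq) (auto simp: convergent_def)
  then obtain R where R: "\<And>n. vm_norm (u n) \<le> R" "R > 0"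
    by (auto simp: Bseq_def abs_le_iff)
  have "\<exists>c\<ge>0. \<forall>x. norm (\<phi> x) \<le> c" if "\<phi> \<in> C0_space" for \<phi> :: "'w \<Rightarrow> 'u"
    using C0_space_bounded[OF that] by metis
  then obtain b where b: "\<And>\<phi>::'w \<Rightarrow> 'u. \<phi> \<in> C0_space \<Longrightarrow> 0 \<le> b \<phi>"
    "\<And>(\<phi>::'w \<Rightarrow> 'u) x. \<phi> \<in> C0_space \<Longrightarrow> norm (\<phi> x) \<le> b \<phi>" by metis
  \<comment> \<open>The product is taken over all functions, so the functionals are extended by 0
    off \<open>C0_space\<close>; their coordinatewise bounds place them in a compact box.\<close>
  define X where "X n \<phi> = (if \<phi> \<in> C0_space then vm_pair (u n) \<phi> else 0)" for n \<phi>
  define K where "K = PiE UNIV (\<lambda>\<phi>::'w \<Rightarrow> 'u. {- (R * \<bar>b \<phi>\<bar>)..R * \<bar>b \<phi>\<bar>})"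
  have XK: "X n \<in> K" for n
    unfolding K_def
  proof (rule PiE_I)
    fix \<phi> :: "'w \<Rightarrow> 'u"
    show "X n \<phi> \<in> {- (R * \<bar>b \<phi>\<bar>)..R * \<bar>b \<phi>\<bar>}"
    proof (cases "\<phi> \<in> C0_space")
      case True
      have "\<bar>vm_pair (u n) \<phi>\<bar> \<le> vm_norm (u n) * b \<phi>"
        by (rule abs_vm_pair_le[OF u C0_space_measurable[OF True] b(2)[OF True]])
      also have "\<dots> \<le> R * \<bar>b \<phi>\<bar>" using R b(1)[OF True] by (intro mult_mono) auto
      finally show ?thesis using True by (auto simp: X_def abs_le_iff)
    qed (use R(2) in \<open>simp add: X_def\<close>)
  qed simp
  have "compactin (product_topology (\<lambda>_. euclidean) UNIV) K"
    unfolding K_def compactin_PiE by (simp add: compactin_euclidean_iff)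
  then have "compact K" by (simp add: euclidean_product_topology)
  moreover have "filtermap X sequentially \<noteq> bot" by (simp add: filtermap_bot_iff)
  moreover have "eventually (\<lambda>x. x \<in> K) (filtermap X sequentially)" by (simp add: eventually_filtermap XK)
  ultimately obtain \<Lambda> where \<Lambda>: "inf (nhds \<Lambda>) (filtermap X sequentially) \<noteq> bot"
    unfolding compact_filter by blast
  \<comment> \<open>Pulling back the neighbourhoods of the cluster point makes it a limit along
    \<open>F\<close>; the factor \<open>sequentially\<close> ensures that ordinary limits of
    sequences persist along \<open>F\<close>.\<close>
  define F where "F = inf sequentially (filtercomap X (nhds \<Lambda>))"
  have F: "F \<noteq> bot"
  proof
    assume "F = bot"
    then have "eventually (\<lambda>n. False) F" by simp
    then obtain P Q where PQ: "eventually P sequentially" "eventually Q (nhds \<Lambda>)" "\<And>n. P n \<Longrightarrow> Q (X n) \<Longrightarrow> False"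
      unfolding F_def eventually_inf eventually_filtercomap by metis
    have "eventually (\<lambda>x. \<not> Q x) (filtermap X sequentially)"
      unfolding eventually_filtermap using PQ(1) by eventually_elim (use PQ(3) in blast)
    then have "eventually (\<lambda>x. False) (inf (nhds \<Lambda>) (filtermap X sequentially))"
      unfolding eventually_inf using PQ(2) by blast
    then show False using \<Lambda> by (simp add: eventually_False)
  qed
  have Fs: "F \<le> sequentially" by (simp add: F_def)
  have XF: "filterlim X (nhds \<Lambda>) F"
    unfolding F_def by (rule filterlim_mono[OF filterlim_filtercomap order_refl inf_le2])
  have coord: "((\<lambda>n. X n \<phi>) \<longlongrightarrow> \<Lambda> \<phi>) F" for \<phi>
  proof -
    show ?thesis
    proof (rule topological_tendstoI)
      fix S :: "real set" assume S: "open S" "\<Lambda> \<phi> \<in> S"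
      have "open ((\<lambda>x::('w \<Rightarrow> 'u) \<Rightarrow> real. x \<phi>) -` S)"
        by (rule open_vimage[OF S(1) continuous_on_product_coordinates])
      then have "eventually (\<lambda>x. x \<phi> \<in> S) (nhds \<Lambda>)"
        unfolding eventually_nhds using S(2) by (intro exI[of _ "(\<lambda>x. x \<phi>) -` S"]) auto
      then show "eventually (\<lambda>n. X n \<phi> \<in> S) F" using XF by (rule eventually_compose_filterlim)
    qed
  qed
  have lim: "((\<lambda>n. vm_pair (u n) \<phi>) \<longlongrightarrow> \<Lambda> \<phi>) F" if "\<phi> \<in> C0_space" for \<phi>
    using coord[of \<phi>] that by (simp add: X_def)
  have mF: "((\<lambda>n. vm_norm (u n)) \<longlongrightarrow> m) F" using m Fs by (rule tendsto_mono[rotated])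
  have m0: "0 \<le> m" using m vm_norm_nonneg by (intro LIMSEQ_le_const) auto
  have lin: "\<Lambda> (\<lambda>x. r *\<^sub>R \<phi> x + s *\<^sub>R \<psi> x) = r * \<Lambda> \<phi> + s * \<Lambda> \<psi>"
    if \<phi>: "\<phi> \<in> C0_space" and \<psi>: "\<psi> \<in> C0_space" for \<phi> \<psi> r s
  proof (rule tendsto_unique[OF F])
    show "((\<lambda>n. vm_pair (u n) (\<lambda>x. r *\<^sub>R \<phi> x + s *\<^sub>R \<psi> x)) \<longlongrightarrow> \<Lambda> (\<lambda>x. r *\<^sub>R \<phi> x + s *\<^sub>R \<psi> x)) F"
      by (intro lim C0_space_add C0_space_scaleR \<phi> \<psi>)
    have "vm_pair (u n) (\<lambda>x. r *\<^sub>R \<phi> x + s *\<^sub>R \<psi> x) = r * vm_pair (u n) \<phi> + s * vm_pair (u n) \<psi>" for n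
      by (rule vm_pair_linear[OF u C0_space_measurable[OF \<phi>] b(2)[OF \<phi>] C0_space_measurable[OF \<psi>] b(2)[OF \<psi>]])
    then show "((\<lambda>n. vm_pair (u n) (\<lambda>x. r *\<^sub>R \<phi> x + s *\<^sub>R \<psi> x)) \<longlongrightarrow> r * \<Lambda> \<phi> + s * \<Lambda> \<psi>) F"
      using lim[OF \<phi>] lim[OF \<psi>] by (auto intro!: tendsto_intros)
  qed
  have "C0_functional \<Lambda> m"
  proof
    show "locally_compact_space (euclidean :: 'w topology)" by (rule lc)
    show "\<Lambda> (\<lambda>x. \<phi> x + \<psi> x) = \<Lambda> \<phi> + \<Lambda> \<psi>" if "\<phi> \<in> C0_space" "\<psi> \<in> C0_space" for \<phi> \<psi>
      using lin[OF that, of 1 1] by simp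
    show "\<Lambda> (\<lambda>x. a *\<^sub>R \<phi> x) = a * \<Lambda> \<phi>" if "\<phi> \<in> C0_space" for \<phi> a
      using lin[OF that C0_space_zero, of a 0] by simp
    show "0 \<le> m" by (rule m0)
    show "\<Lambda> \<phi> \<le> m * c" if \<phi>: "\<phi> \<in> C0_space" and le: "\<And>x. norm (\<phi> x) \<le> c" for \<phi> c
    proof (rule tendsto_le[OF F _ lim[OF \<phi>]])
      show "((\<lambda>n. vm_norm (u n) * c) \<longlongrightarrow> m * c) F" by (intro tendsto_intros mF)
      have "vm_pair (u n) \<phi> \<le> vm_norm (u n) * c" for n
        using abs_vm_pair_le[OF u C0_space_measurable[OF \<phi>] le, of n] by linarith
      then show "eventually (\<lambda>n. vm_pair (u n) \<phi> \<le> vm_norm (u n) * c) F" by simp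
    qed
  qed
  then interpret C0_functional \<Lambda> m .
  show ?thesis
    using rep_vmeasure vm_norm_rep_le F Fs lim vm_pair_rep by (intro bexI[of _ rep] conjI exI[of _ F]) auto
qed


section \<open>The direct method for the control problem\<close>

theorem theorem5:
  fixes J :: "'h::{real_inner,complete_space} \<Rightarrow> 'h"
    and D0 :: "'h set" and H0 :: "'h \<Rightarrow> 'h" and G :: "real \<Rightarrow> 'h \<Rightarrow> 'h"
    and Hs :: "'l::finite \<Rightarrow> 'h \<Rightarrow> 'h"
    and T alpha :: real and psi0 :: 'h and Obs :: "'h \<Rightarrow> 'h"
    and p q :: ereal
    and B :: "('w::{topological_space,t2_space} set \<Rightarrow> 'u::{real_inner,banach,second_countable_topology})
               \<Rightarrow> real \<Rightarrow> real^'l"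
    and Bs :: "(real \<Rightarrow> real^'l) \<Rightarrow> 'w \<Rightarrow> 'u"
  assumes J: "complex_structure J"
    and H0: "selfadjoint_op J D0 H0"
    and G: "unitary_group_generated J D0 H0 G"
    and Hs: "\<forall>l. bounded_selfadjoint J (Hs l)"
    and T: "T > 0" and alpha: "alpha > 0"
    and Obs: "cbounded_linear J Obs"
    and Omega: "locally_compact_space (euclidean :: 'w topology)"
    and wellposed: "\<forall>w\<in>Lp_space 1 T. \<exists>psi. mild_solution J G Hs psi0 T w psi
                      \<and> (\<forall>phi. mild_solution J G Hs psi0 T w phi \<longrightarrow> (\<forall>t\<in>{0..T}. phi t = psi t))"
    and p: "1 < p" and q: "inverse p + inverse q = 1"
    and B: "control_operator p q T B Bs"
  shows "\<exists>psib ub. ub \<in> vmeasures \<and> mild_solution J G Hs psi0 T (B ub) psib \<and>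
           (\<forall>psi u. u \<in> vmeasures \<longrightarrow> mild_solution J G Hs psi0 T (B u) psi \<longrightarrow>
              1/2 * inner (psib T) (Obs (psib T)) + alpha * vm_norm ub
                \<le> 1/2 * inner (psi T) (Obs (psi T)) + alpha * vm_norm u)"
proof -
  define F where "F = (\<lambda>l s x. G (- s) (- J (Hs l (G s x))))"
  obtain c where sf: "skew_family F c T"
    using skew_family_interaction[OF J G Hs T] unfolding F_def by blast
  interpret S: skew_family F c T by (rule sf)
  have Gl: "bounded_linear (G t)" and Gn: "norm (G t x) = norm x" for t x
    using G by (auto simp: unitary_group_generated_def cbounded_linear_def)
  have ev: "S.evolves w (\<lambda>t. G (- t) (psi t))" and init: "psi 0 = psi0"
    if "mild_solution J G Hs psi0 T w psi" for w psi
    using mild_solution_evolves[OF sf[unfolded F_def] G that] unfolding F_def by auto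
  have endnorm: "norm (psi T) = norm psi0"
    if "mild_solution J G Hs psi0 T w psi" "w \<in> Lp_space p T" for w psi
    using S.evolves_norm[OF ev[OF that(1)] Lp_absolutely_integrable[OF p that(2)], of T] T init[OF that(1)]
    by (simp add: Gn)
  have BL: "\<And>u. u \<in> vmeasures \<Longrightarrow> B u \<in> Lp_space p T"
    and BsC: "\<And>f. f \<in> Lp_space q T \<Longrightarrow> Bs f \<in> C0_space"
    and predual: "\<And>f u. f \<in> Lp_space q T \<Longrightarrow> u \<in> vmeasures \<Longrightarrow>
      vm_pair u (Bs f) = (\<integral>t. f t \<bullet> B u t \<partial>lebesgue_on {0..T})"
    using B unfolding control_operator_def by blast+
  have "\<exists>C. \<forall>u\<in>vmeasures. Lp_norm p T (B u) \<le> C * vm_norm u"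
    using B unfolding control_operator_def by (elim conjE) assumption
  then obtain C where C: "\<And>u. u \<in> vmeasures \<Longrightarrow> Lp_norm p T (B u) \<le> C * vm_norm u"
    by blast
  have sol: "\<exists>psi. mild_solution J G Hs psi0 T (B u) psi" if "u \<in> vmeasures" for u
    using wellposed Lp_subset_L1[OF p BL[OF that]] by blast
  have Ol: "bounded_linear Obs" using Obs by (simp add: cbounded_linear_def)
  obtain k where k: "k > 0" "\<And>x. norm (Obs x) \<le> norm x * k"
    using bounded_linear.pos_bounded[OF Ol] by blast
  define P where "P = {(psi, u). u \<in> vmeasures \<and> mild_solution J G Hs psi0 T (B u) psi}"
  define cost where "cost = (\<lambda>(psi, u :: 'w set \<Rightarrow> 'u). 1/2 * inner (psi T) (Obs (psi T)) + alpha * vm_norm u)"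
  define b where "b = norm psi0 * (norm psi0 * k)"
  have low: "- b + alpha * vm_norm u \<le> cost (psi, u)" if "(psi, u) \<in> P" for psi u
  proof -
    have n: "norm (psi T) = norm psi0" using that endnorm[OF _ BL] by (auto simp: P_def)
    have "\<bar>inner (psi T) (Obs (psi T))\<bar> \<le> norm (psi T) * norm (Obs (psi T))"
      by (rule Cauchy_Schwarz_ineq2)
    also have "\<dots> \<le> b" unfolding b_def n[symmetric] by (intro mult_left_mono k(2)) simp
    finally show ?thesis by (simp add: cost_def)
  qed
  have ne: "P \<noteq> {}" using sol[OF vmeasure_zero] vmeasure_zero by (auto simp: P_def)
  have bdd: "bdd_below (cost ` P)"
  proof (rule bdd_belowI2)
    fix x assume x: "x \<in> P"
    obtain psi u where xe: "x = (psi, u)" by (cases x)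
    show "- b \<le> cost x"
      using low[of psi u] x mult_nonneg_nonneg[OF less_imp_le[OF alpha] vm_norm_nonneg[of u]]
      unfolding xe by linarith
  qed
  define m0 where "m0 = Inf (cost ` P)"
  have m0_le: "m0 \<le> cost x" if "x \<in> P" for x
    unfolding m0_def using bdd that by (intro cInf_lower) auto
  have "\<exists>x\<in>P. cost x < m0 + 1 / real (Suc n)" for n
  proof -
    have "Inf (cost ` P) < m0 + 1 / real (Suc n)" unfolding m0_def by simp
    then show ?thesis using cInf_lessD[of "cost ` P"] ne by auto
  qed
  then obtain x where x: "\<And>n. x n \<in> P" "\<And>n. cost (x n) < m0 + 1 / real (Suc n)" by metis
  define psi where "psi n = fst (x n)" for n
  define u where "u n = snd (x n)" for n
  have xe: "x n = (psi n, u n)" for n by (simp add: psi_def u_def)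
  have u: "u n \<in> vmeasures" and mild: "mild_solution J G Hs psi0 T (B (u n)) (psi n)" for n
    using x(1)[of n] by (auto simp: P_def xe)
  have costlim: "(\<lambda>n. cost (x n)) \<longlonglongrightarrow> m0"
  proof (rule tendsto_sandwich)
    show "eventually (\<lambda>n. m0 \<le> cost (x n)) sequentially" using m0_le x(1) by simp
    show "eventually (\<lambda>n. cost (x n) \<le> m0 + 1 / real (Suc n)) sequentially"
      using x(2) by (simp add: less_imp_le)
    show "(\<lambda>n. m0 + 1 / real (Suc n)) \<longlonglongrightarrow> m0"
      using tendsto_add[OF tendsto_const LIMSEQ_inverse_real_of_nat, of m0] by (simp add: inverse_eq_divide)
  qed simp
  \<comment> \<open>Obtained from the lower bound \<open>low\<close> and
    \<open>cost (x n) < m0 + 1\<close>.\<close>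
  define R where "R = (m0 + 1 + b) / alpha"
  have R: "vm_norm (u n) \<le> R" for n
  proof -
    have "1 / real (Suc n) \<le> 1" by simp
    then have "alpha * vm_norm (u n) \<le> m0 + 1 + b"
      using low[of "psi n" "u n"] x[of n] unfolding xe by linarith
    then show ?thesis using alpha by (simp add: R_def field_simps)
  qed
  \<comment> \<open>A subsequence with convergent norms comes first, so that the cost splits in the
    limit into the observable term and \<open>alpha * m\<close>; the filter is then taken along this
    subsequence.\<close>
  have "seq_compact {0..R}" by (intro compact_imp_seq_compact compact_Icc)
  then obtain m r where r: "strict_mono r" "((\<lambda>n. vm_norm (u n)) \<circ> r) \<longlonglongrightarrow> m"
    using R vm_norm_nonneg by (elim seq_compactE[where f = "\<lambda>n. vm_norm (u n)"]) auto
  have "\<exists>v\<in>vmeasures. vm_norm v \<le> m \<and> (\<exists>F. F \<noteq> bot \<and> F \<le> sequentially \<and>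
      (\<forall>\<phi>\<in>C0_space. ((\<lambda>n. vm_pair (u (r n)) \<phi>) \<longlongrightarrow> vm_pair v \<phi>) F))"
    using r(2) by (intro weak_star_limit[OF Omega] u) (simp add: o_def)
  then obtain ub A where ub: "ub \<in> vmeasures" "vm_norm ub \<le> m" and A: "A \<noteq> bot" "A \<le> sequentially"
    and weak: "\<And>\<phi>. \<phi> \<in> C0_space \<Longrightarrow> ((\<lambda>n. vm_pair (u (r n)) \<phi>) \<longlongrightarrow> vm_pair ub \<phi>) A"
    by blast
  \<comment> \<open>The candidate state is the solution for the limit control. Only its value at
    \<open>T\<close> will be identified as a limit, which is all the cost depends on.\<close>
  obtain psib where psib: "mild_solution J G Hs psi0 T (B ub) psib" using sol[OF ub(1)] by blast
  have wn: "B (u n) absolutely_integrable_on {0..T}" for n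
    by (rule Lp_absolutely_integrable[OF p BL[OF u]])
  have RB: "Lp_norm p T (B (u n)) \<le> \<bar>C\<bar> * R" for n
  proof -
    have "C * vm_norm (u n) \<le> \<bar>C\<bar> * vm_norm (u n)" by (intro mult_right_mono vm_norm_nonneg) simp
    also have "\<dots> \<le> \<bar>C\<bar> * R" by (intro mult_left_mono R) simp
    finally show ?thesis using C[OF u, of n] by simp
  qed
  obtain M where M: "\<And>n. integral {0..T} (\<lambda>t. norm (B (u n) t)) \<le> M"
    using Lp_L1_bound[OF p less_imp_le[OF T], where R = "\<bar>C\<bar> * R" and 'l = 'l] BL[OF u] RB by blast
  have lim: "((\<lambda>n. G (- T) (psi (r n) T)) \<longlongrightarrow> G (- T) (psib T)) A"
  proof (rule S.evolves_tendsto[where \<phi>n = "\<lambda>n t. G (- t) (psi (r n) t)" and \<phi> = "\<lambda>t. G (- t) (psib t)"])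
    show "S.evolves (B ub) (\<lambda>t. G (- t) (psib t))" by (rule ev[OF psib])
    show "B ub absolutely_integrable_on {0..T}" by (rule Lp_absolutely_integrable[OF p BL[OF ub(1)]])
    show "S.evolves (B (u (r n))) (\<lambda>t. G (- t) (psi (r n) t))" for n by (rule ev[OF mild])
    show "B (u (r n)) absolutely_integrable_on {0..T}" for n by (rule wn)
    show "G (- 0) (psi (r n) 0) = G (- 0) (psib 0)" for n by (simp add: init[OF mild] init[OF psib])
    show "integral {0..T} (\<lambda>t. norm (B (u (r n)) t)) \<le> M" for n by (rule M)
    show "\<exists>d>0. \<forall>n i s. 0 \<le> i \<longrightarrow> i \<le> s \<longrightarrow> s \<le> T \<longrightarrow> s - i \<le> d \<longrightarrow>
        integral {i..s} (\<lambda>t. norm (B (u (r n)) t)) \<le> e" if "e > 0" for e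
      using Lp_equiintegrable[OF p that, where R = "\<bar>C\<bar> * R" and T = T and 'l = 'l] BL[OF u] RB by blast
    show "((\<lambda>n. integral {0..t} (\<lambda>s. B (u (r n)) s $ l)) \<longlongrightarrow> integral {0..t} (\<lambda>s. B ub s $ l)) A"
      if t: "t \<in> {0..T}" for l t
    proof -
      \<comment> \<open>Through the predual relation this function tests the \<open>l\<close>-th
        component of the control on \<open>{0..t}\<close>, so weak-star convergence of the measures
        yields convergence of the primitives.\<close>
      define f where "f = (\<lambda>s. indicat_real {0..t} s *\<^sub>R (axis l 1 :: real^'l))"
      have f: "f \<in> Lp_space q T"
        unfolding f_def using conjugate_exponent_real[OF p q] t by (intro Lp_space_indicator) auto
      have "vm_pair v (Bs f) = integral {0..t} (\<lambda>s. B v s $ l)" if v: "v \<in> vmeasures" for v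
        using predual[OF f v] integral_indicator_inner[OF integrable_Lp[OF p BL[OF v]] t, of l]
        by (simp add: f_def)
      then show ?thesis using weak[OF BsC[OF f]] u ub(1) by simp
    qed
  qed
  have psilim: "((\<lambda>n. psi (r n) T) \<longlongrightarrow> psib T) A"
  proof (rule Lim_transform_eventually[of "\<lambda>n. G T (G (- T) (psi (r n) T))"])
    have "((\<lambda>n. G T (G (- T) (psi (r n) T))) \<longlongrightarrow> G T (G (- T) (psib T))) A"
      by (rule bounded_linear.tendsto[OF Gl lim])
    then show "((\<lambda>n. G T (G (- T) (psi (r n) T))) \<longlongrightarrow> psib T) A"
      by (simp add: unitary_group_inverse[OF G])
  qed (simp add: unitary_group_inverse[OF G])
  have "((\<lambda>n. cost (x (r n))) \<longlongrightarrow> 1/2 * inner (psib T) (Obs (psib T)) + alpha * m) A"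
  proof -
    have "((\<lambda>n. vm_norm (u (r n))) \<longlongrightarrow> m) A"
      using r(2) A(2) by (intro tendsto_mono[of A sequentially]) (auto simp: o_def)
    then show ?thesis unfolding xe cost_def prod.case
      by (intro tendsto_intros bounded_linear.tendsto[OF Ol] psilim)
  qed
  moreover have "((\<lambda>n. cost (x (r n))) \<longlongrightarrow> m0) A"
    using LIMSEQ_subseq_LIMSEQ[OF costlim r(1)] A(2) by (intro tendsto_mono[of A sequentially]) (auto simp: o_def)
  \<comment> \<open>The infimum is expressed exactly, with \<open>m\<close> in place of the norm of
    \<open>ub\<close>; the only loss in the limit is \<open>vm_norm ub \<le> m\<close>, which can
    only lower the cost.\<close>
  ultimately have m0: "m0 = 1/2 * inner (psib T) (Obs (psib T)) + alpha * m"
    using tendsto_unique[OF A(1)] by blast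
  have "alpha * vm_norm ub \<le> alpha * m" using alpha ub(2) by simp
  then have "1/2 * inner (psib T) (Obs (psib T)) + alpha * vm_norm ub \<le> cost (psi', u')"
    if "(psi', u') \<in> P" for psi' u'
    using m0_le[OF that] m0 by simp
  then show ?thesis using ub(1) psib by (intro exI[of _ psib] exI[of _ ub]) (auto simp: P_def cost_def)
qed

end
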